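(* Let $d \geq 1$ and $k \geq 2$ be integers and let $G = C_{2k+1}^d$ be the $d$th power of the cartesian product of the odd cycle $C_{2k+1}$ with itself. Let $\varphi$ be a proper partial edge coloring of $G$ with colors from $\{1,\dots,2d+1\}$ in which at most $2d$ edges are precolored. Then $\varphi$ can be extended to a proper $(2d+1)$-edge coloring of $G$, i.e. there is a proper edge coloring $f : E(G) \to \{1,\dots,2d+1\}$ such that $f(e) = \varphi(e)$ for every edge $e$ that is colored under $\varphi$.
   Context: $C_n$ denotes the (simple) cycle with $n$ vertices, $n \geq 3$. The cartesian product $G \square H$ of two graphs $G$ and $H$ is the graph with vertex set $V(G)\times V(H)$, where $(u,v)$ is adjacent to $(u',v')$ if and only if $u=u'$ and $vv' \in E(H)$, or $uu' \in E(G)$ and $v=v'$. $G^d$ denotes the $d$-fold cartesian product $G \square G \square \cdots \square G$ ($d$ factors). A proper partial edge coloring (edge precoloring) of $G$ is a proper edge coloring of some subset $E' \subseteq E(G)$, that is, an assignment of colors to the edges of $E'$ such that any two edges of $E'$ sharing an endpoint receive different colors; the edges of $E'$ are the precolored edges. A proper $t$-edge coloring of $G$ is a proper edge coloring of all edges of $G$ with colors from $\{1,\dots,t\}$. *)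

theory Defs
  imports Main
begin

text \<open>Undirected graphs, with an edge given as the set of its two endpoints.\<close>

datatype 'a graph = Graph (verts: "'a set") (edges: "'a set set")

definition simple_graph :: "'a graph \<Rightarrow> bool" where
  "simple_graph G \<longleftrightarrow> (\<forall>e\<in>edges G. e \<subseteq> verts G \<and> card e = 2)"

text \<open>This is the simple cycle on \<open>n\<close> vertices when \<open>n \<ge> 3\<close>.\<close>

definition cycle_graph :: "nat \<Rightarrow> nat graph" where
  "cycle_graph n = Graph {..<n} {{i, Suc i mod n} | i. i < n}"

definition cart_prod :: "'a graph \<Rightarrow> 'b graph \<Rightarrow> ('a \<times> 'b) graph" where
  "cart_prod G H = Graph (verts G \<times> verts H)
     {{(u, v), (u', v')} | u v u' v'.
        u \<in> verts G \<and> v \<in> verts H \<and> u' \<in> verts G \<and> v' \<in> verts H \<and>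
        (u = u' \<and> {v, v'} \<in> edges H \<or> {u, u'} \<in> edges G \<and> v = v')}"

definition map_graph_verts :: "('a \<Rightarrow> 'b) \<Rightarrow> 'a graph \<Rightarrow> 'b graph" where
  "map_graph_verts h G = Graph (h ` verts G) ((\<lambda>e. h ` e) ` edges G)"

text \<open>
  The type of an iterated pair would depend on the number of factors, so a vertex of the
  \<open>d\<close>-fold product is encoded as a list of length \<open>d\<close>: the pair \<open>(x, xs)\<close> is renamed to
  \<open>x # xs\<close>, which is injective.  The recursion starts at the one-vertex graph, the unit of the
  cartesian product, so that the first power is \<open>G\<close> up to renaming each vertex \<open>v\<close> to \<open>[v]\<close>.
\<close>

fun cart_power :: "'a graph \<Rightarrow> nat \<Rightarrow> 'a list graph" where
  "cart_power G 0 = Graph {[]} {}"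
| "cart_power G (Suc d) = map_graph_verts (\<lambda>(x, xs). x # xs) (cart_prod G (cart_power G d))"

definition proper_on :: "'a set set \<Rightarrow> ('a set \<Rightarrow> nat) \<Rightarrow> bool" where
  "proper_on E f \<longleftrightarrow> (\<forall>e\<in>E. \<forall>e'\<in>E. e \<noteq> e' \<and> e \<inter> e' \<noteq> {} \<longrightarrow> f e \<noteq> f e')"

definition proper_edge_coloring :: "'a graph \<Rightarrow> nat \<Rightarrow> ('a set \<Rightarrow> nat) \<Rightarrow> bool" where
  "proper_edge_coloring G t f \<longleftrightarrow> f ` edges G \<subseteq> {1..t} \<and> proper_on (edges G) f"

text \<open>The precolored edges are those in \<open>dom \<phi>\<close>.\<close>

definition proper_partial_edge_coloring ::
    "'a graph \<Rightarrow> nat \<Rightarrow> ('a set \<Rightarrow> nat option) \<Rightarrow> bool" where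
  "proper_partial_edge_coloring G t \<phi> \<longleftrightarrow>
     dom \<phi> \<subseteq> edges G \<and> ran \<phi> \<subseteq> {1..t} \<and> proper_on (dom \<phi>) (\<lambda>e. the (\<phi> e))"

lemma simple_cycle_graph:
  assumes "n \<ge> 3"
  shows "simple_graph (cycle_graph n)"
proof -
  have "i \<noteq> Suc i mod n" if "i < n" for i
    using that assms by (cases "Suc i = n") auto
  then show ?thesis
    using assms by (auto simp: simple_graph_def cycle_graph_def)
qed

lemma card_edges_cycle_graph:
  assumes "n \<ge> 3"
  shows "card (edges (cycle_graph n)) = n"
proof -
  have "inj_on (\<lambda>i. {i, Suc i mod n}) {..<n}"
  proof (rule inj_onI)
    fix i j assume *: "i \<in> {..<n}" "j \<in> {..<n}" "{i, Suc i mod n} = {j, Suc j mod n}"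
    show "i = j"
      using * assms by (cases "Suc i = n"; cases "Suc j = n") (auto simp: doubleton_eq_iff)
  qed
  moreover have "edges (cycle_graph n) = (\<lambda>i. {i, Suc i mod n}) ` {..<n}"
    by (auto simp: cycle_graph_def)
  ultimately show ?thesis
    by (simp add: card_image)
qed

lemma simple_cart_prod:
  assumes "simple_graph G" "simple_graph H"
  shows "simple_graph (cart_prod G H)"
proof -
  have "x \<noteq> y" if "{x, y} \<in> edges G" for x y
    using assms(1) that by (force simp: simple_graph_def)
  moreover have "x \<noteq> y" if "{x, y} \<in> edges H" for x y
    using assms(2) that by (force simp: simple_graph_def)
  ultimately show ?thesis
    by (fastforce simp: simple_graph_def cart_prod_def card_2_iff)
qed

lemma simple_map_graph_verts:
  assumes "simple_graph G" "inj h"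
  shows "simple_graph (map_graph_verts h G)"
  using assms by (auto simp: simple_graph_def map_graph_verts_def card_image inj_on_subset)

lemma simple_cart_power:
  assumes "simple_graph G"
  shows "simple_graph (cart_power G d)"
proof (induction d)
  case 0
  show ?case by (simp add: simple_graph_def)
next
  case (Suc d)
  show ?case
    unfolding cart_power.simps
    by (intro simple_map_graph_verts simple_cart_prod assms Suc) (auto intro: injI)
qed

lemma verts_cart_power: "verts (cart_power G d) = {xs. length xs = d \<and> set xs \<subseteq> verts G}"
proof (induction d)
  case (Suc d)
  show ?case
    using Suc by (auto simp: map_graph_verts_def cart_prod_def length_Suc_conv image_iff)
qed auto

lemma finite_edges_cart_power:
  assumes "simple_graph G" "finite (verts G)"
  shows "finite (edges (cart_power G d))"
proof (rule finite_subset)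
  show "edges (cart_power G d) \<subseteq> Pow (verts (cart_power G d))"
    using simple_cart_power[OF assms(1)] by (auto simp: simple_graph_def)
  show "finite (Pow (verts (cart_power G d)))"
    using finite_lists_length_eq[OF assms(2)]
    by (simp add: verts_cart_power conj_commute)
qed

end

theory Submission
  imports Defs
begin

text \<open>Add to every vertex \<open>v\<close> the singleton \<open>{v}\<close> as a further item, whose colour stands for the
colour that no edge at \<open>v\<close> has. In the \<open>d\<close>-th power of a cycle every vertex then lies on \<open>2 d + 1\<close>
items, namely \<open>2 d\<close> edges and one singleton, and a proper edge colouring with \<open>2 d + 1\<close> colours is
the same as a proper colouring of the items. The theorem follows from a stronger statement
(\<open>extendable_cycle_power\<close>): every proper partial colouring of at most \<open>2 d\<close> items extends to all
items. Allowing singletons is what makes the induction on \<open>d\<close> work.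

For the step, the power of exponent \<open>d + 1\<close> is seen as a cyclic arrangement of layers, each a copy
of the \<open>d\<close>-th power, with a perfect matching between consecutive layers; put \<open>h = 2 d\<close>, so there
are \<open>h + 3\<close> colours. Choose one colour for each matching, different for consecutive matchings
(\<open>walk\<close>). A layer then has \<open>h + 1\<close> colours left and can be coloured by the induction hypothesis,
independently of the other layers, as long as at most \<open>h\<close> of its items are prescribed and no
prescribed item has one of the two excluded colours (\<open>color_along_walk\<close>).

What remains is repaired by a Kempe exchange (\<open>swap\<close>). Suppose that an item \<open>e\<close> has the same
colour in two consecutive layers, and that the matching edges at the vertices of \<open>e\<close> all have the
colour \<open>s\<close>: then the two copies of \<open>e\<close> may take the colour \<open>s\<close> and the matching edges the colour of
\<open>e\<close>. This serves two purposes. A layer with more than \<open>h\<close> prescribed items is relieved of all items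
of one colour \<open>s\<close>: its matching to an empty neighbour gets the colour \<open>s\<close>, both layers are coloured
alike, and the items of colour \<open>s\<close> are restored by exchanges (\<open>couple\<close>). A prescribed edge of a
matching whose colour \<open>x\<close> cannot be given to the whole matching is handled by prescribing \<open>x\<close>, in
both layers, for one item at its end vertex, often the singleton, and exchanging (\<open>put\<close>, \<open>unput\<close>).

The direction that is regarded as vertical is chosen to contain as few precoloured edges as
possible. There are \<open>d + 1\<close> directions and at most \<open>2 d + 2\<close> precoloured items, so either some
direction contains none or one of them, or every direction contains exactly two and there are no
precoloured singletons. These are the cases \<open>no_vertical\<close>, \<open>one_vertical\<close> and \<open>two_verticals\<close>. The
last one leaves out a single configuration, in the two-dimensional power; it cannot occur in both
directions at once (\<open>tangled_turn\<close>).\<close>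

section \<open>Partial colourings of items\<close>

definition partial_col :: "'v set set \<Rightarrow> nat set \<Rightarrow> ('v set \<Rightarrow> nat option) \<Rightarrow> bool" where
  "partial_col I K R \<longleftrightarrow> dom R \<subseteq> I \<and> ran R \<subseteq> K \<and>
     (\<forall>e e' x. R e = Some x \<longrightarrow> R e' = Some x \<longrightarrow> e \<inter> e' \<noteq> {} \<longrightarrow> e = e')"

definition total_col :: "'v set set \<Rightarrow> nat set \<Rightarrow> ('v set \<Rightarrow> nat) \<Rightarrow> bool" where
  "total_col I K g \<longleftrightarrow> g ` I \<subseteq> K \<and> proper_on I g"

definition agrees :: "('v \<Rightarrow> nat option) \<Rightarrow> ('v \<Rightarrow> nat) \<Rightarrow> bool" where
  "agrees R g \<longleftrightarrow> (\<forall>e x. R e = Some x \<longrightarrow> g e = x)"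

text \<open>The statement proved by induction, with \<open>h = 2 d\<close> for the \<open>d\<close>-th power. As \<open>h + 1\<close> is then the
number of items at a vertex, a total colouring uses every colour at every vertex.\<close>

definition extendable :: "'v set set \<Rightarrow> nat \<Rightarrow> bool" where
  "extendable I h \<longleftrightarrow> (\<forall>K R. card K = h + 1 \<longrightarrow> partial_col I K R \<longrightarrow> card (dom R) \<le> h \<longrightarrow>
     (\<exists>g. total_col I K g \<and> agrees R g))"

lemma agreesD: "agrees R g \<Longrightarrow> R e = Some x \<Longrightarrow> g e = x"
  by (auto simp: agrees_def)

lemma agrees_empty [simp]: "agrees Map.empty g"
  by (auto simp: agrees_def)

lemma partial_col_empty [simp]: "partial_col I K Map.empty"
  by (auto simp: partial_col_def)

lemma partial_col_upd:
  assumes "partial_col I K R" "e \<in> I" "x \<in> K" "\<And>z. R z = Some x \<Longrightarrow> z \<inter> e \<noteq> {} \<Longrightarrow> z = e"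
  shows "partial_col I K (R(e \<mapsto> x))"
  using assms unfolding partial_col_def
  by (auto simp: ran_def dom_def split: if_splits)

lemma partial_col_restrict:
  assumes "partial_col I K R" shows "partial_col I K (R |` A)"
  using assms unfolding partial_col_def by (auto simp: restrict_map_def ran_def dom_def split: if_splits)

lemma card_ran_le: "finite (dom R) \<Longrightarrow> card (ran R) \<le> card (dom R)"
proof -
  assume "finite (dom R)"
  moreover have "ran R = (\<lambda>e. the (R e)) ` dom R" by (force simp: ran_def dom_def image_iff)
  ultimately show ?thesis by (simp add: card_image_le)
qed

lemma card_dom_upd_le: "finite (dom R) \<Longrightarrow> card (dom (R(e \<mapsto> x))) \<le> card (dom R) + 1"
  by (auto simp: card_insert_if)

lemma ran_upd_subset: "ran (R(e \<mapsto> x)) \<subseteq> insert x (ran R)"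
  by (auto simp: ran_def)

lemma pick_from_large:
  assumes "card A > card B" "finite B" shows "\<exists>x. x \<in> A \<and> x \<notin> B"
  by (metis assms card_mono not_le subsetI)

section \<open>Cyclically arranged layers and the Kempe exchange\<close>

text \<open>The layers are indexed by \<open>J\<close>, and the layer after \<open>j\<close> is \<open>nx j\<close>. Only the local shape of the
cyclic order is recorded: no cycle of \<open>nx\<close> has fewer than five elements. This makes the
reversal of the order, which exchanges \<open>nx\<close> and \<open>pv\<close>, a symmetry of the locale. The vertices and
items of a single layer are \<open>X\<close> and \<open>I\<close>.\<close>

locale layers =
  fixes J :: "'j set" and nx pv :: "'j \<Rightarrow> 'j"
    and X :: "'v set" and I :: "'v set set" and K :: "nat set" and h :: nat
  assumes fin_J: "finite J"
    and nx_J [simp]: "j \<in> J \<Longrightarrow> nx j \<in> J" and pv_J [simp]: "j \<in> J \<Longrightarrow> pv j \<in> J"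
    and nx_pv [simp]: "j \<in> J \<Longrightarrow> nx (pv j) = j" and pv_nx [simp]: "j \<in> J \<Longrightarrow> pv (nx j) = j"
    and nx1: "j \<in> J \<Longrightarrow> nx j \<noteq> j"
    and nx2: "j \<in> J \<Longrightarrow> nx (nx j) \<noteq> j"
    and nx3: "j \<in> J \<Longrightarrow> nx (nx (nx j)) \<noteq> j"
    and nx4: "j \<in> J \<Longrightarrow> nx (nx (nx (nx j))) \<noteq> j"
    and fin_I: "finite I"
    and item_sub: "e \<in> I \<Longrightarrow> e \<subseteq> X"
    and item_cases: "e \<in> I \<Longrightarrow> v \<in> e \<Longrightarrow> \<exists>w. e = {v, w}"
    and item_ne: "e \<in> I \<Longrightarrow> e \<noteq> {}"
    and singleton_item: "v \<in> X \<Longrightarrow> {v} \<in> I"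
    and card_star: "v \<in> X \<Longrightarrow> card {e \<in> I. v \<in> e} = h + 1"
    and no_triangle: "{u, v} \<in> I \<Longrightarrow> {v, w} \<in> I \<Longrightarrow> {u, w} \<in> I \<Longrightarrow> u = v \<or> v = w \<or> u = w"
    and ext: "extendable I h"
    and card_K: "card K = h + 3"
    and h_even: "even h"
    and single_vertex: "h = 0 \<Longrightarrow> u \<in> X \<Longrightarrow> v \<in> X \<Longrightarrow> u = v"
begin

lemma fin_K: "finite K"
  using card_K by (metis add_is_0 card.infinite zero_neq_numeral)

text \<open>Here \<open>g j\<close> colours the items of layer \<open>j\<close>, and \<open>m j v\<close> is the colour of the edge between the
copies of \<open>v\<close> in the layers \<open>j\<close> and \<open>nx j\<close>. The product of a cycle with a graph has exactly these
edges, so this is properness in the product.\<close>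

definition layered :: "('j \<Rightarrow> 'v set \<Rightarrow> nat) \<Rightarrow> ('j \<Rightarrow> 'v \<Rightarrow> nat) \<Rightarrow> bool" where
  "layered g m \<longleftrightarrow> (\<forall>j\<in>J. total_col I K (g j) \<and> (\<forall>v\<in>X. m j v \<in> K \<and> m j v \<noteq> m (nx j) v \<and>
     (\<forall>e\<in>I. v \<in> e \<longrightarrow> g j e \<noteq> m j v \<and> g (nx j) e \<noteq> m j v)))"

lemma nx_inject: "i \<in> J \<Longrightarrow> j \<in> J \<Longrightarrow> nx i = nx j \<longleftrightarrow> i = j"
  by (metis pv_nx)

lemma pv_inject: "i \<in> J \<Longrightarrow> j \<in> J \<Longrightarrow> pv i = pv j \<longleftrightarrow> i = j"
  by (metis nx_pv)

text \<open>All that is used of cycles of length at least five; stated in both orientations so that the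
simplifier can decide case distinctions on neighbouring layers.\<close>

lemma layers_distinct:
  assumes j: "j \<in> J"
  shows "nx j \<noteq> j" "j \<noteq> nx j" "pv j \<noteq> j" "j \<noteq> pv j" "nx (nx j) \<noteq> j" "j \<noteq> nx (nx j)"
    "pv (pv j) \<noteq> j" "j \<noteq> pv (pv j)" "pv j \<noteq> nx j" "nx j \<noteq> pv j"
    "nx (nx j) \<noteq> nx j" "nx j \<noteq> nx (nx j)" "pv (pv j) \<noteq> pv j" "pv j \<noteq> pv (pv j)"
    "nx (nx j) \<noteq> pv j" "pv j \<noteq> nx (nx j)" "pv (pv j) \<noteq> nx j" "nx j \<noteq> pv (pv j)"
    "pv (pv j) \<noteq> nx (nx j)" "nx (nx j) \<noteq> pv (pv j)"
    "nx (nx (nx j)) \<noteq> j" "j \<noteq> nx (nx (nx j))" "nx (nx (nx j)) \<noteq> nx j" "nx j \<noteq> nx (nx (nx j))"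
    "nx (nx (nx j)) \<noteq> nx (nx j)" "nx (nx j) \<noteq> nx (nx (nx j))"
    "nx (nx (nx j)) \<noteq> pv j" "pv j \<noteq> nx (nx (nx j))"
  using j nx1 nx2 nx3 nx4 by (metis nx_J pv_J nx_pv pv_nx)+

lemma reflect: "layers J pv nx X I K h"
proof
  show "pv (pv j) \<noteq> j" "pv j \<noteq> j" if "j \<in> J" for j using layers_distinct that by auto
  show "pv (pv (pv j)) \<noteq> j" if "j \<in> J" for j using that nx3 by (metis pv_J nx_pv)
  show "pv (pv (pv (pv j))) \<noteq> j" if "j \<in> J" for j using that nx4 by (metis pv_J nx_pv)
qed (use fin_J fin_I item_sub item_cases item_ne singleton_item card_star no_triangle ext card_K h_even single_vertex in auto)

text \<open>A matching is named after its lower layer, so it changes its name when the order is reversed: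
the matching above \<open>j\<close> becomes the one above \<open>nx j\<close>.\<close>

lemma layered_reflect:
  assumes "layers.layered J pv X I K g m"
  shows "layered g (\<lambda>j. m (nx j))"
proof -
  interpret r: layers J pv nx X I K h by (rule reflect)
  have "total_col I K (g j)" if "j \<in> J" for j using assms that by (auto simp: r.layered_def)
  moreover have "m (nx j) v \<in> K \<and> m (nx j) v \<noteq> m (nx (nx j)) v \<and>
     (\<forall>e\<in>I. v \<in> e \<longrightarrow> g j e \<noteq> m (nx j) v \<and> g (nx j) e \<noteq> m (nx j) v)" if "j \<in> J" "v \<in> X" for j v
    using assms that unfolding r.layered_def by (metis nx_J pv_nx)
  ultimately show ?thesis unfolding layered_def by blast
qed

lemma total_col_distinct:
  "total_col I K' g \<Longrightarrow> e \<in> I \<Longrightarrow> e' \<in> I \<Longrightarrow> v \<in> e \<Longrightarrow> v \<in> e' \<Longrightarrow> g e = g e' \<Longrightarrow> e = e'"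
  unfolding total_col_def proper_on_def by blast

lemma layeredI:
  assumes "\<And>j e. j \<in> J \<Longrightarrow> e \<in> I \<Longrightarrow> g j e \<in> K"
    and "\<And>j v e e'. j \<in> J \<Longrightarrow> e \<in> I \<Longrightarrow> e' \<in> I \<Longrightarrow> v \<in> e \<Longrightarrow> v \<in> e' \<Longrightarrow> e \<noteq> e' \<Longrightarrow> g j e \<noteq> g j e'"
    and "\<And>j v. j \<in> J \<Longrightarrow> v \<in> X \<Longrightarrow> m j v \<in> K \<and> m j v \<noteq> m (nx j) v"
    and "\<And>j v e. j \<in> J \<Longrightarrow> v \<in> X \<Longrightarrow> e \<in> I \<Longrightarrow> v \<in> e \<Longrightarrow> g j e \<noteq> m j v \<and> g (nx j) e \<noteq> m j v"
  shows "layered g m"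
  unfolding layered_def total_col_def proper_on_def
proof (intro ballI conjI impI)
  fix j e e' assume "j \<in> J" "e \<in> I" "e' \<in> I" "e \<noteq> e' \<and> e \<inter> e' \<noteq> {}"
  then show "g j e \<noteq> g j e'" using assms(2) by blast
qed (use assms(1,3,4) in auto)

lemma layeredD:
  assumes "layered g m" "j \<in> J"
  shows "total_col I K (g j)" "e \<in> I \<Longrightarrow> g j e \<in> K" "v \<in> X \<Longrightarrow> m j v \<in> K" "v \<in> X \<Longrightarrow> m j v \<noteq> m (nx j) v"
    "v \<in> X \<Longrightarrow> m (nx j) v \<noteq> m j v"
    "e \<in> I \<Longrightarrow> v \<in> e \<Longrightarrow> g j e \<noteq> m j v"
    "e \<in> I \<Longrightarrow> v \<in> e \<Longrightarrow> g (nx j) e \<noteq> m j v"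
    "e \<in> I \<Longrightarrow> v \<in> e \<Longrightarrow> m j v \<noteq> g j e"
    "e \<in> I \<Longrightarrow> v \<in> e \<Longrightarrow> m j v \<noteq> g (nx j) e"
    "e \<in> I \<Longrightarrow> e' \<in> I \<Longrightarrow> v \<in> e \<Longrightarrow> v \<in> e' \<Longrightarrow> g j e = g j e' \<Longrightarrow> e = e'"
  using assms item_sub total_col_distinct unfolding layered_def total_col_def by (blast, blast, blast, blast, metis, blast, blast, metis subsetD, metis subsetD, metis (no_types, lifting) total_col_def)

text \<open>At a vertex of a member of \<open>S\<close> or \<open>T\<close> exactly two of the incident items exchange their colours,
the member itself and the edge of the matching; hence the set of colours seen there does not change
and the colouring stays proper. The families \<open>S\<close> and \<open>T\<close> may differ: an edge in one layer can be
matched against its two end vertices in the other.\<close>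

lemma swap:
  assumes layered: "layered g m" and j: "j \<in> J" and ST: "S \<subseteq> I" "T \<subseteq> I" "\<Union>S = \<Union>T"
    and dS: "\<And>e e'. e \<in> S \<Longrightarrow> e' \<in> S \<Longrightarrow> e \<inter> e' \<noteq> {} \<Longrightarrow> e = e'"
    and dT: "\<And>e e'. e \<in> T \<Longrightarrow> e' \<in> T \<Longrightarrow> e \<inter> e' \<noteq> {} \<Longrightarrow> e = e'"
    and s: "\<And>v. v \<in> \<Union>S \<Longrightarrow> m j v = s"
    and eq: "\<And>e e'. e \<in> S \<Longrightarrow> e' \<in> T \<Longrightarrow> e \<inter> e' \<noteq> {} \<Longrightarrow> g j e = g (nx j) e'"
  defines "g' \<equiv> g(j := (\<lambda>e. if e \<in> S then s else g j e), nx j := (\<lambda>e. if e \<in> T then s else g (nx j) e))"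
  shows "\<exists>m'. layered g' m' \<and> (\<forall>i. i \<noteq> j \<longrightarrow> m' i = m i) \<and> (\<forall>v. v \<notin> \<Union>S \<longrightarrow> m' j v = m j v) \<and>
     (\<forall>e\<in>S. \<forall>v\<in>e. m' j v = g j e)"
proof -
  note nd = layers_distinct[OF j]
  define u where "u v = g j (SOME e. e \<in> S \<and> v \<in> e)" for v
  have u: "u v = g j e" if "e \<in> S" "v \<in> e" for e v
  proof -
    have "(SOME e. e \<in> S \<and> v \<in> e) \<in> S \<and> v \<in> (SOME e. e \<in> S \<and> v \<in> e)"
      using that by (intro someI) auto
    then have "(SOME e. e \<in> S \<and> v \<in> e) = e" using dS that by blast
    then show ?thesis by (simp add: u_def)
  qed
  have u': "u v = g (nx j) e" if "e \<in> T" "v \<in> e" for e v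
  proof -
    have "v \<in> \<Union>S" unfolding ST(3) using that by blast
    then obtain e' where e': "e' \<in> S" "v \<in> e'" by blast
    then have "e' \<inter> e \<noteq> {}" using that by blast
    then show ?thesis using u[OF e'] eq[OF e'(1) that(1)] by simp
  qed
  define m' where "m' = m(j := (\<lambda>v. if v \<in> \<Union>S then u v else m j v))"
  have S_T: "v \<in> \<Union>S \<longleftrightarrow> v \<in> \<Union>T" for v by (simp only: ST(3))
  have SX: "\<Union>S \<subseteq> X" using ST(1) item_sub by blast
  have usK: "u v \<in> K \<and> s \<in> K" if vS: "v \<in> \<Union>S" for v
  proof -
    obtain e where e: "e \<in> S" "v \<in> e" using vS by blast
    have "u v \<in> K" using u[OF e] layeredD(2)[OF layered j, of e] e ST(1) by auto
    moreover have "m j v \<in> K" using vS SX layeredD(3)[OF layered j, of v] by fastforce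
    ultimately show ?thesis using s[OF vS] by simp
  qed
  have sK: "s \<in> K" if eST: "e \<in> S \<union> T" for e
  proof -
    have "e \<noteq> {}" using eST ST(1,2) item_ne by blast
    then obtain v where v: "v \<in> e" by blast
    have "v \<in> \<Union>S" using eST
    proof
      assume "e \<in> S" then show ?thesis using v by blast
    next
      assume "e \<in> T" then show ?thesis unfolding ST(3) using v by blast
    qed
    then show ?thesis using usK by blast
  qed
  have "layered g' m'"
  proof (rule layeredI)
    fix i e assume i: "i \<in> J" "e \<in> I"
    show "g' i e \<in> K"
      using layeredD(2)[OF layered] i sK by (auto simp: g'_def)
  next
    fix i v e e' assume i: "i \<in> J" and e: "e \<in> I" "e' \<in> I" "v \<in> e" "v \<in> e'" "e \<noteq> e'"
    have ne: "g i e \<noteq> g i e'" using layeredD(10)[OF layered i] e by blast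
    have v: "v \<in> X" using e item_sub by blast
    consider "i = j" | "i = nx j" | "i \<noteq> j" "i \<noteq> nx j" by blast
    then show "g' i e \<noteq> g' i e'"
    proof cases
      case 1
      have "g j x \<noteq> s" if "y \<in> S" "v \<in> y" "x \<in> I" "v \<in> x" for x y
        using layeredD(6)[OF layered j that(3,4)] s[OF UnionI[OF that(1,2)]] by simp
      moreover have "\<not> (e \<in> S \<and> e' \<in> S)" using dS e by blast
      ultimately show ?thesis using 1 nd(2) ne e by (auto simp: g'_def)
    next
      case 2
      have "g (nx j) x \<noteq> s" if "y \<in> T" "v \<in> y" "x \<in> I" "v \<in> x" for x y
        using layeredD(7)[OF layered j that(3,4)] s[unfolded S_T, OF UnionI[OF that(1,2)]] by simp
      moreover have "\<not> (e \<in> T \<and> e' \<in> T)" using dT e by blast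
      ultimately show ?thesis using 2 nd(1) ne e by (auto simp: g'_def)
    next
      case 3 then show ?thesis using ne by (simp add: g'_def)
    qed
  next
    fix i v assume i: "i \<in> J" and v: "v \<in> X"
    show "m' i v \<in> K \<and> m' i v \<noteq> m' (nx i) v"
    proof (cases "v \<in> \<Union>S")
      case False
      then show ?thesis using layeredD(3,4)[OF layered i v] by (auto simp: m'_def)
    next
      case True
      then obtain e where e: "e \<in> S" "v \<in> e" by blast
      then have eI: "e \<in> I" using ST(1,2) by blast
      obtain e' where e': "e' \<in> T" "v \<in> e'" using True[unfolded S_T] by blast
      then have e'I: "e' \<in> I" using ST(1,2) by blast
      \<comment> \<open>The matching above and the one below already avoid the colour that the edge at \<open>v\<close> takes over.\<close>
      have "u v \<noteq> m (pv j) v"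
        using layeredD(7)[OF layered, of "pv j" e v] j eI e u by simp
      moreover have "u v \<noteq> m (nx j) v"
        using layeredD(6)[OF layered, of "nx j" e' v] j e'I e' u' by simp
      moreover have "nx i = j \<longleftrightarrow> i = pv j" using i j by auto
      ultimately show ?thesis using layeredD(3,4)[OF layered i v] True usK nd
        by (auto simp: m'_def)
    qed
  next
    fix i v e assume i: "i \<in> J" and v: "v \<in> X" and e: "e \<in> I" "v \<in> e"
    have A: "g' i e \<noteq> m' i v"
    proof (cases "i = j")
      case True
      show ?thesis
      proof (cases "v \<in> \<Union>S")
        case T: True
        then obtain x where x: "x \<in> S" "v \<in> x" by blast
        then have xI: "x \<in> I" using ST(1,2) by blast
        have "g j x \<noteq> s" using layeredD(6)[OF layered j xI x(2)] s[OF T] by simp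
        moreover have "g j e \<noteq> g j x" if "e \<notin> S" using layeredD(10)[OF layered j e(1) xI e(2)] x that by blast
        moreover have "e \<in> S \<Longrightarrow> e = x" using dS x e by blast
        ultimately show ?thesis using True nd T u[OF x] by (auto simp: g'_def m'_def)
      next
        case F: False
        then show ?thesis using True nd layeredD(6)[OF layered j e] e by (auto simp: g'_def m'_def)
      qed
    next
      case ij: False
      show ?thesis
      proof (cases "i = nx j \<and> e \<in> T")
        case True
        have "v \<in> \<Union>S" unfolding S_T using True e by blast
        then have "m j v = s" by (rule s)
        then have "m (nx j) v \<noteq> s" using layeredD(5)[OF layered j v] by simp
        then show ?thesis using True ij by (auto simp: g'_def m'_def)
      next
        case False
        then show ?thesis using ij layeredD(6)[OF layered i e] by (auto simp: g'_def m'_def)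
      qed
    qed
    have B: "g' (nx i) e \<noteq> m' i v"
    proof (cases "i = j")
      case True
      show ?thesis
      proof (cases "v \<in> \<Union>S")
        case T: True
        then obtain x where x: "x \<in> T" "v \<in> x" unfolding S_T by blast
        then have xI: "x \<in> I" using ST(1,2) by blast
        have nj: "nx j \<in> J" using j by simp
        have "g (nx j) x \<noteq> s" using layeredD(7)[OF layered j xI x(2)] s[OF T] by simp
        moreover have "g (nx j) e \<noteq> g (nx j) x" if "e \<notin> T" using layeredD(10)[OF layered nj e(1) xI e(2)] x that by blast
        moreover have "e \<in> T \<Longrightarrow> e = x" using dT x e by blast
        ultimately show ?thesis using True nd T u'[OF x] by (auto simp: g'_def m'_def)
      next
        case F: False
        then show ?thesis using True nd layeredD(7)[OF layered j e] e S_T by (auto simp: g'_def m'_def)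
      qed
    next
      case ij: False
      then have ni: "nx i \<noteq> nx j" using nx_inject i j by simp
      show ?thesis
      proof (cases "nx i = j \<and> e \<in> S")
        case True
        have "m j v = s" using s[of v] True e by blast
        then have "m i v \<noteq> s" using layeredD(4)[OF layered i v] True by simp
        then show ?thesis using True ij ni by (auto simp: g'_def m'_def)
      next
        case False
        then show ?thesis using ij ni layeredD(7)[OF layered i e] by (auto simp: g'_def m'_def)
      qed
    qed
    show "g' i e \<noteq> m' i v \<and> g' (nx i) e \<noteq> m' i v" using A B by blast
  qed
  moreover have "\<forall>e\<in>S. \<forall>v\<in>e. m' j v = g j e" using u by (auto simp: m'_def)
  ultimately show ?thesis by (intro exI[of _ m']) (auto simp: m'_def)
qed

end

section \<open>Colours for the matchings and overloaded layers\<close>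

abbreviation colored_items :: "('v set \<Rightarrow> nat option) \<Rightarrow> nat \<Rightarrow> 'v set set" where
  "colored_items R s \<equiv> {e. R e = Some s}"

definition without :: "('v set \<Rightarrow> nat option) \<Rightarrow> nat \<Rightarrow> ('v set \<Rightarrow> nat option)" where
  "without R s = R |` (- colored_items R s)"

lemma without_eq_Some [simp]: "without R s e = Some x \<longleftrightarrow> R e = Some x \<and> x \<noteq> s"
  by (cases "R e = Some s") (auto simp: without_def)

lemma ran_without: "ran (without R s) = ran R - {s}"
  unfolding ran_def without_eq_Some by blast

lemma partial_col_without: "partial_col I K R \<Longrightarrow> partial_col I K (without R s)"
  unfolding without_def by (rule partial_col_restrict)

lemma card_without:
  assumes "finite (dom R)" shows "card (dom (without R s)) + card (colored_items R s) = card (dom R)"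
proof -
  have dom: "dom (without R s) = dom R - colored_items R s"
    unfolding dom_def by (auto simp: without_def restrict_map_def)
  have "colored_items R s \<subseteq> dom R" by auto
  then show ?thesis unfolding dom using assms
    by (metis card_Diff_subset card_mono diff_add finite_subset)
qed

context layers
begin

lemma fin_dom: "partial_col I K' R \<Longrightarrow> finite (dom R)"
  using finite_subset[OF _ fin_I] by (simp add: partial_col_def)

lemma fin_ran: "partial_col I K R \<Longrightarrow> finite (ran R)"
  using finite_subset[OF _ fin_K] by (simp add: partial_col_def)

lemma card_ran_Un_le:
  assumes "partial_col I K R" "partial_col I K R'"
  shows "card (ran R \<union> ran R') \<le> card (dom R) + card (dom R')"
  using card_Un_le[of "ran R" "ran R'"] card_ran_le[OF fin_dom[OF assms(1)]]
    card_ran_le[OF fin_dom[OF assms(2)]] by linarith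

text \<open>Each index has only two neighbours in the cyclic order, so three available colours are enough
to continue from any proper choice on \<open>Y\<close>.\<close>

lemma greedy:
  assumes Y: "Y \<subseteq> J" and proper: "\<And>j. j \<in> Y \<Longrightarrow> nx j \<in> Y \<Longrightarrow> c0 j \<noteq> c0 (nx j)"
    and L: "\<And>j. j \<in> J - Y \<Longrightarrow> card (L j) \<ge> 3"
  obtains c where "\<And>j. j \<in> Y \<Longrightarrow> c j = c0 j" "\<And>j. j \<in> J - Y \<Longrightarrow> c j \<in> L j"
    "\<And>j. j \<in> J \<Longrightarrow> c j \<noteq> (c (nx j) :: nat)"
proof -
  have "\<exists>c. (\<forall>j\<in>Y. c j = c0 j) \<and> (\<forall>j\<in>Z. c j \<in> L j) \<and>
      (\<forall>j\<in>Y \<union> Z. nx j \<in> Y \<union> Z \<longrightarrow> c j \<noteq> c (nx j))" if "finite Z" "Z \<subseteq> J - Y" for Z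
    using that
  proof (induction Z rule: finite_induct)
    case empty
    then show ?case using proper by (intro exI[of _ c0]) auto
  next
    case (insert z Z)
    then obtain c where c: "\<forall>j\<in>Y. c j = c0 j" "\<forall>j\<in>Z. c j \<in> L j"
      "\<forall>j\<in>Y \<union> Z. nx j \<in> Y \<union> Z \<longrightarrow> c j \<noteq> c (nx j)" by auto
    have z: "z \<in> J" "z \<notin> Y" using insert by auto
    have "card {c (nx z), c (pv z)} \<le> 2" by (simp add: card_insert_if)
    then have "card {c (nx z), c (pv z)} < card (L z)" using L[of z] z by simp
    then obtain x where x: "x \<in> L z" "x \<notin> {c (nx z), c (pv z)}"
      using pick_from_large by (metis finite.emptyI finite.insertI)
    have "(c(z := x)) j \<noteq> (c(z := x)) (nx j)"
      if j: "j \<in> Y \<union> insert z Z" "nx j \<in> Y \<union> insert z Z" for j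
    proof -
      have jJ: "j \<in> J" using j insert.prems Y by auto
      show ?thesis
      proof (cases "j = z")
        case True then show ?thesis using x layers_distinct[OF z(1)] by auto
      next
        case False
        show ?thesis
        proof (cases "nx j = z")
          case True then have "j = pv z" using jJ by auto
          then show ?thesis using x True False by auto
        next
          case F: False
          then show ?thesis using c(3) j False by auto
        qed
      qed
    qed
    then show ?case using c x z insert.hyps by (intro exI[of _ "c(z := x)"]) auto
  qed
  from this[of "J - Y"] fin_J Y obtain c where c: "\<forall>j\<in>Y. c j = c0 j" "\<forall>j\<in>J - Y. c j \<in> L j"
      "\<forall>j\<in>J. nx j \<in> J \<longrightarrow> c j \<noteq> c (nx j)"
    by (auto simp: Un_absorb1)
  then show ?thesis using that by (metis nx_J)
qed

lemma walk:
  assumes "Y \<subseteq> J" "\<And>j. j \<in> Y \<Longrightarrow> c0 j \<in> K" "\<And>j. j \<in> Y \<Longrightarrow> nx j \<in> Y \<Longrightarrow> c0 j \<noteq> c0 (nx j)"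
    and R: "\<And>j. j \<in> J \<Longrightarrow> partial_col I K (R j)"
    and few: "\<And>j. j \<in> J - Y \<Longrightarrow> card (ran (R j) \<union> ran (R (nx j))) \<le> h"
  obtains c where "\<And>j. j \<in> Y \<Longrightarrow> c j = c0 j" "\<And>j. j \<in> J \<Longrightarrow> c j \<in> K"
    "\<And>j. j \<in> J \<Longrightarrow> c j \<noteq> c (nx j)"
    "\<And>j. j \<in> J - Y \<Longrightarrow> c j \<notin> ran (R j) \<and> c j \<notin> ran (R (nx j))"
proof -
  have L: "card (K - (ran (R j) \<union> ran (R (nx j)))) \<ge> 3" if "j \<in> J - Y" for j
  proof -
    have "ran (R j) \<union> ran (R (nx j)) \<subseteq> K" using R[of j] R[of "nx j"] that by (auto simp: partial_col_def)
    then show ?thesis using few[OF that] card_K card_Diff_subset[OF finite_subset[OF _ fin_K]] by fastforce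
  qed
  obtain c where "\<And>j. j \<in> Y \<Longrightarrow> c j = c0 j" "\<And>j. j \<in> J - Y \<Longrightarrow> c j \<in> K - (ran (R j) \<union> ran (R (nx j)))"
    "\<And>j. j \<in> J \<Longrightarrow> c j \<noteq> c (nx j)"
    using greedy[of Y c0 "\<lambda>j. K - (ran (R j) \<union> ran (R (nx j)))", OF assms(1,3) L] by metis
  then show ?thesis using that[of c] assms(2) by (metis DiffD1 DiffD2 DiffI UnCI)
qed

lemma layered_constant_matchings:
  assumes "\<And>j. j \<in> J \<Longrightarrow> c j \<in> K" "\<And>j. j \<in> J \<Longrightarrow> c j \<noteq> c (nx j)"
    and g: "\<And>j. j \<in> J \<Longrightarrow> total_col I (K - {c j, c (pv j)}) (g j)"
  shows "layered g (\<lambda>j v. c j)"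
  unfolding layered_def
proof (intro ballI conjI impI)
  fix j assume j: "j \<in> J"
  show "total_col I K (g j)" using g[OF j] by (auto simp: total_col_def)
  show "c j \<in> K" "c j \<noteq> c (nx j)" using assms j by auto
  fix e assume e: "e \<in> I"
  show "g j e \<noteq> c j" using g[OF j] e by (auto simp: total_col_def)
  show "g (nx j) e \<noteq> c j" using g[of "nx j"] j e by (auto simp: total_col_def image_subset_iff)
qed

text \<open>The induction hypothesis enters here: two of the \<open>h + 3\<close> colours go to the two adjacent
matchings.\<close>

lemma layer_ext:
  assumes "a \<in> K" "b \<in> K" "a \<noteq> b" "partial_col I K R" "a \<notin> ran R" "b \<notin> ran R" "card (dom R) \<le> h"
  obtains g where "total_col I (K - {a, b}) g" "agrees R g"
proof -
  have "card (K - {a, b}) = h + 1" using assms card_K fin_K by (simp add: card_Diff_subset)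
  moreover have "partial_col I (K - {a, b}) R" using assms by (auto simp: partial_col_def)
  ultimately show ?thesis using ext assms(7) that unfolding extendable_def by blast
qed

lemma color_layers:
  assumes "\<And>j. j \<in> J \<Longrightarrow> c j \<in> K" "\<And>j. j \<in> J \<Longrightarrow> c j \<noteq> c (nx j)"
    and R: "\<And>j. j \<in> J \<Longrightarrow> partial_col I K (R j)" "\<And>j. j \<in> J \<Longrightarrow> card (dom (R j)) \<le> h"
    and c: "\<And>j. j \<in> J \<Longrightarrow> c j \<notin> ran (R j) \<and> c j \<notin> ran (R (nx j))"
  obtains g where "\<And>j. j \<in> J \<Longrightarrow> total_col I (K - {c j, c (pv j)}) (g j)" "\<And>j. j \<in> J \<Longrightarrow> agrees (R j) (g j)"
proof -
  have "\<exists>g. total_col I (K - {c j, c (pv j)}) g \<and> agrees (R j) g" if "j \<in> J" for j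
    using layer_ext[of "c j" "c (pv j)" "R j"] assms(1,2)[of j] assms(1,2)[of "pv j"] R[of j] c[of j] c[of "pv j"] that
    by (metis nx_pv pv_J)
  then show ?thesis using that by metis
qed

text \<open>On \<open>Y\<close> the colours of the matchings are prescribed. Elsewhere the few colours that occur in the
two adjacent layers are avoided, which leaves at least three.\<close>

lemma color_along_walk:
  assumes "Y \<subseteq> J" and Y: "\<And>j. j \<in> Y \<Longrightarrow> c0 j \<in> K \<and> c0 j \<notin> ran (R j) \<and> c0 j \<notin> ran (R (nx j))"
    and proper: "\<And>j. j \<in> Y \<Longrightarrow> nx j \<in> Y \<Longrightarrow> c0 j \<noteq> c0 (nx j)"
    and R: "\<And>j. j \<in> J \<Longrightarrow> partial_col I K (R j)" "\<And>j. j \<in> J \<Longrightarrow> card (dom (R j)) \<le> h"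
    and few: "\<And>j. j \<in> J - Y \<Longrightarrow> card (ran (R j) \<union> ran (R (nx j))) \<le> h"
  obtains g m where "layered g m" "\<And>j. j \<in> J \<Longrightarrow> agrees (R j) (g j)" "\<And>j v. j \<in> Y \<Longrightarrow> m j v = c0 j"
proof -
  obtain c where c: "\<And>j. j \<in> Y \<Longrightarrow> c j = c0 j" "\<And>j. j \<in> J \<Longrightarrow> c j \<in> K"
    "\<And>j. j \<in> J \<Longrightarrow> c j \<noteq> c (nx j)"
    "\<And>j. j \<in> J - Y \<Longrightarrow> c j \<notin> ran (R j) \<and> c j \<notin> ran (R (nx j))"
    using walk[of Y c0 R, OF assms(1) conjunct1[OF Y] proper R(1) few] by metis
  obtain g where g: "\<And>j. j \<in> J \<Longrightarrow> total_col I (K - {c j, c (pv j)}) (g j)" "\<And>j. j \<in> J \<Longrightarrow> agrees (R j) (g j)"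
  proof (rule color_layers[of c R, OF c(2,3) R])
    show "c j \<notin> ran (R j) \<and> c j \<notin> ran (R (nx j))" if "j \<in> J" for j
      using c(1)[of j] c(4)[of j] Y[of j] that by (cases "j \<in> Y") auto
  qed auto
  show ?thesis using that[of g "\<lambda>j v. c j"] layered_constant_matchings[OF c(2,3) g(1)] g(2) c(1) by blast
qed

lemma card_without_less:
  assumes "partial_col I K R" "s \<in> ran R" shows "card (dom (without R s)) + 1 \<le> card (dom R)"
proof -
  have "finite (colored_items R s)" using fin_dom[OF assms(1)] by (rule rev_finite_subset) auto
  moreover have "colored_items R s \<noteq> {}" using assms(2) by (auto simp: ran_def)
  ultimately have "card (colored_items R s) > 0" by (simp add: card_gt_0_iff)
  then show ?thesis using card_without[OF fin_dom[OF assms(1)], of s] by linarith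
qed

text \<open>All items that should have the colour of the matching get it at once; being of one colour in
\<open>R\<close> they are disjoint, so the exchanges do not interfere.\<close>

lemma swap_in_color:
  assumes layered: "layered g m" and j: "j \<in> J" and R: "partial_col I K R" and s: "\<And>v. m j v = s"
    and eq: "\<And>e. R e = Some s \<Longrightarrow> g (nx j) e = g j e"
  obtains g' m' where "layered g' m'" "\<And>i. i \<noteq> j \<Longrightarrow> m' i = m i" "\<And>i. i \<noteq> j \<Longrightarrow> i \<noteq> nx j \<Longrightarrow> g' i = g i"
    "\<And>v. (\<And>e. R e = Some s \<Longrightarrow> v \<notin> e) \<Longrightarrow> m' j v = s"
    "\<And>i e. R e \<noteq> Some s \<Longrightarrow> g' i e = g i e" "\<And>e. R e = Some s \<Longrightarrow> g' j e = s \<and> g' (nx j) e = s"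
proof -
  let ?S = "colored_items R s"
  let ?g = "g(j := (\<lambda>e. if e \<in> ?S then s else g j e), nx j := (\<lambda>e. if e \<in> ?S then s else g (nx j) e))"
  have S: "?S \<subseteq> I" using R by (auto simp: partial_col_def)
  have d: "e = e'" if "e \<in> ?S" "e' \<in> ?S" "e \<inter> e' \<noteq> {}" for e e'
    using R that unfolding partial_col_def mem_Collect_eq by blast
  have eq': "g j e = g (nx j) e'" if "e \<in> ?S" "e' \<in> ?S" "e \<inter> e' \<noteq> {}" for e e'
    using d[OF that] eq[of e] that by simp
  obtain m' where m': "layered ?g m'" "\<forall>i. i \<noteq> j \<longrightarrow> m' i = m i" "\<forall>v. v \<notin> \<Union>?S \<longrightarrow> m' j v = m j v"
    using swap[OF layered j S S refl d d s eq'] by blast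
  show ?thesis
    by (rule that[OF m'(1)]) (use m'(2,3) s layers_distinct[OF j] in auto)
qed

text \<open>Layer \<open>j0\<close> may be overloaded provided that dropping its items of colour \<open>s = c0 j0\<close> leaves at most
\<open>h\<close>. The layer above is empty, and since the matchings on the outer sides of the two layers have the
same colour, both layers have the same colours at their disposal and can be coloured alike. This
puts every dropped item into the position required for an exchange with the matching \<open>j0\<close>, whose
colour is \<open>s\<close>.\<close>

lemma couple:
  assumes j0: "j0 \<in> J" and Y: "Y \<subseteq> J" "pv j0 \<in> Y" "j0 \<in> Y" "nx j0 \<in> Y"
    and empty: "R (nx j0) = Map.empty" and sides: "c0 (nx j0) = c0 (pv j0)"
    and K: "\<And>j. j \<in> Y \<Longrightarrow> c0 j \<in> K"
    and c0: "\<And>j. j \<in> Y \<Longrightarrow> j \<noteq> j0 \<Longrightarrow> c0 j \<notin> ran (R j) \<and> c0 j \<notin> ran (R (nx j))"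
    and proper: "\<And>j. j \<in> Y \<Longrightarrow> nx j \<in> Y \<Longrightarrow> c0 j \<noteq> c0 (nx j)"
    and R: "\<And>j. j \<in> J \<Longrightarrow> partial_col I K (R j)" "\<And>j. j \<in> J \<Longrightarrow> j \<noteq> j0 \<Longrightarrow> card (dom (R j)) \<le> h"
    and R0: "card (dom (without (R j0) (c0 j0))) \<le> h"
    and few: "\<And>j. j \<in> J - Y \<Longrightarrow> card (ran (R j) \<union> ran (R (nx j))) \<le> h"
  obtains g m where "layered g m" "\<And>j. j \<in> J \<Longrightarrow> agrees (R j) (g j)"
    "\<And>j v. j \<in> Y \<Longrightarrow> j \<noteq> j0 \<Longrightarrow> m j v = c0 j"
    "\<And>v. (\<And>e. R j0 e = Some (c0 j0) \<Longrightarrow> v \<notin> e) \<Longrightarrow> m j0 v = c0 j0"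
    "\<And>e. g (nx j0) e = g j0 e"
proof -
  note nd = layers_distinct[OF j0]
  let ?s = "c0 j0"
  define R' where "R' = R(j0 := without (R j0) ?s)"
  have R': "partial_col I K (R' j)" "card (dom (R' j)) \<le> h" if "j \<in> J" for j
    using R[OF that] R0 by (auto simp: R'_def partial_col_without)
  have cR': "c0 j \<notin> ran (R' j) \<and> c0 j \<notin> ran (R' (nx j))" if "j \<in> Y" for j
  proof (cases "j = j0")
    case True then show ?thesis using nd empty by (auto simp: R'_def ran_without)
  next
    case False
    then show ?thesis using c0[OF that False] by (auto simp: R'_def ran_without)
  qed
  have few': "card (ran (R' j) \<union> ran (R' (nx j))) \<le> h" if "j \<in> J - Y" for j
  proof -
    have "R' j = R j" "R' (nx j) = R (nx j)" using that Y(2,3) by (auto simp: R'_def)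
    then show ?thesis using few[OF that] by simp
  qed
  obtain c where c: "\<And>j. j \<in> Y \<Longrightarrow> c j = c0 j" "\<And>j. j \<in> J \<Longrightarrow> c j \<in> K"
    "\<And>j. j \<in> J \<Longrightarrow> c j \<noteq> c (nx j)"
    "\<And>j. j \<in> J - Y \<Longrightarrow> c j \<notin> ran (R' j) \<and> c j \<notin> ran (R' (nx j))"
    using walk[of Y c0 R', OF Y(1) K proper R'(1) few'] by metis
  have c': "c j \<notin> ran (R' j) \<and> c j \<notin> ran (R' (nx j))" if "j \<in> J" for j
    using c(1)[of j] c(4)[of j] cR'[of j] that by (cases "j \<in> Y") auto
  obtain g1 where g1: "\<And>j. j \<in> J \<Longrightarrow> total_col I (K - {c j, c (pv j)}) (g1 j)" "\<And>j. j \<in> J \<Longrightarrow> agrees (R' j) (g1 j)"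
    using color_layers[of c R', OF c(2,3) R' c'] by metis
  \<comment> \<open>The empty layer is recoloured like layer \<open>j0\<close>, with which it shares its palette.\<close>
  define g2 where "g2 = g1(nx j0 := g1 j0)"
  have "{c (nx j0), c (pv (nx j0))} = {c j0, c (pv j0)}"
    using c(1) Y sides j0 by auto
  then have g2: "total_col I (K - {c j, c (pv j)}) (g2 j)" if "j \<in> J" for j
    using g1(1)[OF that] g1(1)[OF j0] by (auto simp: g2_def)
  have l2: "layered g2 (\<lambda>j v. c j)" by (rule layered_constant_matchings[OF c(2,3) g2])
  have s: "c j0 = ?s" using c(1) Y by simp
  have eq: "g2 (nx j0) e = g2 j0 e" for e using nd by (simp add: g2_def)
  obtain g m where gm: "layered g m" "\<And>i. i \<noteq> j0 \<Longrightarrow> m i = (\<lambda>v. c i)" "\<And>i. i \<noteq> j0 \<Longrightarrow> i \<noteq> nx j0 \<Longrightarrow> g i = g2 i"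
    "\<And>v. (\<And>e. R j0 e = Some ?s \<Longrightarrow> v \<notin> e) \<Longrightarrow> m j0 v = ?s"
    "\<And>i e. R j0 e \<noteq> Some ?s \<Longrightarrow> g i e = g2 i e" "\<And>e. R j0 e = Some ?s \<Longrightarrow> g j0 e = ?s \<and> g (nx j0) e = ?s"
    by (rule swap_in_color[OF l2 j0 R(1)[OF j0] s eq], rule that) blast+
  have ag: "agrees (R j) (g j)" if j: "j \<in> J" for j
  proof -
    consider "j = nx j0" | "j = j0" | "j \<noteq> nx j0" "j \<noteq> j0" by blast
    then show ?thesis
    proof cases
      case 1 then show ?thesis using empty by simp
    next
      case 2
      have "g j0 e = x" if e: "R j0 e = Some x" for e x
      proof (cases "x = ?s")
        case True then show ?thesis using gm(6) e by simp
      next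
        case False
        then have "R' j0 e = Some x" using e by (simp add: R'_def)
        then show ?thesis using g1(2)[OF j0] gm(5)[of e j0] e False nd by (auto simp: agrees_def g2_def)
      qed
      then show ?thesis using 2 by (auto simp: agrees_def)
    next
      case 3
      then show ?thesis using gm(3)[of j] g1(2)[OF j] by (auto simp: g2_def R'_def)
    qed
  qed
  have "g (nx j0) e = g j0 e" for e
    using gm(5)[of e] gm(6)[of e] nd by (cases "R j0 e = Some ?s") (auto simp: g2_def)
  then show ?thesis using that[of g m] gm(1,2,4) ag c(1) by auto
qed

text \<open>A single nonempty layer is coupled to both of its neighbours: items of colour \<open>s\<close> are restored
through the matching above and items of colour \<open>t\<close> through the matching below.\<close>

lemma couple_both:
  assumes j0: "j0 \<in> J" and R: "\<And>j. j \<in> J \<Longrightarrow> partial_col I K (R j)" "\<And>j. j \<in> J \<Longrightarrow> j \<noteq> j0 \<Longrightarrow> R j = Map.empty"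
    and st: "s \<in> K" "t \<in> K" "s \<noteq> t"
    and small: "card (dom (without (without (R j0) s) t)) \<le> h"
  obtains g m where "layered g m" "\<And>j. j \<in> J \<Longrightarrow> agrees (R j) (g j)"
proof -
  note nd = layers_distinct[OF j0]
  define R' where "R' = R(j0 := without (without (R j0) s) t)"
  have R': "partial_col I K (R' j)" "card (dom (R' j)) \<le> h" if "j \<in> J" for j
    using R[OF that] R(1)[OF j0] small by (auto simp: R'_def partial_col_without)
  let ?Y = "{pv (pv j0), pv j0, j0, nx j0}"
  define c0 where "c0 = (\<lambda>j. if j = pv j0 \<or> j = nx j0 then t else s)"
  have c0: "c0 j \<in> K \<and> c0 j \<notin> ran (R' j) \<and> c0 j \<notin> ran (R' (nx j))" if "j \<in> ?Y" for j
  proof -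
    have "ran (R' i) \<inter> {s, t} = {}" if "i \<in> J" for i
      using R(2)[OF that] by (cases "i = j0") (auto simp: R'_def ran_without)
    moreover have "c0 j \<in> {s, t}" by (simp add: c0_def)
    moreover have "j \<in> J" using that j0 by auto
    ultimately show ?thesis using st by (metis IntI disjoint_iff insert_iff nx_J singletonD)
  qed
  have few: "card (ran (R' j) \<union> ran (R' (nx j))) \<le> h" if "j \<in> J - ?Y" for j
  proof -
    have "j \<noteq> j0" "nx j \<noteq> j0" using that j0 by auto
    then have "R' j = Map.empty" "R' (nx j) = Map.empty" using R(2) that by (auto simp: R'_def)
    then show ?thesis by simp
  qed
  have Y: "?Y \<subseteq> J" using j0 by auto
  have proper: "c0 j \<noteq> c0 (nx j)" if "j \<in> ?Y" "nx j \<in> ?Y" for j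
  proof -
    have "pv (pv j0) \<in> J" "nx (pv (pv j0)) = pv j0" using j0 by auto
    then show ?thesis using that nd st j0 by (auto simp: c0_def)
  qed
  obtain c where c: "\<And>j. j \<in> ?Y \<Longrightarrow> c j = c0 j" "\<And>j. j \<in> J \<Longrightarrow> c j \<in> K"
    "\<And>j. j \<in> J \<Longrightarrow> c j \<noteq> c (nx j)"
    "\<And>j. j \<in> J - ?Y \<Longrightarrow> c j \<notin> ran (R' j) \<and> c j \<notin> ran (R' (nx j))"
    using walk[of ?Y c0 R', OF Y conjunct1[OF c0] proper R'(1) few] by metis
  have c': "c j \<notin> ran (R' j) \<and> c j \<notin> ran (R' (nx j))" if "j \<in> J" for j
    using c(1)[of j] c(4)[of j] c0[of j] that by (cases "j \<in> ?Y") auto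
  obtain g1 where g1: "\<And>j. j \<in> J \<Longrightarrow> total_col I (K - {c j, c (pv j)}) (g1 j)" "\<And>j. j \<in> J \<Longrightarrow> agrees (R' j) (g1 j)"
    using color_layers[of c R', OF c(2,3) R' c'] by metis
  \<comment> \<open>All three layers lie between matchings coloured \<open>s\<close> and \<open>t\<close>.\<close>
  define g2 where "g2 = g1(nx j0 := g1 j0, pv j0 := g1 j0)"
  have cv: "c j0 = s" "c (nx j0) = t" "c (pv j0) = t" "c (pv (pv j0)) = s"
    using c(1)[of j0] c(1)[of "nx j0"] c(1)[of "pv j0"] c(1)[of "pv (pv j0)"] nd by (auto simp: c0_def)
  have g2: "total_col I (K - {c j, c (pv j)}) (g2 j)" if "j \<in> J" for j
    using g1(1)[OF that] g1(1)[OF j0] cv j0 by (auto simp: g2_def insert_commute)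
  have l2: "layered g2 (\<lambda>j v. c j)" by (rule layered_constant_matchings[OF c(2,3) g2])
  have eq: "g2 (nx j0) = g2 j0" "g2 (pv j0) = g2 j0" using nd by (auto simp: g2_def)
  obtain g3 m3 where g3: "layered g3 m3" "\<And>i. i \<noteq> j0 \<Longrightarrow> m3 i = (\<lambda>v. c i)"
     "\<And>i. i \<noteq> j0 \<Longrightarrow> i \<noteq> nx j0 \<Longrightarrow> g3 i = g2 i"
    "\<And>i e. R j0 e \<noteq> Some s \<Longrightarrow> g3 i e = g2 i e" "\<And>e. R j0 e = Some s \<Longrightarrow> g3 j0 e = s \<and> g3 (nx j0) e = s"
    by (rule swap_in_color[OF l2 j0 R(1)[OF j0] cv(1) fun_cong[OF eq(1)]], rule that) blast+
  have pJ: "pv j0 \<in> J" using j0 by simp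
  obtain g4 m4 where g4: "layered g4 m4"
    "\<And>i e. R j0 e \<noteq> Some t \<Longrightarrow> g4 i e = g3 i e" "\<And>e. R j0 e = Some t \<Longrightarrow> g4 j0 e = t"
  proof (rule swap_in_color[OF g3(1) pJ R(1)[OF j0], of t])
    show "m3 (pv j0) v = t" for v using g3(2)[of "pv j0"] nd cv by simp
    show "g3 (nx (pv j0)) e = g3 (pv j0) e" if "R j0 e = Some t" for e
      using g3(4)[of e] that st eq j0 by simp
  qed (use j0 in auto)
  have "g4 j0 e = x" if e: "R j0 e = Some x" for e x
  proof (cases "x = t")
    case True then show ?thesis using g4 e by simp
  next
    case xt: False
    then have 4: "g4 j0 e = g3 j0 e" using g4(2)[of e] e by simp
    show ?thesis
    proof (cases "x = s")
      case True then show ?thesis using 4 g3(5) e by simp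
    next
      case False
      then have "R' j0 e = Some x" using e xt by (simp add: R'_def)
      then show ?thesis using g1(2)[OF j0] 4 g3(4)[of e j0] e False nd by (auto simp: agrees_def g2_def)
    qed
  qed
  then have "agrees (R j) (g4 j)" if "j \<in> J" for j
    using R(2)[OF that] by (cases "j = j0") (auto simp: agrees_def)
  then show ?thesis using that g4(1) by blast
qed


abbreviation load :: "('v set \<Rightarrow> nat option) \<Rightarrow> nat" where
  "load R \<equiv> card (dom R)"

section \<open>No precoloured vertical edge\<close>

definition used :: "('j \<Rightarrow> 'v set \<Rightarrow> nat option) \<Rightarrow> nat set" where
  "used P = (\<Union>j\<in>J. ran (P j))"

lemma not_used: "x \<notin> used P \<Longrightarrow> j \<in> J \<Longrightarrow> x \<notin> ran (P j)"
  by (auto simp: used_def)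

lemma usedI: "x \<in> ran (P j) \<Longrightarrow> j \<in> J \<Longrightarrow> x \<in> used P"
  by (auto simp: used_def)

lemma nx_eq_iff: "i \<in> J \<Longrightarrow> j \<in> J \<Longrightarrow> nx i = j \<longleftrightarrow> i = pv j"
  by (metis pv_nx nx_pv)

lemma outside_pair:
  assumes "j \<in> J" "i \<in> J - {pv j, j, nx j}"
  shows "i \<in> J" "nx i \<in> J" "nx i \<noteq> i" "i \<noteq> nx i" "nx i \<noteq> j" "nx i \<noteq> nx j" "i \<noteq> j" "i \<noteq> nx j"
  using assms nx1[of i] nx_inject[of i j] nx_eq_iff[of i j] by auto

lemma used_sub_K: "(\<And>j. j \<in> J \<Longrightarrow> partial_col I K (P j)) \<Longrightarrow> used P \<subseteq> K"
  by (auto simp: used_def partial_col_def)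

lemma card_used:
  assumes "\<And>j. j \<in> J \<Longrightarrow> partial_col I K (P j)" shows "card (used P) \<le> (\<Sum>j\<in>J. load (P j))"
proof -
  have "card (used P) \<le> (\<Sum>j\<in>J. card (ran (P j)))"
    unfolding used_def by (rule card_UN_le[OF fin_J])
  also have "\<dots> \<le> (\<Sum>j\<in>J. load (P j))"
    by (rule sum_mono) (use card_ran_le fin_dom assms in blast)
  finally show ?thesis .
qed

lemma load_0: "partial_col I K R \<Longrightarrow> load R = 0 \<Longrightarrow> R = Map.empty"
  using fin_dom by fastforce

lemma load_pos: "x \<in> ran R \<Longrightarrow> partial_col I K R \<Longrightarrow> load R \<ge> 1"
  using load_0 by fastforce

lemma ran_nonempty: "load R \<ge> 1 \<Longrightarrow> \<exists>x. x \<in> ran R"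
  by (metis card.empty dom_eq_empty_conv not_one_le_zero ranI option.exhaust_sel)

lemma sub_total: "A \<subseteq> J \<Longrightarrow> (\<Sum>j\<in>A. load (P j)) \<le> (\<Sum>j\<in>J. load (P j))"
  by (rule sum_mono2[OF fin_J]) auto

lemma pick_K: "finite B \<Longrightarrow> card B < h + 3 \<Longrightarrow> \<exists>x. x \<in> K \<and> x \<notin> B"
  using pick_from_large card_K by metis

lemma pick_avoiding:
  assumes "partial_col I K R" "partial_col I K R'" "load R + load R' \<le> h + 1"
  obtains y where "y \<in> K" "y \<noteq> x" "y \<notin> ran R" "y \<notin> ran R'"
proof -
  have "card (insert x (ran R \<union> ran R')) < h + 3"
    using card_ran_Un_le[OF assms(1,2)] assms(3) by (simp add: card_insert_if fin_ran assms)
  then show ?thesis using pick_K[of "insert x (ran R \<union> ran R')"] that fin_ran assms by auto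
qed

text \<open>The number in the name counts the prescribed edges of matchings.\<close>

definition solvable0 :: "('j \<Rightarrow> 'v set \<Rightarrow> nat option) \<Rightarrow> bool" where
  "solvable0 P \<longleftrightarrow> (\<exists>g m. layered g m \<and> (\<forall>j\<in>J. agrees (P j) (g j)))"

definition solvable1 :: "('j \<Rightarrow> 'v set \<Rightarrow> nat option) \<Rightarrow> 'j \<Rightarrow> 'v \<Rightarrow> nat \<Rightarrow> bool" where
  "solvable1 P j v x \<longleftrightarrow> (\<exists>g m. layered g m \<and> (\<forall>j\<in>J. agrees (P j) (g j)) \<and> m j v = x)"

definition solvable2 :: "('j \<Rightarrow> 'v set \<Rightarrow> nat option) \<Rightarrow> 'j \<Rightarrow> 'v \<Rightarrow> nat \<Rightarrow> 'j \<Rightarrow> 'v \<Rightarrow> nat \<Rightarrow> bool" where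
  "solvable2 P j v x j' v' x' \<longleftrightarrow> (\<exists>g m. layered g m \<and> (\<forall>j\<in>J. agrees (P j) (g j)) \<and> m j v = x \<and> m j' v' = x')"

lemma solvable0_reflect: "layers.solvable0 J pv X I K P \<Longrightarrow> solvable0 P"
proof -
  interpret r: layers J pv nx X I K h by (rule reflect)
  show "r.solvable0 P \<Longrightarrow> solvable0 P" unfolding r.solvable0_def solvable0_def using layered_reflect by blast
qed

lemma solvable1_reflect: "layers.solvable1 J pv X I K P (nx j) v x \<Longrightarrow> solvable1 P j v x"
proof -
  interpret r: layers J pv nx X I K h by (rule reflect)
  show "r.solvable1 P (nx j) v x \<Longrightarrow> solvable1 P j v x" unfolding r.solvable1_def solvable1_def using layered_reflect by blast
qed

lemma solvable2_reflect: "layers.solvable2 J pv X I K P (nx j) v x (nx j') v' x' \<Longrightarrow> solvable2 P j v x j' v' x'"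
proof -
  interpret r: layers J pv nx X I K h by (rule reflect)
  show "r.solvable2 P (nx j) v x (nx j') v' x' \<Longrightarrow> solvable2 P j v x j' v' x'"
    unfolding r.solvable2_def solvable2_def using layered_reflect by blast
qed

lemma solvable2_swap: "solvable2 P j v x j' v' x' \<Longrightarrow> solvable2 P j' v' x' j v x"
  unfolding solvable2_def by blast

lemma few_from_loads:
  assumes "\<And>j. j \<in> J \<Longrightarrow> partial_col I K (R j)" "j \<in> J" "load (R j) + load (R (nx j)) \<le> h"
  shows "card (ran (R j) \<union> ran (R (nx j))) \<le> h"
  using card_ran_Un_le[of "R j" "R (nx j)"] assms(1)[of j] assms(1)[of "nx j"] assms by simp

text \<open>At most two more items than \<open>h\<close> are prescribed altogether, so if two consecutive layers together
contain more than \<open>h\<close> of them, the remaining layers contain at most one. The matching between these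
two layers and its two neighbours are coloured first.\<close>

lemma no_vertical_spread:
  assumes P: "\<And>j. j \<in> J \<Longrightarrow> partial_col I K (P j)" and tot: "(\<Sum>j\<in>J. load (P j)) \<le> h + 2"
    and small: "\<And>j. j \<in> J \<Longrightarrow> load (P j) \<le> h"
  shows "solvable0 P"
proof (cases "\<exists>j\<in>J. load (P j) + load (P (nx j)) \<ge> h + 1")
  case False
  obtain g m where "layered g m" "\<And>j. j \<in> J \<Longrightarrow> agrees (P j) (g j)"
    by (rule color_along_walk[of "{}" undefined P])
      (use P small False few_from_loads[of P, OF P] in \<open>auto simp: not_le less_Suc_eq_le\<close>)
  then show ?thesis unfolding solvable0_def by blast
next
  case True
  then obtain j where j: "j \<in> J" and big: "load (P j) + load (P (nx j)) \<ge> h + 1" by blast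
  note nd = layers_distinct[OF j]
  have h1: "h \<ge> 1" using big small[of j] small[of "nx j"] j by (cases "h = 0") auto
  have rest: "load (P i) + load (P i') \<le> 1"
    if "i \<in> J" "i' \<in> J" "i \<noteq> i'" "i \<notin> {j, nx j}" "i' \<notin> {j, nx j}" for i i'
  proof -
    have "(\<Sum>k\<in>{j, nx j, i, i'}. load (P k)) \<le> h + 2"
      using sub_total[of "{j, nx j, i, i'}" P] tot that j by auto
    then show ?thesis using big that nd by auto
  qed
  have two: "load (P j) + load (P (nx j)) \<le> h + 2"
    using sub_total[of "{j, nx j}" P] tot j nd by auto
  have nn: "load (P (nx (nx j))) \<le> 1" "load (P (pv j)) \<le> 1"
    using rest[of "nx (nx j)" "pv j"] j nd by auto
  have "card (ran (P j) \<union> ran (P (nx j))) < h + 3"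
    using card_ran_Un_le[of "P j" "P (nx j)"] P j two by fastforce
  then obtain x where x: "x \<in> K" "x \<notin> ran (P j)" "x \<notin> ran (P (nx j))"
    using pick_K[of "ran (P j) \<union> ran (P (nx j))"] fin_ran P j by auto
  obtain y where y: "y \<in> K" "y \<noteq> x" "y \<notin> ran (P (nx j))" "y \<notin> ran (P (nx (nx j)))"
    by (rule pick_avoiding[of "P (nx j)" "P (nx (nx j))" x])
      (use P j nn small[of "nx j"] in auto)
  obtain z where z: "z \<in> K" "z \<noteq> x" "z \<notin> ran (P (pv j))" "z \<notin> ran (P j)"
    by (rule pick_avoiding[of "P (pv j)" "P j" x]) (use P j nn small[of j] in auto)
  let ?c = "(\<lambda>_. x)(nx j := y, pv j := z)"
  obtain g m where "layered g m" "\<And>j. j \<in> J \<Longrightarrow> agrees (P j) (g j)"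
  proof (rule color_along_walk[of "{pv j, j, nx j}" ?c P])
    fix i assume i: "i \<in> J - {pv j, j, nx j}"
    then have "load (P i) + load (P (nx i)) \<le> 1"
      using rest[of i "nx i"] outside_pair[OF j i] by simp
    then show "card (ran (P i) \<union> ran (P (nx i))) \<le> h"
      using few_from_loads[of P i, OF P] i h1 by auto
  qed (use P small j x y z nd in \<open>auto split: if_splits\<close>)
  then show ?thesis unfolding solvable0_def by blast
qed

lemma no_vertical_coupled:
  assumes P: "\<And>j. j \<in> J \<Longrightarrow> partial_col I K (P j)" and tot: "(\<Sum>j\<in>J. load (P j)) \<le> h + 2"
    and j: "j \<in> J" and over: "load (P j) \<ge> h + 1" and nx: "P (nx j) = Map.empty"
    and s: "s \<in> ran (P j)" "load (without (P j) s) \<le> h"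
    and hh: "h \<ge> 1 \<or> (\<forall>i\<in>J. i \<noteq> j \<longrightarrow> P i = Map.empty)"
  shows "solvable0 P"
proof -
  note nd = layers_distinct[OF j]
  have rest: "load (P i) + load (P i') \<le> 1" if "i \<in> J" "i' \<in> J" "i \<noteq> i'" "i \<noteq> j" "i' \<noteq> j" for i i'
  proof -
    have "(\<Sum>k\<in>{j, i, i'}. load (P k)) \<le> h + 2"
      using sub_total[of "{j, i, i'}" P] tot that j by auto
    then show ?thesis using over that by auto
  qed
  have rest1: "load (P i) \<le> h" if "i \<in> J" "i \<noteq> j" for i
  proof -
    have "(\<Sum>k\<in>{j, i}. load (P k)) \<le> h + 2" using sub_total[of "{j, i}" P] tot that j by auto
    then have "load (P i) \<le> 1" using over that by auto
    then show ?thesis using hh that by auto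
  qed
  obtain t where t: "t \<in> K" "t \<notin> used P"
    using pick_K[of "used P"] card_used[of P, OF P] tot used_sub_K[of P, OF P] fin_K finite_subset
    by (metis (no_types, lifting) le_imp_less_Suc le_trans numeral_2_eq_2 numeral_3_eq_3 add_Suc_right)
  have "s \<in> K" "t \<noteq> s" using s t P[OF j] usedI[of s P j] j by (auto simp: partial_col_def)
  let ?c = "(\<lambda>_. t)(j := s)"
  obtain g m where "layered g m" "\<And>j. j \<in> J \<Longrightarrow> agrees (P j) (g j)"
  proof (rule couple[of j "{pv j, j, nx j}" P ?c])
    fix i assume i: "i \<in> J - {pv j, j, nx j}"
    then have "load (P i) + load (P (nx i)) \<le> 1" "h = 0 \<Longrightarrow> load (P i) + load (P (nx i)) = 0"
      using rest[of i "nx i"] outside_pair[OF j i] hh by auto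
    then show "card (ran (P i) \<union> ran (P (nx i))) \<le> h"
      using few_from_loads[of P i, OF P] i by (cases "h = 0") auto
  qed (use P rest1 j nx s t \<open>s \<in> K\<close> \<open>t \<noteq> s\<close> nd not_used[OF t(2)] in \<open>auto split: if_splits\<close>)
  then show ?thesis unfolding solvable0_def by blast
qed

lemma only_color_left:
  assumes "h = 0" "a \<in> K" "b \<in> K" "a \<noteq> b" "x \<in> K" "x \<noteq> a" "x \<noteq> b" "y \<in> K - {a, b}"
  shows "y = x"
proof -
  have "card (K - {a, b}) = 1" using assms card_K fin_K by (simp add: card_Diff_subset)
  then obtain u where u: "K - {a, b} = {u}" by (auto simp: card_1_singleton_iff)
  have "x \<in> K - {a, b}" using assms by simp
  then show ?thesis using assms(8) by (simp add: u)
qed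

text \<open>If \<open>h = 0\<close>, a layer is one vertex and there are three colours. The item of a layer receives the
colour that the two adjacent matchings leave over, so it can be prescribed through them.\<close>

lemma single_vertex_from_walk:
  assumes h: "h = 0" and P: "\<And>j. j \<in> J \<Longrightarrow> partial_col I K (P j)" and Y: "Y \<subseteq> J"
    and K: "\<And>j. j \<in> Y \<Longrightarrow> c0 j \<in> K" and proper: "\<And>j. j \<in> Y \<Longrightarrow> nx j \<in> Y \<Longrightarrow> c0 j \<noteq> c0 (nx j)"
    and PY: "\<And>j. j \<in> J \<Longrightarrow> P j \<noteq> Map.empty \<Longrightarrow>
       pv j \<in> Y \<and> j \<in> Y \<and> c0 j \<notin> ran (P j) \<and> c0 (pv j) \<notin> ran (P j)"
  shows "solvable0 P"
proof -
  obtain c where c: "\<And>j. j \<in> Y \<Longrightarrow> c j = c0 j" "\<And>j. j \<in> J \<Longrightarrow> c j \<in> K"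
    "\<And>j. j \<in> J \<Longrightarrow> c j \<noteq> c (nx j)"
    using walk[of Y c0 "\<lambda>_. Map.empty", OF Y K proper] by (auto simp: h)
  obtain g where g: "\<And>j. j \<in> J \<Longrightarrow> total_col I (K - {c j, c (pv j)}) (g j)"
    using color_layers[of c "\<lambda>_. Map.empty", OF c(2,3)] by auto
  have "agrees (P j) (g j)" if j: "j \<in> J" for j
    unfolding agrees_def
  proof (intro allI impI)
    fix e x assume e: "P j e = Some x"
    then have ne: "P j \<noteq> Map.empty" and x: "x \<in> ran (P j)" by (auto simp: ran_def)
    have "x \<in> K" "e \<in> I" using P[OF j] x e by (auto simp: partial_col_def)
    then show "g j e = x"
      using only_color_left[OF h, of "c j" "c (pv j)" x "g j e"] g[OF j] c(1)[of j] c(1)[of "pv j"]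
        c(2)[of j] c(2)[of "pv j"] c(3)[of "pv j"] PY[OF j ne] j x by (auto simp: total_col_def)
  qed
  then show ?thesis unfolding solvable0_def using layered_constant_matchings[OF c(2,3) g] by blast
qed

lemma single_vertex_two_items:
  assumes h: "h = 0" and P: "\<And>j. j \<in> J \<Longrightarrow> partial_col I K (P j)"
    and j: "j \<in> J" "j' \<in> J" "j \<noteq> j'" and ne: "j \<noteq> nx j'" "j \<noteq> nx (nx j')"
    and one: "load (P j) \<le> 1" "load (P j') \<le> 1"
    and only: "\<And>i. i \<in> J \<Longrightarrow> i \<noteq> j \<Longrightarrow> i \<noteq> j' \<Longrightarrow> P i = Map.empty"
  shows "solvable0 P"
proof -
  note nd = layers_distinct[OF j(1)] layers_distinct[OF j(2)]
  have r: "card (ran (P j)) \<le> 1" "card (ran (P j')) \<le> 1" "finite (ran (P j))" "finite (ran (P j'))"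
    using card_ran_le[OF fin_dom] P j one fin_ran by (meson le_trans)+
  have pick: "\<exists>x. x \<in> K \<and> x \<noteq> z \<and> x \<notin> B" if "card B \<le> 1" "finite B" for z B
    using pick_K[of "insert z B"] that by (auto simp: card_insert_if h split: if_splits)
  show ?thesis
  proof (cases "j' = nx j")
    case True
    have "card (ran (P j) \<union> ran (P j')) < h + 3"
      using card_Un_le[of "ran (P j)" "ran (P j')"] r h by linarith
    then obtain x where x: "x \<in> K" "x \<notin> ran (P j)" "x \<notin> ran (P j')"
      using pick_K[of "ran (P j) \<union> ran (P j')"] r by auto
    obtain y where y: "y \<in> K" "y \<noteq> x" "y \<notin> ran (P j)" using pick r by metis
    obtain z where z: "z \<in> K" "z \<noteq> x" "z \<notin> ran (P j')" using pick r by metis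
    define c where "c = (\<lambda>_. x)(pv j := y, nx j := z)"
    have c: "c (pv j) = y" "c j = x" "c (nx j) = z" using nd by (auto simp: c_def)
    show ?thesis
    proof (rule single_vertex_from_walk[of P "{pv j, j, nx j}" c, OF h P])
      fix i assume "i \<in> {pv j, j, nx j}" "nx i \<in> {pv j, j, nx j}"
      then have "i = pv j \<or> i = j" using nd by auto
      then show "c i \<noteq> c (nx i)" using c x(1) y(2) z(2) j(1) by auto
    next
      fix i assume "i \<in> J" "P i \<noteq> Map.empty"
      then have "i = j \<or> i = nx j" using only True by blast
      then show "pv i \<in> {pv j, j, nx j} \<and> i \<in> {pv j, j, nx j} \<and> c i \<notin> ran (P i) \<and> c (pv i) \<notin> ran (P i)"
        using c x y z True j by auto
    qed (use c x y z j in auto)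
  next
    case False
    obtain y where y: "y \<in> K" "y \<notin> ran (P j)" using pick r by metis
    obtain w where w: "w \<in> K" "w \<noteq> y" "w \<notin> ran (P j)" using pick r by metis
    obtain z where z: "z \<in> K" "z \<noteq> y" "z \<notin> ran (P j')" using pick r by metis
    obtain x where x: "x \<in> K" "x \<noteq> z" "x \<notin> ran (P j')" using pick r by metis
    have d: "pv j \<noteq> j'" "pv j' \<noteq> j" "pv j \<noteq> pv j'" "nx j \<noteq> j'" "nx j' \<noteq> j" "nx j' \<noteq> pv j"
      using j ne False pv_inject by auto
    define c where "c = (\<lambda>_. x)(pv j := w, j := y, pv j' := z)"
    have c: "c (pv j) = w" "c j = y" "c (pv j') = z" "c j' = x"
      using d j nd by (auto simp: c_def)
    show ?thesis
    proof (rule single_vertex_from_walk[of P "{pv j, j, pv j', j'}" c, OF h P])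
      fix i assume "i \<in> {pv j, j, pv j', j'}" "nx i \<in> {pv j, j, pv j', j'}"
      then consider "i = pv j" | "i = pv j'" | "i = j" "nx i = pv j'"
        using d(4,5,6) nd(1,9,29,37) j(1,2) by auto
      then show "c i \<noteq> c (nx i)" using c w(2) x(2) z(2) j(1,2) by cases auto
    next
      fix i assume "i \<in> J" "P i \<noteq> Map.empty"
      then have "i = j \<or> i = j'" using only by blast
      then show "pv i \<in> {pv j, j, pv j', j'} \<and> i \<in> {pv j, j, pv j', j'} \<and> c i \<notin> ran (P i) \<and> c (pv i) \<notin> ran (P i)"
        using c x y z w by auto
    qed (use c w x y z j in auto)
  qed
qed

text \<open>An overloaded layer has at least one empty neighbour to be coupled with. If one colour does not
relieve it enough, it contains all \<open>h + 2\<close> prescribed items, and both neighbours are empty. Two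
overloaded layers occur only for \<open>h = 0\<close>.\<close>

lemma no_vertical:
  assumes P: "\<And>j. j \<in> J \<Longrightarrow> partial_col I K (P j)" and tot: "(\<Sum>j\<in>J. load (P j)) \<le> h + 2"
  shows "solvable0 P"
proof (cases "\<exists>j\<in>J. load (P j) \<ge> h + 1")
  case False
  then show ?thesis by (intro no_vertical_spread[of P] P tot) (auto simp: not_le)
next
  case True
  then obtain j where j: "j \<in> J" and over: "load (P j) \<ge> h + 1" by blast
  interpret r: layers J pv nx X I K h by (rule reflect)
  note nd = layers_distinct[OF j]
  have tj: "load (P j) \<le> h + 2" using sub_total[of "{j}" P] tot j by auto
  obtain s where s: "s \<in> ran (P j)" using ran_nonempty[of "P j"] over by auto
  have ws: "load (without (P j) s) + 1 \<le> load (P j)" by (rule card_without_less[OF P[OF j] s])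
  show ?thesis
  proof (cases "load (P j) = h + 1 \<or> load (without (P j) s) \<le> h")
    case False
    then have over2: "load (P j) = h + 2" using tj over by simp
    have emp: "P i = Map.empty" if "i \<in> J" "i \<noteq> j" for i
      using sub_total[of "{j, i}" P] tot that j over2 load_0[OF P] by auto
    obtain t where t: "t \<in> ran (without (P j) s)" using ran_nonempty False by (metis One_nat_def Suc_leI not_le_imp_less bot_nat_0.not_eq_extremum le_0_eq zero_le)
    have "load (without (without (P j) s) t) + 1 \<le> load (without (P j) s)"
      by (rule card_without_less[OF partial_col_without[OF P[OF j]] t])
    then have "load (without (without (P j) s) t) \<le> h" using ws tj by linarith
    moreover have "s \<in> K" "t \<in> K" "s \<noteq> t" using s t P[OF j] by (auto simp: partial_col_def ran_without)
    ultimately obtain g m where "layered g m" "\<And>j. j \<in> J \<Longrightarrow> agrees (P j) (g j)"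
      using couple_both[of j P s t] j P emp by metis
    then show ?thesis unfolding solvable0_def by blast
  next
    case True
    then have ws': "load (without (P j) s) \<le> h" using ws by linarith
    show ?thesis
    proof (cases "h = 0 \<and> (\<exists>i\<in>J. i \<noteq> j \<and> P i \<noteq> Map.empty)")
      case True
      then obtain i where i: "i \<in> J" "i \<noteq> j" "P i \<noteq> Map.empty" and h: "h = 0" by blast
      have li: "load (P i) \<ge> 1" using load_0[OF P] i by fastforce
      have sm: "load (P j) + load (P i) \<le> 2" using sub_total[of "{j, i}" P] tot i j h by auto
      have only: "P k = Map.empty" if "k \<in> J" "k \<noteq> j" "k \<noteq> i" for k
        using sub_total[of "{j, i, k}" P] tot that i j li over h load_0[OF P] by auto
      have one: "load (P j) \<le> 1" "load (P i) \<le> 1" using sm over li by auto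
      \<comment> \<open>On a cycle of length at least five, one of the two layers does not follow the other within two steps.\<close>
      have "\<not> ((j = nx i \<or> j = nx (nx i)) \<and> (i = nx j \<or> i = nx (nx j)))"
        using layers_distinct[OF i(1)] nx2[OF i(1)] nx3[OF i(1)] nx4[OF i(1)] by auto
      then show ?thesis
        using single_vertex_two_items[of P j i, OF h P j i(1) i(2)[symmetric] _ _ one only]
          single_vertex_two_items[of P i j, OF h P i(1) j i(2) _ _ one(2,1) only] by blast
    next
      case False
      then have hh: "h \<ge> 1 \<or> (\<forall>i\<in>J. i \<noteq> j \<longrightarrow> P i = Map.empty)" by (cases h) auto
      show ?thesis
      proof (cases "P (nx j) = Map.empty")
        case True
        show ?thesis by (rule no_vertical_coupled[OF P tot j over True s ws' hh])
      next
        case False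
        then have "load (P (nx j)) \<noteq> 0" using load_0[OF P, of "nx j"] j by auto
        then have "load (P (pv j)) = 0" using sub_total[of "{j, nx j, pv j}" P] tot j over nd by auto
        then have e: "P (pv j) = Map.empty" using load_0 P j by simp
        have "r.solvable0 P" by (rule r.no_vertical_coupled[OF P tot j over e s ws' hh])
        then show ?thesis by (rule solvable0_reflect)
      qed
    qed
  qed
qed


section \<open>Prescribing an edge of a matching\<close>

text \<open>The overloaded layer \<open>nx j\<close> is coupled upwards, away from the matching \<open>j\<close>, which therefore keeps
the constant colour \<open>c0\<close>.\<close>

lemma constant_matching_right:
  assumes j: "j \<in> J" and R: "\<And>i. i \<in> J \<Longrightarrow> partial_col I K (R i)"
    and c0: "c0 \<in> K" "c0 \<notin> ran (R j)" "c0 \<notin> ran (R (nx j))"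
    and l: "load (R j) \<le> h" "load (R (nx j)) = h + 1"
    and emp: "\<And>i. i \<in> J \<Longrightarrow> i \<noteq> j \<Longrightarrow> i \<noteq> nx j \<Longrightarrow> R i = Map.empty"
  obtains g m where "layered g m" "\<And>i. i \<in> J \<Longrightarrow> agrees (R i) (g i)" "\<And>v. m j v = c0"
proof -
  note nd = layers_distinct[OF j]
  have nj: "nx j \<in> J" using j by simp
  obtain s where s: "s \<in> ran (R (nx j))" using ran_nonempty[of "R (nx j)"] l by auto
  have "s \<in> K" using s R[OF nj] by (auto simp: partial_col_def)
  have w: "load (without (R (nx j)) s) \<le> h"
    using card_without_less[OF R[OF nj] s] l by linarith
  have sc: "s \<noteq> c0" using s c0 by blast
  define c where "c = (\<lambda>_. c0)(nx j := s)"
  have c: "c j = c0" "c (nx j) = s" "c (nx (nx j)) = c0" using nd by (auto simp: c_def)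
  have e2: "R (nx (nx j)) = Map.empty" "R (nx (nx (nx j))) = Map.empty"
    using emp[of "nx (nx j)"] emp[of "nx (nx (nx j))"] nd j by auto
  obtain g m where gm: "layered g m" "\<And>i. i \<in> J \<Longrightarrow> agrees (R i) (g i)"
      "\<And>i v. i \<in> {j, nx j, nx (nx j)} \<Longrightarrow> i \<noteq> nx j \<Longrightarrow> m i v = c i"
  proof (rule couple[of "nx j" "{j, nx j, nx (nx j)}" R c])
    show "load (without (R (nx j)) (c (nx j))) \<le> h" using w c by simp
    fix i
    show "load (R i) \<le> h" if "i \<in> J" "i \<noteq> nx j" using emp[of i] l(1) that by (cases "i = j") auto
    show "c i \<in> K" if "i \<in> {j, nx j, nx (nx j)}" using that c c0 \<open>s \<in> K\<close> by auto
    show "c i \<notin> ran (R i) \<and> c i \<notin> ran (R (nx i))" if "i \<in> {j, nx j, nx (nx j)}" "i \<noteq> nx j"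
      using that c c0 e2 by auto
    show "c i \<noteq> c (nx i)" if "i \<in> {j, nx j, nx (nx j)}" "nx i \<in> {j, nx j, nx (nx j)}"
    proof -
      have "i = j \<or> i = nx j" using that nd by auto
      then show ?thesis using c sc by auto
    qed
    show "card (ran (R i) \<union> ran (R (nx i))) \<le> h" if i: "i \<in> J - {j, nx j, nx (nx j)}"
    proof -
      have "R i = Map.empty" using emp i by auto
      moreover have "load (R (nx i)) \<le> h" using emp[of "nx i"] l(1) i nx_inject[of i j] j by (cases "nx i = j") auto
      ultimately show ?thesis using few_from_loads[of R i, OF R] i by simp
    qed
  qed (use j R e2 c nd in auto)
  show ?thesis using that[OF gm(1,2)] gm(3)[of j] nd c by auto
qed

lemma constant_matching_left:
  assumes j: "j \<in> J" and R: "\<And>i. i \<in> J \<Longrightarrow> partial_col I K (R i)"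
    and c0: "c0 \<in> K" "c0 \<notin> ran (R j)" "c0 \<notin> ran (R (nx j))"
    and l: "load (R (nx j)) \<le> h" "load (R j) = h + 1"
    and emp: "\<And>i. i \<in> J \<Longrightarrow> i \<noteq> j \<Longrightarrow> i \<noteq> nx j \<Longrightarrow> R i = Map.empty"
  obtains g m where "layered g m" "\<And>i. i \<in> J \<Longrightarrow> agrees (R i) (g i)" "\<And>v. m j v = c0"
proof -
  interpret r: layers J pv nx X I K h by (rule reflect)
  obtain g m where gm: "r.layered g m" "\<And>i. i \<in> J \<Longrightarrow> agrees (R i) (g i)" "\<And>v. m (nx j) v = c0"
    by (rule r.constant_matching_right[of "nx j" R c0]) (use assms in auto)
  show ?thesis using that[OF layered_reflect[OF gm(1)] gm(2)] gm(3) by simp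
qed

text \<open>One of the two layers at the matching \<open>j\<close> may contain \<open>h + 1\<close> items, if all layers away from this
matching are empty. Otherwise the colour \<open>a\<close> serves for both neighbouring matchings.\<close>

lemma constant_matching:
  assumes j: "j \<in> J" and R: "\<And>i. i \<in> J \<Longrightarrow> partial_col I K (R i)"
    and c0: "c0 \<in> K" "c0 \<notin> ran (R j)" "c0 \<notin> ran (R (nx j))"
    and a: "a \<in> K" "a \<noteq> c0" "\<And>i. i \<in> {pv j, j, nx j, nx (nx j)} \<Longrightarrow> a \<notin> ran (R i)"
    and l: "load (R j) \<le> h + 1" "load (R (nx j)) \<le> h + 1" "load (R j) \<le> h \<or> load (R (nx j)) \<le> h"
    and emp: "\<And>i. i \<in> J \<Longrightarrow> i \<noteq> j \<Longrightarrow> i \<noteq> nx j \<Longrightarrow> load (R j) > h \<or> load (R (nx j)) > h \<Longrightarrow> R i = Map.empty"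
    and sm: "\<And>i. i \<in> J \<Longrightarrow> i \<noteq> j \<Longrightarrow> i \<noteq> nx j \<Longrightarrow> load (R i) \<le> h"
    and few: "\<And>i. i \<in> J - {pv j, j, nx j} \<Longrightarrow> load (R i) + load (R (nx i)) \<le> h"
  obtains g m where "layered g m" "\<And>i. i \<in> J \<Longrightarrow> agrees (R i) (g i)" "\<And>v. m j v = c0"
proof -
  note nd = layers_distinct[OF j]
  consider "load (R (nx j)) = h + 1" "load (R j) \<le> h" | "load (R j) = h + 1" "load (R (nx j)) \<le> h"
    | "load (R j) \<le> h" "load (R (nx j)) \<le> h" using l by linarith
  then show ?thesis
  proof cases
    case 1
    have e: "R i = Map.empty" if "i \<in> J" "i \<noteq> j" "i \<noteq> nx j" for i using emp[OF that] 1 by simp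
    show ?thesis using constant_matching_right[OF j R c0 1(2,1) e] that by blast
  next
    case 2
    have e: "R i = Map.empty" if "i \<in> J" "i \<noteq> j" "i \<noteq> nx j" for i using emp[OF that] 2 by simp
    show ?thesis using constant_matching_left[OF j R c0 2(2,1) e] that by blast
  next
    case 3
    define c where "c = (\<lambda>_. a)(j := c0)"
    have c: "c j = c0" "c (nx j) = a" "c (pv j) = a" using nd by (auto simp: c_def)
    obtain g m where gm: "layered g m" "\<And>i. i \<in> J \<Longrightarrow> agrees (R i) (g i)" "\<And>i v. i \<in> {pv j, j, nx j} \<Longrightarrow> m i v = c i"
    proof (rule color_along_walk[of "{pv j, j, nx j}" c R])
      fix i
      show "c i \<in> K \<and> c i \<notin> ran (R i) \<and> c i \<notin> ran (R (nx i))" if "i \<in> {pv j, j, nx j}"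
      proof -
        have "\<forall>k\<in>{pv j, j, nx j, nx (nx j)}. a \<notin> ran (R k)" using a(3) by blast
        then show ?thesis using that c c0 a(1) j by auto
      qed
      show "c i \<noteq> c (nx i)" if "i \<in> {pv j, j, nx j}" "nx i \<in> {pv j, j, nx j}"
      proof -
        have "i = pv j \<or> i = j" using that nd by auto
        then show ?thesis using c a(2) j by auto
      qed
      show "load (R i) \<le> h" if "i \<in> J" using 3 sm that by blast
      show "card (ran (R i) \<union> ran (R (nx i))) \<le> h" if "i \<in> J - {pv j, j, nx j}"
        using few_from_loads[of R i, OF R] few that by auto
    qed (use j R in auto)
    show ?thesis using that[OF gm(1,2)] gm(3)[of j] c by auto
  qed
qed

lemma swap_item:
  assumes layered: "layered g m" and j: "j \<in> J" and e: "e \<in> I" "g j e = x" "g (nx j) e = x"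
    and s: "\<And>v. v \<in> e \<Longrightarrow> m j v = s"
  obtains g' m' where "layered g' m'" "\<And>i. i \<noteq> j \<Longrightarrow> m' i = m i" "\<And>v. v \<notin> e \<Longrightarrow> m' j v = m j v"
    "\<And>v. v \<in> e \<Longrightarrow> m' j v = x" "\<And>i z. z \<noteq> e \<or> (i \<noteq> j \<and> i \<noteq> nx j) \<Longrightarrow> g' i z = g i z"
    "g' j e = s"
proof -
  let ?g = "g(j := (\<lambda>z. if z \<in> {e} then s else g j z), nx j := (\<lambda>z. if z \<in> {e} then s else g (nx j) z))"
  have "\<exists>m'. layered ?g m' \<and> (\<forall>i. i \<noteq> j \<longrightarrow> m' i = m i) \<and> (\<forall>v. v \<notin> \<Union>{e} \<longrightarrow> m' j v = m j v) \<and>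
     (\<forall>e\<in>{e}. \<forall>v\<in>e. m' j v = g j e)"
    by (rule swap[OF layered j]) (use e s in auto)
  then obtain m' where m': "layered ?g m'" "\<forall>i. i \<noteq> j \<longrightarrow> m' i = m i" "\<forall>v. v \<notin> e \<longrightarrow> m' j v = m j v"
      "\<forall>v\<in>e. m' j v = g j e" by auto
  show ?thesis by (rule that[OF m'(1)]) (use m' e layers_distinct[OF j] in auto)
qed

text \<open>Stands for a prescribed edge of the matching \<open>j\<close> at a vertex of \<open>e\<close>: after an extension has been
found, an exchange at \<open>e\<close> moves the colour \<open>x\<close> to the matching; see \<open>unput\<close>.\<close>

definition put :: "('j \<Rightarrow> 'v set \<Rightarrow> nat option) \<Rightarrow> 'j \<Rightarrow> 'v set \<Rightarrow> nat \<Rightarrow> ('j \<Rightarrow> 'v set \<Rightarrow> nat option)" where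
  "put R j e x = R(j := (R j)(e \<mapsto> x), nx j := (R (nx j))(e \<mapsto> x))"

lemma put_at:
  assumes "j \<in> J"
  shows "put R j e x j = (R j)(e \<mapsto> x)" "put R j e x (nx j) = (R (nx j))(e \<mapsto> x)"
  using layers_distinct[OF assms] by (auto simp: put_def)

lemma put_other: "i \<noteq> j \<Longrightarrow> i \<noteq> nx j \<Longrightarrow> put R j e x i = R i"
  by (auto simp: put_def)

lemma put_partial_col:
  assumes j: "j \<in> J" and R: "\<And>i. i \<in> J \<Longrightarrow> partial_col I K (R i)" and e: "e \<in> I" "x \<in> K"
    and dis: "\<And>z. R j z = Some x \<or> R (nx j) z = Some x \<Longrightarrow> z \<inter> e = {}"
    and i: "i \<in> J"
  shows "partial_col I K (put R j e x i)"
proof -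
  have "partial_col I K ((R k)(e \<mapsto> x))" if "k = j \<or> k = nx j" for k
  proof (rule partial_col_upd[OF _ e])
    show "partial_col I K (R k)" using that R j by auto
    show "z = e" if "R k z = Some x" "z \<inter> e \<noteq> {}" for z
      using dis[of z] that \<open>k = j \<or> k = nx j\<close> by blast
  qed
  then show ?thesis
    using R[OF i] put_at[OF j, of R e x] put_other[of i j R e x] by (cases "i = j"; cases "i = nx j") simp_all
qed

lemma put_load:
  assumes "j \<in> J" "\<And>i. i \<in> J \<Longrightarrow> partial_col I K (R i)" "i \<in> J"
  shows "load (put R j e x i) \<le> load (R i) + 1"
proof (cases "i = j \<or> i = nx j")
  case True
  then have "put R j e x i = (R i)(e \<mapsto> x)" using put_at[OF assms(1)] by auto
  then show ?thesis using card_dom_upd_le[OF fin_dom[OF assms(2)[OF assms(3)]], of e x] by simp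
next
  case False then show ?thesis using put_other by simp
qed

lemma put_ran: "ran (put R j e x i) \<subseteq> insert x (ran (R i))"
  unfolding put_def by (auto simp: ran_def split: if_splits)

lemma unput:
  assumes layered: "layered g m" and j: "j \<in> J" and ag: "\<And>i. i \<in> J \<Longrightarrow> agrees (put R j e x i) (g i)"
    and e: "e \<in> I" "R j e = None" "R (nx j) e = None" and s: "\<And>v. v \<in> e \<Longrightarrow> m j v = s"
  obtains g' m' where "layered g' m'" "\<And>i. i \<in> J \<Longrightarrow> agrees (R i) (g' i)" "\<And>v. v \<in> e \<Longrightarrow> m' j v = x"
    "\<And>i. i \<noteq> j \<Longrightarrow> m' i = m i" "\<And>v. v \<notin> e \<Longrightarrow> m' j v = m j v"
proof -
  have ge: "g j e = x" "g (nx j) e = x"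
    using ag[of j] ag[of "nx j"] put_at[OF j, of R e x] j by (auto simp: agrees_def)
  obtain g' m' where gm: "layered g' m'" "\<And>i. i \<noteq> j \<Longrightarrow> m' i = m i" "\<And>v. v \<notin> e \<Longrightarrow> m' j v = m j v"
    "\<And>v. v \<in> e \<Longrightarrow> m' j v = x" "\<And>i z. z \<noteq> e \<or> (i \<noteq> j \<and> i \<noteq> nx j) \<Longrightarrow> g' i z = g i z"
    using swap_item[OF layered j e(1) ge s] by metis
  have "agrees (R i) (g' i)" if i: "i \<in> J" for i
    unfolding agrees_def
  proof (intro allI impI)
    fix z y assume z: "R i z = Some y"
    have 1: "z \<noteq> e \<or> (i \<noteq> j \<and> i \<noteq> nx j)" using z e by auto
    have 2: "put R j e x i z = Some y"
    proof (cases "i = j \<or> i = nx j")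
      case True
      then have "z \<noteq> e" using 1 by blast
      with True show ?thesis using z put_at[OF j, of R e x] by (elim disjE) simp_all
    next
      case False then show ?thesis using z put_other by simp
    qed
    show "g' i z = y" using gm(5)[OF 1] agreesD[OF ag[OF i] 2] by simp
  qed
  then show ?thesis using that gm by blast
qed

text \<open>An item that cannot be used to bring the colour \<open>x\<close> to the matching between two layers with
prescribed colourings \<open>R\<close> and \<open>R'\<close>.\<close>

definition blocked :: "('v set \<Rightarrow> nat option) \<Rightarrow> ('v set \<Rightarrow> nat option) \<Rightarrow> nat \<Rightarrow> 'v set \<Rightarrow> bool" where
  "blocked R R' x e \<longleftrightarrow> e \<in> dom R \<or> e \<in> dom R' \<or> (\<exists>z. (R z = Some x \<or> R' z = Some x) \<and> z \<inter> e \<noteq> {})"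

lemma blocked_commute: "blocked R R' x e \<longleftrightarrow> blocked R' R x e"
  unfolding blocked_def by blast

definition blocks :: "('v set \<Rightarrow> nat option) \<Rightarrow> nat \<Rightarrow> 'v set \<Rightarrow> 'v set \<Rightarrow> bool" where
  "blocks R x z e \<longleftrightarrow> z \<in> dom R \<and> (z = e \<or> R z = Some x \<and> z \<inter> e \<noteq> {})"

text \<open>Suppose that \<open>z\<close> has colour \<open>x\<close> and meets two items \<open>{v, w}\<close> and \<open>{v, w'}\<close> without containing \<open>v\<close>.
Then \<open>z = {w, w'}\<close>, and the three vertices form a triangle.\<close>

lemma blocks_inj:
  assumes R: "partial_col I K R" and v: "\<And>z. R z = Some x \<Longrightarrow> v \<notin> z"
    and b: "blocks R x z e" "blocks R x z e'" and e: "e \<in> I" "e' \<in> I" "v \<in> e" "v \<in> e'"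
  shows "e = e'"
proof (rule ccontr)
  assume ne: "e \<noteq> e'"
  have zx: "R z = Some x" using b ne unfolding blocks_def by blast
  have "v \<notin> z" using v[OF zx] .
  then have "z \<noteq> e" "z \<noteq> e'" using e by blast+
  then have "z \<inter> e \<noteq> {}" "z \<inter> e' \<noteq> {}" using b unfolding blocks_def by blast+
  then obtain w w' where w: "w \<in> z" "w \<in> e" "w' \<in> z" "w' \<in> e'" by blast
  have wv: "w \<noteq> v" "w' \<noteq> v" using w \<open>v \<notin> z\<close> by blast+
  have E: "e = {v, w}" "e' = {v, w'}"
    using item_cases[OF e(1,3)] item_cases[OF e(2,4)] w wv by auto
  have "w \<noteq> w'" using E ne by blast
  have zI: "z \<in> I" using zx R unfolding partial_col_def by blast
  have "z = {w, w'}" using item_cases[OF zI w(1)] w(3) \<open>w \<noteq> w'\<close> by auto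
  then show False using no_triangle[of w v w'] E e zI wv \<open>w \<noteq> w'\<close> by (auto simp: insert_commute)
qed

text \<open>Every prescribed item blocks at most one item at \<open>v\<close>. If there are no more prescribed items than
candidates in \<open>C\<close> and all candidates are blocked, then blocking is a bijection.\<close>

lemma tight_blocking:
  assumes R: "partial_col I K R" "partial_col I K R'"
    and v: "\<And>z. R z = Some x \<or> R' z = Some x \<Longrightarrow> v \<notin> z"
    and C: "C \<subseteq> {e \<in> I. v \<in> e}" and all: "\<And>e. e \<in> C \<Longrightarrow> blocked R R' x e"
    and le: "load R + load R' \<le> card C"
  shows "load R + load R' = card C"
    and "\<And>e z z'. e \<in> C \<Longrightarrow> blocks R x z e \<Longrightarrow> blocks R x z' e \<Longrightarrow> z = z'"
    and "\<And>e z z'. e \<in> C \<Longrightarrow> blocks R' x z e \<Longrightarrow> blocks R' x z' e \<Longrightarrow> z = z'"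
    and "\<And>e z z'. e \<in> C \<Longrightarrow> blocks R x z e \<Longrightarrow> blocks R' x z' e \<Longrightarrow> False"
    and "\<And>z. z \<in> dom R \<Longrightarrow> R z \<noteq> Some x \<Longrightarrow> v \<in> z"
    and "\<And>z. z \<in> dom R' \<Longrightarrow> R' z \<noteq> Some x \<Longrightarrow> v \<in> z"
proof -
  define blk where "blk y e = (case y of Inl z \<Rightarrow> blocks R x z e | Inr z \<Rightarrow> blocks R' x z e)" for y e
  let ?B = "dom R <+> dom R'"
  have finB: "finite ?B" using fin_dom[OF R(1)] fin_dom[OF R(2)] by simp
  have finC: "finite C" by (rule finite_subset[OF C]) (simp add: fin_I)
  have "\<exists>y. y \<in> ?B \<and> blk y e" if "e \<in> C" for e
  proof -
    consider "e \<in> dom R" | "e \<in> dom R'" | z where "R z = Some x" "z \<inter> e \<noteq> {}"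
      | z where "R' z = Some x" "z \<inter> e \<noteq> {}"
      using all[OF \<open>e \<in> C\<close>] unfolding blocked_def by blast
    then show ?thesis
    proof cases
      case 1 then show ?thesis by (intro exI[of _ "Inl e"]) (auto simp add: blk_def blocks_def)
    next
      case 2 then show ?thesis by (intro exI[of _ "Inr e"]) (auto simp add: blk_def blocks_def)
    next
      case 3 then show ?thesis by (intro exI[of _ "Inl z"]) (auto simp add: blk_def blocks_def)
    next
      case 4 then show ?thesis by (intro exI[of _ "Inr z"]) (auto simp add: blk_def blocks_def)
    qed
  qed
  then obtain b where b: "\<And>e. e \<in> C \<Longrightarrow> b e \<in> ?B \<and> blk (b e) e" by metis
  have inj: "e = e'" if "e \<in> C" "e' \<in> C" "blk y e" "blk y e'" for y e e'
  proof (cases y)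
    case (Inl z)
    show ?thesis by (rule blocks_inj[OF R(1), of x v z]) (use Inl that C v in \<open>auto simp: blk_def\<close>)
  next
    case (Inr z)
    show ?thesis by (rule blocks_inj[OF R(2), of x v z]) (use Inr that C v in \<open>auto simp: blk_def\<close>)
  qed
  have "inj_on b C" using b inj by (metis inj_onI)
  then have "card (b ` C) = card C" by (rule card_image)
  moreover have sub: "b ` C \<subseteq> ?B" using b by blast
  moreover have cB: "card ?B = load R + load R'" using card_Plus[OF fin_dom[OF R(1)] fin_dom[OF R(2)]] .
  ultimately have eq: "b ` C = ?B" using le finB by (metis card_mono card_subset_eq le_antisym)
  then show "load R + load R' = card C" using cB \<open>card (b ` C) = card C\<close> by simp
  have uniq: "y = b e" if "e \<in> C" "y \<in> ?B" "blk y e" for y e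
  proof -
    have "y \<in> b ` C" using that(2) eq by simp
    then obtain e' where "e' \<in> C" "y = b e'" by blast
    then show ?thesis using inj[of e e' y] b that by blast
  qed
  have in1: "Inl z \<in> ?B" if "blocks R x z e" for z e using that by (auto simp: blocks_def)
  have in2: "Inr z \<in> ?B" if "blocks R' x z e" for z e using that by (auto simp: blocks_def)
  have k1: "Inl z = b e" if "e \<in> C" "blocks R x z e" for z e
    using uniq[OF that(1) in1[OF that(2)]] that by (simp add: blk_def)
  have k2: "Inr z = b e" if "e \<in> C" "blocks R' x z e" for z e
    using uniq[OF that(1) in2[OF that(2)]] that by (simp add: blk_def)
  show "z = z'" if "e \<in> C" "blocks R x z e" "blocks R x z' e" for e z z'
    using k1 that by (metis sum.inject(1))
  show "z = z'" if "e \<in> C" "blocks R' x z e" "blocks R' x z' e" for e z z'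
    using k2 that by (metis sum.inject(2))
  show False if "e \<in> C" "blocks R x z e" "blocks R' x z' e" for e z z'
    using k1 k2 that by (metis Inl_Inr_False)
  have hit: "\<exists>e\<in>C. blk y e" if "y \<in> ?B" for y using that eq b by (metis imageE)
  show "v \<in> z" if "z \<in> dom R" "R z \<noteq> Some x" for z
  proof -
    obtain e where "e \<in> C" "blk (Inl z) e" using hit[of "Inl z"] \<open>z \<in> dom R\<close> by blast
    then show ?thesis using \<open>R z \<noteq> Some x\<close> C by (auto simp: blk_def blocks_def)
  qed
  show "v \<in> z" if "z \<in> dom R'" "R' z \<noteq> Some x" for z
  proof -
    obtain e where "e \<in> C" "blk (Inr z) e" using hit[of "Inr z"] \<open>z \<in> dom R'\<close> by blast
    then show ?thesis using \<open>R' z \<noteq> Some x\<close> C by (auto simp: blk_def blocks_def)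
  qed
qed


section \<open>One precoloured vertical edge\<close>

lemma one_vertical_free_spread:
  assumes j: "j \<in> J" and P: "\<And>i. i \<in> J \<Longrightarrow> partial_col I K (P i)"
    and tot: "(\<Sum>i\<in>J. load (P i)) \<le> h + 1"
    and x: "x \<in> K" "x \<notin> ran (P j)" "x \<notin> ran (P (nx j))"
    and small: "\<And>i. i \<in> J \<Longrightarrow> load (P i) \<le> h"
  shows "solvable1 P j v x"
proof (cases "\<exists>i\<in>J. i \<noteq> j \<and> load (P i) + load (P (nx i)) \<ge> h + 1")
  case False
  obtain g m where "layered g m" "\<And>i. i \<in> J \<Longrightarrow> agrees (P i) (g i)" "\<And>i v. i \<in> {j} \<Longrightarrow> m i v = x"
  proof (rule color_along_walk[of "{j}" "\<lambda>_. x" P])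
    fix i assume i: "i \<in> J - {j}"
    then have "load (P i) + load (P (nx i)) \<le> h" using False by (auto simp: not_le)
    then show "card (ran (P i) \<union> ran (P (nx i))) \<le> h"
      using few_from_loads[of P i, OF P] i by auto
  qed (use j P small x layers_distinct[OF j] in auto)
  then show ?thesis unfolding solvable1_def by blast
next
  case True
  then obtain i where i: "i \<in> J" "i \<noteq> j" "load (P i) + load (P (nx i)) \<ge> h + 1" by blast
  have rest: "load (P k) = 0" if "k \<in> J" "k \<noteq> i" "k \<noteq> nx i" for k
    using sub_total[of "{i, nx i, k}" P] tot i that layers_distinct[OF i(1)] by auto
  have "load (P i) + load (P (nx i)) \<le> h + 1"
    using sub_total[of "{i, nx i}" P] tot i layers_distinct[OF i(1)] by auto
  then obtain y where y: "y \<in> K" "y \<noteq> x" "y \<notin> ran (P i)" "y \<notin> ran (P (nx i))"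
    using pick_avoiding[of "P i" "P (nx i)" x] P i(1) by auto
  define c where "c = (\<lambda>_. x)(i := y)"
  have c: "c j = x" "c i = y" using i by (auto simp: c_def)
  obtain g m where "layered g m" "\<And>i. i \<in> J \<Longrightarrow> agrees (P i) (g i)" "\<And>k v. k \<in> {j, i} \<Longrightarrow> m k v = c k"
  proof (rule color_along_walk[of "{j, i}" c P])
    fix k assume k: "k \<in> J - {j, i}"
    have "load (P k) + load (P (nx k)) \<le> h"
    proof (cases "k = nx i")
      case True
      then show ?thesis using rest[of "nx k"] small[of k] i k layers_distinct[OF i(1)] by auto
    next
      case False
      then show ?thesis using rest[of k] small[of "nx k"] k by auto
    qed
    then show "card (ran (P k) \<union> ran (P (nx k))) \<le> h"
      using few_from_loads[of P k, OF P] k by auto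
  next
    fix k assume k: "k \<in> {j, i}" "nx k \<in> {j, i}"
    then have "k = j \<and> nx k = i \<or> k = i \<and> nx k = j" using nx1[of k] i j by auto
    then show "c k \<noteq> c (nx k)" using c y(2) by auto
  qed (use j i P small x y c in auto)
  then show ?thesis unfolding solvable1_def using c by blast
qed

lemma one_vertical_free_near:
  assumes j: "j \<in> J" and P: "\<And>i. i \<in> J \<Longrightarrow> partial_col I K (P i)"
    and x: "x \<in> K" "x \<notin> ran (P j)" "x \<notin> ran (P (nx j))"
    and over: "load (P (nx j)) = h + 1"
    and emp: "\<And>i. i \<in> J \<Longrightarrow> i \<noteq> nx j \<Longrightarrow> P i = Map.empty"
  shows "solvable1 P j v x"
proof -
  have "load (P j) \<le> h" using emp[of j] j layers_distinct[OF j] by simp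
  then obtain g m where "layered g m" "\<And>i. i \<in> J \<Longrightarrow> agrees (P i) (g i)" "\<And>v. m j v = x"
    using constant_matching_right[of j P x, OF j P x _ over] emp by metis
  then show ?thesis unfolding solvable1_def by blast
qed

text \<open>Layer \<open>i\<close> is coupled upwards. The two matchings around the coupled one get a colour different from
\<open>x\<close>, because one of them may be next to the matching \<open>j\<close>.\<close>

lemma one_vertical_free_far:
  assumes j: "j \<in> J" and P: "\<And>i. i \<in> J \<Longrightarrow> partial_col I K (P i)"
    and x: "x \<in> K" and i: "i \<in> J" "i \<noteq> j" "i \<noteq> nx j" "i \<noteq> pv j"
    and over: "load (P i) = h + 1"
    and emp: "\<And>k. k \<in> J \<Longrightarrow> k \<noteq> i \<Longrightarrow> P k = Map.empty"
  shows "solvable1 P j v x"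
proof -
  note nd = layers_distinct[OF i(1)]
  have ne: "j \<noteq> pv i" "j \<noteq> nx i" using i j by auto
  obtain s where s: "s \<in> ran (P i)" using ran_nonempty[of "P i"] over by auto
  have sK: "s \<in> K" using s P[OF i(1)] by (auto simp: partial_col_def)
  have w: "load (without (P i) s) \<le> h" using card_without_less[OF P[OF i(1)] s] over by linarith
  obtain t where t: "t \<in> K" "t \<noteq> x" "t \<notin> ran (P i)"
    using pick_avoiding[of "P i" Map.empty x] P[OF i(1)] over by auto
  have st: "s \<noteq> t" using s t by blast
  define c where "c = (\<lambda>_. t)(i := s, j := x)"
  have c: "c i = s" "c j = x" "c (pv i) = t" "c (nx i) = t" using i ne nd by (auto simp: c_def)
  have pp: "P (pv i) = Map.empty" "P (nx i) = Map.empty" "P (nx (nx i)) = Map.empty"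
     "P j = Map.empty" "P (nx j) = Map.empty"
    using emp i j nd by auto
  obtain g m where "layered g m" "\<And>i. i \<in> J \<Longrightarrow> agrees (P i) (g i)"
    "\<And>k v. k \<in> {pv i, i, nx i, j} \<Longrightarrow> k \<noteq> i \<Longrightarrow> m k v = c k"
  proof (rule couple[of i "{pv i, i, nx i, j}" P c])
    fix k
    show "c k \<noteq> c (nx k)" if k: "k \<in> {pv i, i, nx i, j}" "nx k \<in> {pv i, i, nx i, j}"
    proof -
      consider "k = pv i" | "k = i" | "k = nx i" "nx k = j" | "k = j" "nx k = pv i" | "k = j" "nx k = nx i"
        | "k = j" "nx k = i"
        using k nd nx1[OF j] by auto
      then show ?thesis using c t(2) st i ne j nx_inject by cases auto
    qed
    show "c k \<notin> ran (P k) \<and> c k \<notin> ran (P (nx k))" if k: "k \<in> {pv i, i, nx i, j}" "k \<noteq> i"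
      using k c pp t i by auto
    show "card (ran (P k) \<union> ran (P (nx k))) \<le> h" if k: "k \<in> J - {pv i, i, nx i, j}"
      using emp[of k] emp[of "nx k"] k nx_eq_iff[of k i] i by auto
    show "load (P k) \<le> h" if "k \<in> J" "k \<noteq> i" using emp that by simp
    show "c k \<in> K" if "k \<in> {pv i, i, nx i, j}" using that c sK t x by auto
  qed (use i j P pp w c in auto)
  then show ?thesis unfolding solvable1_def using c i by blast
qed

text \<open>The colour \<open>x\<close> does not occur in the two adjacent layers, so the whole matching \<open>j\<close> takes it. If
some layer is overloaded, it contains all prescribed items, and it is coupled through a matching
different from \<open>j\<close>.\<close>

lemma one_vertical_free:
  assumes j: "j \<in> J" and P: "\<And>i. i \<in> J \<Longrightarrow> partial_col I K (P i)"
    and tot: "(\<Sum>i\<in>J. load (P i)) \<le> h + 1"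
    and x: "x \<in> K" "x \<notin> ran (P j)" "x \<notin> ran (P (nx j))"
  shows "solvable1 P j v x"
proof (cases "\<exists>i\<in>J. load (P i) \<ge> h + 1")
  case False
  then show ?thesis by (intro one_vertical_free_spread[of j P] j P tot x) (auto simp: not_le)
next
  case True
  interpret r: layers J pv nx X I K h by (rule reflect)
  obtain i where i: "i \<in> J" "load (P i) \<ge> h + 1" using True by blast
  then have over: "load (P i) = h + 1" using sub_total[of "{i}" P] tot by auto
  have emp: "P k = Map.empty" if "k \<in> J" "k \<noteq> i" for k
    using sub_total[of "{i, k}" P] tot i that load_0[OF P] by auto
  have nj: "nx j \<in> J" using j by simp
  consider "i = nx j" | "i = j" | "i = pv j" | "i \<noteq> j" "i \<noteq> nx j" "i \<noteq> pv j" by blast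
  then show ?thesis
  proof cases
    case 1
    show ?thesis by (rule one_vertical_free_near[of j P]) (use 1 j P x over emp in auto)
  next
    case 2
    have "r.solvable1 P (nx j) v x" by (rule r.one_vertical_free_near[of "nx j" P]) (use 2 j P x over emp in auto)
    then show ?thesis by (rule solvable1_reflect)
  next
    case 3
    have "r.solvable1 P (nx j) v x"
      by (rule r.one_vertical_free_far[of "nx j" P x i]) (use 3 j P x over emp i layers_distinct[OF j] in auto)
    then show ?thesis by (rule solvable1_reflect)
  next
    case 4
    show ?thesis by (rule one_vertical_free_far[of j P x i]) (use 4 j P x over emp i in auto)
  qed
qed

text \<open>The matching \<open>j\<close> gets the colour \<open>x\<close>, and the items of colour \<open>x\<close> in layer \<open>j\<close> are restored through
it. Since none of them contains \<open>v\<close>, the exchanges do not touch the edge at \<open>v\<close>.\<close>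

lemma one_vertical_coupled:
  assumes j: "j \<in> J" and P: "\<And>i. i \<in> J \<Longrightarrow> partial_col I K (P i)"
    and tot: "(\<Sum>i\<in>J. load (P i)) \<le> h + 1"
    and v: "\<And>z. P j z = Some x \<Longrightarrow> v \<notin> z"
    and x: "x \<in> ran (P j)" and emp: "P (nx j) = Map.empty" and a: "a \<in> K" "a \<notin> used P"
  shows "solvable1 P j v x"
proof -
  note nd = layers_distinct[OF j]
  have xK: "x \<in> K" using x P[OF j] by (auto simp: partial_col_def)
  have pj: "load (P j) \<ge> 1" by (rule load_pos[OF x P[OF j]])
  have pj': "load (P j) \<le> h + 1" using sub_total[of "{j}" P] tot j by auto
  have ax: "a \<noteq> x" using a(2) usedI[of x P j, OF x j] by blast
  have w: "load (without (P j) x) \<le> h" using card_without_less[OF P[OF j] x] pj' by linarith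
  define c where "c = (\<lambda>_. a)(j := x)"
  have c: "c j = x" "c (nx j) = a" "c (pv j) = a" using nd by (auto simp: c_def)
  obtain g m where "layered g m" "\<And>i. i \<in> J \<Longrightarrow> agrees (P i) (g i)"
    "\<And>u. (\<And>e. P j e = Some (c j) \<Longrightarrow> u \<notin> e) \<Longrightarrow> m j u = c j"
  proof (rule couple[of j "{pv j, j, nx j}" P c])
    fix i
    show "c i \<noteq> c (nx i)" if "i \<in> {pv j, j, nx j}" "nx i \<in> {pv j, j, nx j}"
    proof -
      have "i = pv j \<or> i = j" using that nd by auto
      then show ?thesis using c ax j by auto
    qed
    show "c i \<notin> ran (P i) \<and> c i \<notin> ran (P (nx i))" if i: "i \<in> {pv j, j, nx j}" "i \<noteq> j"
    proof -
      have "i \<in> J" "c i = a" using i j c by auto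
      then show ?thesis using not_used[OF a(2)] by simp
    qed
    show "load (P i) \<le> h" if "i \<in> J" "i \<noteq> j"
      using sub_total[of "{i, j}" P] tot pj that j by auto
    show "card (ran (P i) \<union> ran (P (nx i))) \<le> h" if i: "i \<in> J - {pv j, j, nx j}"
    proof -
      note o = outside_pair[OF j i]
      have "load (P i) + load (P (nx i)) \<le> h"
        using sub_total[of "{i, nx i, j}" P] tot pj o j by auto
      then show ?thesis using few_from_loads[of P i, OF P] o by auto
    qed
  qed (use j P emp w c a xK in auto)
  then show ?thesis unfolding solvable1_def using c v by metis
qed

text \<open>Two layers with at least one item each, and at most \<open>h + 1\<close> items in total, can each take one more
item. They do not both exceed \<open>h\<close>, since \<open>h\<close> is even.\<close>

lemma constant_matching_one:
  assumes j: "j \<in> J" and tot: "(\<Sum>i\<in>J. load (P i)) \<le> h + 1"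
    and P: "\<And>i. i \<in> J \<Longrightarrow> partial_col I K (P i)"
    and pp: "load (P j) \<ge> 1" "load (P (nx j)) \<ge> 1"
    and R: "\<And>i. i \<in> J \<Longrightarrow> partial_col I K (R i)" "\<And>i. i \<noteq> j \<Longrightarrow> i \<noteq> nx j \<Longrightarrow> R i = P i"
    and l: "load (R j) \<le> load (P j) + 1" "load (R (nx j)) \<le> load (P (nx j)) + 1"
    and c0: "c0 \<in> K" "c0 \<notin> ran (R j)" "c0 \<notin> ran (R (nx j))"
    and a: "a \<in> K" "a \<noteq> c0" "a \<notin> used P" "a \<notin> ran (R j)" "a \<notin> ran (R (nx j))"
  obtains g m where "layered g m" "\<And>i. i \<in> J \<Longrightarrow> agrees (R i) (g i)" "\<And>v. m j v = c0"
proof -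
  note nd = layers_distinct[OF j]
  have two: "load (P j) + load (P (nx j)) \<le> h + 1" using sub_total[of "{j, nx j}" P] tot j nd by auto
  have rest: "load (P j) + load (P (nx j)) + load (P i) \<le> h + 1"
    if "i \<in> J" "i \<noteq> j" "i \<noteq> nx j" for i
    using sub_total[of "{j, nx j, i}" P] tot j nd that by auto
  have lRj: "load (R j) \<le> h + 1" "load (R (nx j)) \<le> h + 1" using l two pp by linarith+
  have h1: "h \<noteq> 1" using h_even by auto
  show ?thesis
  proof (rule constant_matching[OF j R(1) c0 a(1,2)])
    show "a \<notin> ran (R i)" if "i \<in> {pv j, j, nx j, nx (nx j)}" for i
      using that a nd R(2)[of "pv j"] R(2)[of "nx (nx j)"] not_used[OF a(3)] j by auto
    show "load (R j) \<le> h \<or> load (R (nx j)) \<le> h" using l two pp h1 by linarith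
    show "R i = Map.empty" if "i \<in> J" "i \<noteq> j" "i \<noteq> nx j" "load (R j) > h \<or> load (R (nx j)) > h" for i
    proof -
      have "load (P i) = 0" using rest[OF that(1-3)] that(4) l pp by linarith
      then show ?thesis using load_0[OF P[OF that(1)]] R(2) that by simp
    qed
    show "load (R i) \<le> h" if "i \<in> J" "i \<noteq> j" "i \<noteq> nx j" for i
      using rest[OF that] pp R(2) that by auto
    show "load (R i) + load (R (nx i)) \<le> h" if i: "i \<in> J - {pv j, j, nx j}" for i
    proof -
      note o = outside_pair[OF j i]
      have "load (P i) + load (P (nx i)) + load (P j) \<le> h + 1"
        using sub_total[of "{i, nx i, j}" P] tot o j by auto
      then show ?thesis using R(2) o pp by auto
    qed
  qed (use lRj that in \<open>blast+\<close>)
qed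

text \<open>Prescribe \<open>x\<close> at an unblocked item \<open>e\<close> in both layers and exchange it with the matching, which has
an unused colour \<open>a\<close>.\<close>

lemma one_vertical_unblocked:
  assumes j: "j \<in> J" and P: "\<And>i. i \<in> J \<Longrightarrow> partial_col I K (P i)"
    and tot: "(\<Sum>i\<in>J. load (P i)) \<le> h + 1"
    and pp: "load (P j) \<ge> 1" "load (P (nx j)) \<ge> 1"
    and x: "x \<in> used P" and ab: "a \<in> K" "a \<notin> used P" "b \<in> K" "b \<notin> used P" "a \<noteq> b"
    and e: "e \<in> I" "v \<in> e" "\<not> blocked (P j) (P (nx j)) x e"
  shows "solvable1 P j v x"
proof -
  note nd = layers_distinct[OF j]
  have xK: "x \<in> K" using x used_sub_K[of P] P by blast
  have nj: "nx j \<in> J" using j by simp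
  have free: "P j e = None" "P (nx j) e = None"
    using e(3) unfolding blocked_def by blast+
  have dis: "z \<inter> e = {}" if "P j z = Some x \<or> P (nx j) z = Some x" for z
    using e(3) that unfolding blocked_def by blast
  define R where "R = put P j e x"
  have R: "partial_col I K (R i)" if "i \<in> J" for i
    unfolding R_def by (rule put_partial_col[OF j P e(1) xK dis that])
  have ran: "ran (R i) \<subseteq> used P" if "i \<in> J" for i
    using put_ran[of P j e x i] x usedI[of _ P i, OF _ that] unfolding R_def by blast
  obtain g m where gm: "layered g m" "\<And>i. i \<in> J \<Longrightarrow> agrees (R i) (g i)" "\<And>v. m j v = a"
  proof (rule constant_matching_one[of j P R a b])
    show "load (R j) \<le> load (P j) + 1" unfolding R_def by (rule put_load[OF j P j])
    show "load (R (nx j)) \<le> load (P (nx j)) + 1" unfolding R_def by (rule put_load[OF j P nj])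
    show "R i = P i" if "i \<noteq> j" "i \<noteq> nx j" for i using put_other[OF that] by (simp add: R_def)
  qed (use j tot P pp R ab ran[OF j] ran[OF nj] in blast)+
  obtain g' m' where "layered g' m'" "\<And>i. i \<in> J \<Longrightarrow> agrees (P i) (g' i)" "\<And>u. u \<in> e \<Longrightarrow> m' j u = x"
    using unput[OF gm(1) j gm(2)[unfolded R_def] e(1) free gm(3)] by metis
  then show ?thesis unfolding solvable1_def using e(2) by blast
qed

text \<open>All \<open>h + 1\<close> items at \<open>v\<close> are blocked, so by \<open>tight_blocking\<close> each of them is blocked by exactly one
prescribed item; every prescribed item of the two layers contains \<open>v\<close> or has colour \<open>x\<close>. The singleton \<open>{v}\<close> can only
be blocked by itself. Let \<open>d\<close> be its colour. Give \<open>d\<close> to the matching and \<open>x\<close> to \<open>{v}\<close>: the exchange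
at \<open>v\<close> then produces both required colours.\<close>

lemma one_vertical_all_blocked:
  assumes j: "j \<in> J" and P: "\<And>i. i \<in> J \<Longrightarrow> partial_col I K (P i)"
    and tot: "(\<Sum>i\<in>J. load (P i)) \<le> h + 1"
    and pp: "load (P j) \<ge> 1" "load (P (nx j)) \<ge> 1"
    and vX: "v \<in> X" and v: "\<And>z. P j z = Some x \<or> P (nx j) z = Some x \<Longrightarrow> v \<notin> z"
    and x: "x \<in> used P" and a: "a \<in> K" "a \<notin> used P"
    and all: "\<And>e. e \<in> I \<Longrightarrow> v \<in> e \<Longrightarrow> blocked (P j) (P (nx j)) x e"
    and d: "P j {v} = Some d"
  shows "solvable1 P j v x"
proof -
  note nd = layers_distinct[OF j]
  have nj: "nx j \<in> J" using j by simp
  have xK: "x \<in> K" using x used_sub_K[of P] P by blast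
  let ?C = "{e \<in> I. v \<in> e}"
  have tot2: "load (P j) + load (P (nx j)) \<le> card ?C"
    using sub_total[of "{j, nx j}" P] tot j nd card_star[OF vX] by auto
  have all': "blocked (P j) (P (nx j)) x e" if "e \<in> ?C" for e using all that by blast
  note T = tight_blocking[OF P[OF j] P[OF nj] v subset_refl[of ?C] all' tot2]
  have sing: "z = z'" if "blocks (P j) x z e" "blocks (P j) x z' e" "e \<in> I" "v \<in> e" for z z' e
    using T(2) that by blast
  have sing': "z = z'" if "blocks (P (nx j)) x z e" "blocks (P (nx j)) x z' e" "e \<in> I" "v \<in> e" for z z' e
    using T(3) that by blast
  have cross: False if "blocks (P j) x z e" "blocks (P (nx j)) x z' e" "e \<in> I" "v \<in> e" for z z' e
    using T(4) that by blast
  have at_v: "v \<in> z" if "P j z = Some y" "y \<noteq> x" for z y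
    using T(5) that by (metis domI option.inject)
  have at_v': "v \<in> z" if "P (nx j) z = Some y" "y \<noteq> x" for z y
    using T(6) that by (metis domI option.inject)
  have dx: "d \<noteq> x" using v[of "{v}"] d by auto
  have dK: "d \<in> K" and vI: "{v} \<in> I" using P[OF j] d by (auto simp: partial_col_def ran_def)
  have ad: "a \<noteq> d" using a(2) usedI[of d P j] d j by (auto simp: ran_def)
  have ax: "a \<noteq> x" using a(2) x by blast
  have only_d: "z = {v}" if "P j z = Some d" for z
    using at_v[OF that dx] P[OF j] that d unfolding partial_col_def by blast
  have no_loop': "P (nx j) {v} = None"
  proof (rule ccontr)
    assume "P (nx j) {v} \<noteq> None"
    then have "blocks (P (nx j)) x {v} {v}" by (auto simp: blocks_def)
    moreover have "blocks (P j) x {v} {v}" using d by (auto simp: blocks_def)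
    ultimately show False using cross vI by blast
  qed
  have upv: "partial_col I K ((P i)({v} \<mapsto> x))" if "i = j \<or> i = nx j" for i
  proof (rule partial_col_upd[OF _ vI xK])
    show "partial_col I K (P i)" using that P j by auto
    show "z = {v}" if "P i z = Some x" "z \<inter> {v} \<noteq> {}" for z
      using that \<open>i = j \<or> i = nx j\<close> v[of z] by auto
  qed
  have lv: "load ((P j)({v} \<mapsto> x)) = load (P j)" using d by (simp add: insert_absorb domI)
  have ran_used: "ran ((P i)(e \<mapsto> x)) \<subseteq> used P" if "i \<in> J" for i e
    using ran_upd_subset[of "P i" e x] x usedI[of _ P i, OF _ that] by blast
  show ?thesis
  proof (cases "d \<in> ran (P (nx j))")
    case False
    define R where "R = P(j := (P j)({v} \<mapsto> x), nx j := (P (nx j))({v} \<mapsto> x))"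
    have Rj: "R j = (P j)({v} \<mapsto> x)" "R (nx j) = (P (nx j))({v} \<mapsto> x)" using nd by (auto simp: R_def)
    have Ro: "R i = P i" if "i \<noteq> j" "i \<noteq> nx j" for i using that by (simp add: R_def)
    have R: "partial_col I K (R i)" if "i \<in> J" for i
      using upv P that Rj Ro by (cases "i = j \<or> i = nx j") auto
    obtain g m where gm: "layered g m" "\<And>i. i \<in> J \<Longrightarrow> agrees (R i) (g i)" "\<And>v. m j v = d"
    proof (rule constant_matching_one[of j P R d a])
      show "load (R j) \<le> load (P j) + 1" unfolding Rj using lv by simp
      show "load (R (nx j)) \<le> load (P (nx j)) + 1"
        unfolding Rj by (rule card_dom_upd_le[OF fin_dom[OF P[OF nj]]])
      show "d \<notin> ran (R j)" using only_d dx unfolding Rj by (auto simp: ran_def)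
      show "d \<notin> ran (R (nx j))" using False dx unfolding Rj by (auto simp: ran_def)
      show "a \<notin> ran (R j)" "a \<notin> ran (R (nx j))"
        unfolding Rj using ran_used[OF j] ran_used[OF nj] a(2) by blast+
    qed (use j tot P pp R Ro a ad dK in blast)+
    have ge: "g j {v} = x" "g (nx j) {v} = x"
      using gm(2)[of j] gm(2)[of "nx j"] Rj j by (auto simp: agrees_def)
    obtain g' m' where gm': "layered g' m'" "m' j v = x" "\<And>i z. z \<noteq> {v} \<or> (i \<noteq> j \<and> i \<noteq> nx j) \<Longrightarrow> g' i z = g i z"
      "g' j {v} = d"
      by (rule swap_item[OF gm(1) j vI ge gm(3)]) blast
    have "agrees (P i) (g' i)" if i: "i \<in> J" for i
      unfolding agrees_def
    proof (intro allI impI)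
      fix z y assume z: "P i z = Some y"
      show "g' i z = y"
      proof (cases "z = {v} \<and> (i = j \<or> i = nx j)")
        case True
        then have "i = j" using z no_loop' by auto
        then show ?thesis using True z d gm'(4) by simp
      next
        case False
        then have "R i z = Some y" using z by (auto simp: R_def)
        then show ?thesis using gm'(3)[of z i] False agreesD[OF gm(2)[OF i]] by auto
      qed
    qed
    then show ?thesis unfolding solvable1_def using gm' by blast
  next
    case True
    then obtain y where y: "P (nx j) y = Some d" by (auto simp: ran_def)
    have yI: "y \<in> I" using y P[OF nj] by (auto simp: partial_col_def)
    have vy: "v \<in> y" using at_v'[OF y dx] .
    obtain w where w: "y = {v, w}" using item_cases[OF yI vy] by blast
    have wv: "w \<noteq> v" using w y no_loop' by auto
    have wI: "{w} \<in> I" using singleton_item item_sub[OF yI] w by blast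
    have by': "blocks (P (nx j)) x y y" using y by (auto simp: blocks_def)
    have no_w: "w \<notin> z" if "P j z = Some x" for z
    proof
      assume "w \<in> z"
      then have "blocks (P j) x z y" using that w by (auto simp: blocks_def)
      then show False using cross[OF _ by' yI vy] by blast
    qed
    have free_w: "P j {w} = None"
    proof (rule ccontr)
      assume "P j {w} \<noteq> None"
      then obtain c where c: "P j {w} = Some c" by blast
      show False
      proof (cases "c = x")
        case True then show False using no_w[of "{w}"] c by auto
      next
        case False then show False using at_v[OF c] wv by auto
      qed
    qed
    have free_y: "z \<inter> y = {}" if "P (nx j) z = Some x" for z
    proof (rule ccontr)
      assume "z \<inter> y \<noteq> {}"
      then have "blocks (P (nx j)) x z y" using that by (auto simp: blocks_def)
      then have "z = y" using sing'[OF _ by' yI vy] by blast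
      then show False using that y dx by simp
    qed
    have only_d': "z = y" if "P (nx j) z = Some d" for z
      using at_v'[OF that dx] vy P[OF nj] that y unfolding partial_col_def by blast
    \<comment> \<open>Now \<open>d\<close> also occurs on an edge \<open>y = {v, w}\<close> of the other layer. An alternating path through the two edges of the matching at \<open>v\<close> and \<open>w\<close> and through \<open>y\<close>, ending in the two singletons, restores both items of colour \<open>d\<close> at once.\<close>
    define R where "R = P(j := (P j)({v} \<mapsto> x, {w} \<mapsto> x), nx j := (P (nx j))(y \<mapsto> x))"
    have Rj: "R j = (P j)({v} \<mapsto> x, {w} \<mapsto> x)" "R (nx j) = (P (nx j))(y \<mapsto> x)"
      using nd by (auto simp: R_def)
    have Ro: "R i = P i" if "i \<noteq> j" "i \<noteq> nx j" for i using that by (simp add: R_def)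
    have "partial_col I K (R j)"
      unfolding Rj
    proof (rule partial_col_upd[OF _ wI xK])
      show "partial_col I K ((P j)({v} \<mapsto> x))" using upv by blast
      show "z = {w}" if "((P j)({v} \<mapsto> x)) z = Some x" "z \<inter> {w} \<noteq> {}" for z
        using that no_w[of z] wv by (cases "z = {v}") auto
    qed
    moreover have "partial_col I K (R (nx j))"
      unfolding Rj by (rule partial_col_upd[OF P[OF nj] yI xK]) (use free_y in blast)
    ultimately have R: "partial_col I K (R i)" if "i \<in> J" for i
      using P that Ro by (cases "i = j"; cases "i = nx j") auto
    obtain g m where gm: "layered g m" "\<And>i. i \<in> J \<Longrightarrow> agrees (R i) (g i)" "\<And>v. m j v = d"
    proof (rule constant_matching_one[of j P R d a])
      show "load (R j) \<le> load (P j) + 1"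
        using card_dom_upd_le[of "(P j)({v} \<mapsto> x)" "{w}" x] lv fin_dom[OF upv[of j]] unfolding Rj by simp
      show "load (R (nx j)) \<le> load (P (nx j)) + 1"
        unfolding Rj by (rule card_dom_upd_le[OF fin_dom[OF P[OF nj]]])
      show "d \<notin> ran (R j)" using only_d dx unfolding Rj by (auto simp: ran_def)
      show "d \<notin> ran (R (nx j))" using only_d' dx unfolding Rj by (auto simp: ran_def)
      have "ran (R j) \<subseteq> used P"
        using ran_upd_subset[of "(P j)({v} \<mapsto> x)" "{w}" x] ran_used[OF j, of "{v}"] x unfolding Rj by blast
      then show "a \<notin> ran (R j)" using a(2) by blast
      show "a \<notin> ran (R (nx j))" unfolding Rj using ran_used[OF nj] a(2) by blast
    qed (use j tot P pp R Ro a ad dK in blast)+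
    have ge: "g j {v} = x" "g j {w} = x" "g (nx j) y = x"
      using gm(2)[of j] gm(2)[of "nx j"] Rj j wv by (auto simp: agrees_def)
    let ?g = "g(j := (\<lambda>z. if z \<in> {{v}, {w}} then d else g j z), nx j := (\<lambda>z. if z \<in> {y} then d else g (nx j) z))"
    have "\<exists>m'. layered ?g m' \<and> (\<forall>i. i \<noteq> j \<longrightarrow> m' i = m i) \<and> (\<forall>u. u \<notin> \<Union>{{v}, {w}} \<longrightarrow> m' j u = m j u) \<and>
       (\<forall>e\<in>{{v}, {w}}. \<forall>u\<in>e. m' j u = g j e)"
      by (rule swap[OF gm(1) j]) (use ge gm(3) vI wI yI w in auto)
    then obtain m' where m': "layered ?g m'" "m' j v = x" using ge by auto
    have "agrees (P i) (?g i)" if i: "i \<in> J" for i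
      unfolding agrees_def
    proof (intro allI impI)
      fix z c assume z: "P i z = Some c"
      note A = agreesD[OF gm(2)[OF i], of z c]
      have zw: "i = j \<Longrightarrow> z \<noteq> {w}" using z free_w by force
      consider "i = j" "z = {v}" | "i = j" "z \<noteq> {v}" "z \<noteq> {w}" | "i = nx j" "z = y"
        | "i = nx j" "z \<noteq> y" | "i \<noteq> j" "i \<noteq> nx j" using zw by blast
      then show "?g i z = c"
      proof cases
        case 1 then show ?thesis using z d nd by simp
      next
        case 2 then show ?thesis using z A Rj nd by simp
      next
        case 3 then show ?thesis using z y by simp
      next
        case 4 then show ?thesis using z A Rj nd by simp
      next
        case 5 then show ?thesis using z A Ro by simp
      qed
    qed
    then show ?thesis unfolding solvable1_def using m' by blast
  qed
qed

text \<open>If \<open>x\<close> occurs in one of the two layers, it is used at least twice, which leaves two unused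
colours \<open>a\<close> and \<open>b\<close>.\<close>

lemma one_vertical:
  assumes j: "j \<in> J" and P: "\<And>i. i \<in> J \<Longrightarrow> partial_col I K (P i)"
    and tot: "(\<Sum>i\<in>J. load (P i)) \<le> h + 1"
    and vX: "v \<in> X" and xK: "x \<in> K"
    and v: "\<And>z. P j z = Some x \<or> P (nx j) z = Some x \<Longrightarrow> v \<notin> z"
  shows "solvable1 P j v x"
proof (cases "x \<in> ran (P j) \<or> x \<in> ran (P (nx j))")
  case False
  then show ?thesis by (intro one_vertical_free j P tot xK) auto
next
  case True
  interpret r: layers J pv nx X I K h by (rule reflect)
  have nj: "nx j \<in> J" using j by simp
  have xu: "x \<in> used P" using True usedI[of x P j] usedI[of x P "nx j"] j by auto
  have cu: "card (used P) \<le> h + 1" using card_used[of P] P tot by fastforce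
  have fu: "finite (used P)" using used_sub_K[of P] P fin_K finite_subset by blast
  obtain a where a: "a \<in> K" "a \<notin> used P" using pick_K[OF fu] cu by auto
  obtain b where b: "b \<in> K" "b \<notin> insert a (used P)"
    using pick_K[of "insert a (used P)"] fu cu a by auto
  show ?thesis
  proof (cases "load (P j) = 0 \<or> load (P (nx j)) = 0")
    case True
    then have "P j = Map.empty \<or> P (nx j) = Map.empty" using load_0 P j by auto
    then show ?thesis
    proof
      assume e: "P (nx j) = Map.empty"
      show ?thesis
        by (rule one_vertical_coupled[of j P x v a]) (use j P tot v e a \<open>x \<in> ran (P j) \<or> x \<in> ran (P (nx j))\<close> in auto)
    next
      assume e: "P j = Map.empty"
      have "r.solvable1 P (nx j) v x"
        by (rule r.one_vertical_coupled[of "nx j" P x v a]) (use j P tot v e a \<open>x \<in> ran (P j) \<or> x \<in> ran (P (nx j))\<close> in auto)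
      then show ?thesis by (rule solvable1_reflect)
    qed
  next
    case False
    then have pp: "load (P j) \<ge> 1" "load (P (nx j)) \<ge> 1" by auto
    show ?thesis
    proof (cases "\<exists>e\<in>I. v \<in> e \<and> \<not> blocked (P j) (P (nx j)) x e")
      case True
      then obtain e where "e \<in> I" "v \<in> e" "\<not> blocked (P j) (P (nx j)) x e" by blast
      then show ?thesis using one_vertical_unblocked[OF j P tot pp xu a b(1) _ _ _ _ _] b(2) by blast
    next
      case False
      then have all: "blocked (P j) (P (nx j)) x e" if "e \<in> I" "v \<in> e" for e using that by blast
      have "blocked (P j) (P (nx j)) x {v}" using all[OF singleton_item[OF vX]] by blast
      then have "{v} \<in> dom (P j) \<or> {v} \<in> dom (P (nx j))" using v unfolding blocked_def by blast
      then consider d where "P j {v} = Some d" | d where "P (nx j) {v} = Some d" by blast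
      then show ?thesis
      proof cases
        case (1 d)
        show ?thesis by (rule one_vertical_all_blocked[of j P v x a d]) (use j P tot pp vX v xu a all 1 in auto)
      next
        case (2 d)
        have all': "blocked (P (nx j)) (P j) x e" if "e \<in> I" "v \<in> e" for e
          using all[OF that] blocked_commute by blast
        have "r.solvable1 P (nx j) v x"
          by (rule r.one_vertical_all_blocked[of "nx j" P v x a d])
            (use j P tot pp vX v xu a all' 2 in auto)
        then show ?thesis by (rule solvable1_reflect)
      qed
    qed
  qed
qed


section \<open>Two precoloured vertical edges\<close>

lemma few_from_set:
  assumes "ran R \<subseteq> U" "ran R' \<subseteq> U" "finite U" "card U \<le> h"
  shows "card (ran R \<union> ran R') \<le> h"
  using assms card_mono[of U "ran R \<union> ran R'"] by auto

text \<open>The layers contain at most \<open>h\<close> prescribed items, so three colours do not occur in them.\<close>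

lemma pick_unused:
  assumes P: "\<And>i. i \<in> J \<Longrightarrow> partial_col I K (P i)" and tot: "(\<Sum>i\<in>J. load (P i)) \<le> h"
    and B: "finite B" "card B \<le> 2"
  obtains t where "t \<in> K" "t \<notin> used P" "t \<notin> B"
proof -
  have cu: "card (used P) \<le> h" using card_used[of P] P tot by fastforce
  have fu: "finite (used P)" using used_sub_K[of P] P fin_K finite_subset by blast
  have "card (used P \<union> B) < h + 3" using card_Un_le[of "used P" B] cu B by linarith
  then obtain x where "x \<in> K" "x \<notin> used P \<union> B" using pick_K[of "used P \<union> B"] fu B by auto
  then show ?thesis using that by blast
qed

lemma used_bounds:
  assumes P: "\<And>i. i \<in> J \<Longrightarrow> partial_col I K (P i)" and tot: "(\<Sum>i\<in>J. load (P i)) \<le> h"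
  shows "card (used P) \<le> h" "finite (used P)"
  using card_used[of P] used_sub_K[of P] P tot finite_subset[OF _ fin_K] by fastforce+

lemma loads_bound:
  assumes "\<forall>i\<in>J. partial_col I K (P i)" "(\<Sum>i\<in>J. load (P i)) \<le> h"
  shows "i \<in> J \<Longrightarrow> load (P i) \<le> h"
    and "i \<in> J \<Longrightarrow> j \<in> J \<Longrightarrow> i \<noteq> j \<Longrightarrow> load (P i) + load (P j) \<le> h"
    and "i \<in> J \<Longrightarrow> j \<in> J \<Longrightarrow> k \<in> J \<Longrightarrow> i \<noteq> j \<Longrightarrow> j \<noteq> k \<Longrightarrow> i \<noteq> k \<Longrightarrow>
       load (P i) + load (P j) + load (P k) \<le> h"
    and "i \<in> J \<Longrightarrow> j \<in> J \<Longrightarrow> i \<noteq> j \<Longrightarrow> load (P i) = h \<Longrightarrow> P j = Map.empty"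
proof -
  show "i \<in> J \<Longrightarrow> load (P i) \<le> h" using sub_total[of "{i}" P] assms(2) by auto
  show 2: "i \<in> J \<Longrightarrow> j \<in> J \<Longrightarrow> i \<noteq> j \<Longrightarrow> load (P i) + load (P j) \<le> h"
    using sub_total[of "{i, j}" P] assms(2) by auto
  show "i \<in> J \<Longrightarrow> j \<in> J \<Longrightarrow> k \<in> J \<Longrightarrow> i \<noteq> j \<Longrightarrow> j \<noteq> k \<Longrightarrow> i \<noteq> k \<Longrightarrow>
       load (P i) + load (P j) + load (P k) \<le> h"
    using sub_total[of "{i, j, k}" P] assms(2) by auto
  show "i \<in> J \<Longrightarrow> j \<in> J \<Longrightarrow> i \<noteq> j \<Longrightarrow> load (P i) = h \<Longrightarrow> P j = Map.empty"
    using 2 load_0 assms(1) by auto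
qed

text \<open>The matching takes the colour \<open>x\<close>, which is free for it; the second edge is moved to the singleton
of its end vertex if its colour is different.\<close>

lemma same_matching_free:
  assumes j: "j \<in> J" and P: "\<And>i. i \<in> J \<Longrightarrow> partial_col I K (P i)" and tot: "(\<Sum>i\<in>J. load (P i)) \<le> h"
    and vv: "v \<in> X" "v' \<in> X" "v \<noteq> v'" and xx: "x \<in> K" "x' \<in> K"
    and noloop: "\<And>i u. i \<in> J \<Longrightarrow> P i {u} = None"
    and v': "\<And>z. P j z = Some x' \<or> P (nx j) z = Some x' \<Longrightarrow> v' \<notin> z"
    and free: "x \<notin> ran (P j)" "x \<notin> ran (P (nx j))"
  shows "solvable2 P j v x j v' x'"
proof -
  have PB: "\<forall>i\<in>J. partial_col I K (P i)" using P by blast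
  note nd = layers_distinct[OF j] and lb = loads_bound[OF PB tot]
  have nj: "nx j \<in> J" using j by simp
  have h0': "h \<ge> 1" using single_vertex vv by (cases h) auto
  obtain a where a: "a \<in> K" "a \<notin> used P" "a \<notin> {x, x'}"
    by (rule pick_unused[of P "{x, x'}", OF P tot]) (auto simp: card_insert_if)
  define R where "R = (if x = x' then P else put P j {v'} x')"
  have Rle: "load (R i) \<le> load (P i) + 1" if "i \<in> J" for i
    using put_load[OF j P that] by (auto simp: R_def)
  have Ro: "R i = P i" if "i \<noteq> j" "i \<noteq> nx j" for i using put_other[OF that] by (auto simp: R_def)
  have Rr: "ran (R i) \<subseteq> insert x' (ran (P i))" for i using put_ran[of P j "{v'}" x' i] by (auto simp: R_def)
  have xR: "x \<notin> ran (R j)" "x \<notin> ran (R (nx j))"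
    using free Rr[of j] Rr[of "nx j"] by (cases "x = x'", auto simp: R_def)+
  have Rp: "partial_col I K (R i)" if "i \<in> J" for i
    using put_partial_col[of j P "{v'}" x' i, OF j P singleton_item[OF vv(2)] xx(2) _ that] v' P[OF that] by (auto simp: R_def)
  obtain g m where gm: "layered g m" "\<And>i. i \<in> J \<Longrightarrow> agrees (R i) (g i)" "\<And>v. m j v = x"
  proof (rule constant_matching[of j R x a])
    show "a \<notin> ran (R i)" if "i \<in> {pv j, j, nx j, nx (nx j)}" for i
    proof -
      have "i \<in> J" using that j by auto
      then show ?thesis using not_used[OF a(2)] a(3) Rr[of i] by blast
    qed
    show "load (R j) \<le> h + 1" "load (R (nx j)) \<le> h + 1"
      using Rle[OF j] Rle[OF nj] lb(1)[OF j] lb(1)[OF nj] by linarith+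
    show "load (R j) \<le> h \<or> load (R (nx j)) \<le> h"
      using Rle[OF j] Rle[OF nj] lb(2)[OF j nj nd(2)] h0' h_even by (cases "h = 1") auto
    show "R i = Map.empty" if i: "i \<in> J" "i \<noteq> j" "i \<noteq> nx j" "load (R j) > h \<or> load (R (nx j)) > h" for i
    proof -
      have "load (P j) \<ge> h \<or> load (P (nx j)) \<ge> h" using Rle[OF j] Rle[OF nj] i(4) by linarith
      then have "load (P i) = 0" using lb(2)[OF j i(1)] lb(2)[OF nj i(1)] i by auto
      then show ?thesis using Ro i load_0[OF P] by simp
    qed
    show "load (R i) \<le> h" if "i \<in> J" "i \<noteq> j" "i \<noteq> nx j" for i using Ro that lb(1) by simp
    show "load (R i) + load (R (nx i)) \<le> h" if i: "i \<in> J - {pv j, j, nx j}" for i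
      using outside_pair[OF j i] Ro lb(2)[of i "nx i"] by simp
  qed (use j Rp xx xR a in auto)
  show ?thesis
  proof (cases "x = x'")
    case True then show ?thesis unfolding solvable2_def using gm R_def by auto
  next
    case False
    then have ag: "agrees (put P j {v'} x' i) (g i)" if "i \<in> J" for i using gm(2)[OF that] by (simp add: R_def)
    obtain g' m' where "layered g' m'" "\<And>i. i \<in> J \<Longrightarrow> agrees (P i) (g' i)" "\<And>u. u \<in> {v'} \<Longrightarrow> m' j u = x'"
        "\<And>u. u \<notin> {v'} \<Longrightarrow> m' j u = m j u"
      using unput[OF gm(1) j ag singleton_item[OF vv(2)] noloop[OF j] noloop[OF nj] gm(3)] by metis
    then show ?thesis unfolding solvable2_def using vv(3) gm(3) by (metis singletonD singletonI)
  qed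
qed

text \<open>The layer above the matching is empty. Coupling through this matching with colour \<open>x\<close> yields the
first edge and makes room for the singleton \<open>{v'}\<close> in layer \<open>j\<close>. Both layers are coloured alike, so
\<open>{v'}\<close> has the colour \<open>x'\<close> in both and can be exchanged, whatever colour the edge at \<open>v'\<close> has by then.\<close>

lemma same_matching_coupled:
  assumes j: "j \<in> J" and P: "\<And>i. i \<in> J \<Longrightarrow> partial_col I K (P i)" and tot: "(\<Sum>i\<in>J. load (P i)) \<le> h"
    and vv: "v \<in> X" "v' \<in> X" "v \<noteq> v'"
    and noloop: "\<And>i u. i \<in> J \<Longrightarrow> P i {u} = None"
    and v: "\<And>z. P j z = Some x \<Longrightarrow> v \<notin> z" and v': "\<And>z. P j z = Some x' \<Longrightarrow> v' \<notin> z"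
    and obs: "x \<in> ran (P j)" "x' \<in> ran (P j)" and emp: "P (nx j) = Map.empty"
  shows "solvable2 P j v x j v' x'"
proof -
  have PB: "\<forall>i\<in>J. partial_col I K (P i)" using P by blast
  note nd = layers_distinct[OF j] and lb = loads_bound[OF PB tot]
  have nj: "nx j \<in> J" using j by simp
  have xx: "x \<in> K" "x' \<in> K" using obs P[OF j] by (auto simp: partial_col_def)
  have pj: "load (P j) \<ge> 1" by (rule load_pos[OF obs(1) P[OF j]])
  obtain a where a: "a \<in> K" "a \<notin> used P" by (rule pick_unused[of P "{}", OF P tot]) auto
  have ax: "a \<noteq> x" using a(2) usedI[of x P j, OF obs(1) j] by blast
  define R where "R = (if x = x' then P else P(j := (P j)({v'} \<mapsto> x')))"
  have Ro: "R i = P i" if "i \<noteq> j" for i using that by (auto simp: R_def)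
  have "partial_col I K ((P j)({v'} \<mapsto> x'))"
    by (rule partial_col_upd[OF P[OF j] singleton_item[OF vv(2)] xx(2)]) (use v' in auto)
  then have Rp: "partial_col I K (R i)" if "i \<in> J" for i using P[OF that] by (auto simp: R_def)
  have Rr: "ran (R i) \<subseteq> used P" if "i \<in> J" for i
    using ran_upd_subset[of "P j" "{v'}" x'] usedI[of _ P, OF _ that] obs(2)
    by (cases "i = j"; cases "x = x'") (auto simp: R_def)
  have Rx: "P j e = Some x" if "R j e = Some x" for e using that by (auto simp: R_def split: if_splits)
  have xR: "x \<in> ran (R j)"
  proof -
    obtain e where e: "P j e = Some x" using obs(1) by (auto simp: ran_def)
    then have "R j e = Some x" using noloop[OF j] by (auto simp: R_def)
    then show ?thesis by (auto simp: ran_def)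
  qed
  have "load (R j) \<le> load (P j) + 1" using card_dom_upd_le[OF fin_dom[OF P[OF j]], of "{v'}" x'] by (auto simp: R_def)
  then have w: "load (without (R j) x) \<le> h" using card_without_less[OF Rp[OF j] xR] lb(1)[OF j] by linarith
  define c where "c = (\<lambda>_. a)(j := x)"
  have c: "c j = x" "c (nx j) = a" "c (pv j) = a" using nd by (auto simp: c_def)
  obtain g m where gm: "layered g m" "\<And>i. i \<in> J \<Longrightarrow> agrees (R i) (g i)"
    "\<And>u. (\<And>e. R j e = Some (c j) \<Longrightarrow> u \<notin> e) \<Longrightarrow> m j u = c j" "\<And>e. g (nx j) e = g j e"
  proof (rule couple[of j "{pv j, j, nx j}" R c])
    fix i
    show "c i \<noteq> c (nx i)" if "i \<in> {pv j, j, nx j}" "nx i \<in> {pv j, j, nx j}"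
    proof -
      have "i = pv j \<or> i = j" using that nd by auto
      then show ?thesis using c ax j by auto
    qed
    show "c i \<notin> ran (R i) \<and> c i \<notin> ran (R (nx i))" if i: "i \<in> {pv j, j, nx j}" "i \<noteq> j"
    proof -
      have "i \<in> J" "c i = a" using i j c by auto
      then show ?thesis using a(2) Rr[of i] Rr[of "nx i"] by auto
    qed
    show "load (R i) \<le> h" if "i \<in> J" "i \<noteq> j" using lb(1) Ro that by simp
    show "card (ran (R i) \<union> ran (R (nx i))) \<le> h" if i: "i \<in> J - {pv j, j, nx j}"
      using few_from_set[OF Rr Rr used_bounds(2,1)[of P, OF P tot]] i by auto
  qed (use j Rp emp w c a xx Ro[OF nd(1)] in auto)
  have mv: "m j v = x" using gm(3)[of v] c v Rx by metis
  show ?thesis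
  proof (cases "x = x'")
    case True
    then have "m j v' = x'" using gm(3)[of v'] c v' Rx by metis
    moreover have "R = P" using True by (simp add: R_def)
    ultimately show ?thesis unfolding solvable2_def using gm(1,2) mv by auto
  next
    case False
    then have Rj: "R j = (P j)({v'} \<mapsto> x')" by (simp add: R_def)
    have ge: "g j {v'} = x'" "g (nx j) {v'} = x'" using agreesD[OF gm(2)[OF j], of "{v'}" x'] gm(4) Rj by auto
    obtain g' m' where gm': "layered g' m'" "\<And>u. u \<notin> {v'} \<Longrightarrow> m' j u = m j u"
      "\<And>u. u \<in> {v'} \<Longrightarrow> m' j u = x'" "\<And>i z. z \<noteq> {v'} \<or> (i \<noteq> j \<and> i \<noteq> nx j) \<Longrightarrow> g' i z = g i z"
      by (rule swap_item[OF gm(1) j singleton_item[OF vv(2)] ge, of "m j v'"]) auto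
    have "agrees (P i) (g' i)" if i: "i \<in> J" for i
      unfolding agrees_def
    proof (intro allI impI)
      fix z y assume z: "P i z = Some y"
      have ne: "z \<noteq> {v'}" using z noloop[OF i] by auto
      then have "R i z = Some y" using z by (auto simp: R_def)
      then show "g' i z = y" using gm'(4)[of z i] ne agreesD[OF gm(2)[OF i]] by simp
    qed
    then show ?thesis unfolding solvable2_def using gm' mv vv(3) by (metis singletonD singletonI)
  qed
qed

text \<open>Both edges are moved to singletons, so that both layers gain two items. The excluded case is the
one in which each of the two layers would then have \<open>h + 1\<close> items.\<close>

lemma same_matching_singletons:
  assumes j: "j \<in> J" and P: "\<And>i. i \<in> J \<Longrightarrow> partial_col I K (P i)" and tot: "(\<Sum>i\<in>J. load (P i)) \<le> h"
    and vv: "v \<in> X" "v' \<in> X" "v \<noteq> v'"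
    and noloop: "\<And>i u. i \<in> J \<Longrightarrow> P i {u} = None"
    and v: "\<And>z. P j z = Some x \<or> P (nx j) z = Some x \<Longrightarrow> v \<notin> z"
    and v': "\<And>z. P j z = Some x' \<or> P (nx j) z = Some x' \<Longrightarrow> v' \<notin> z"
    and obs: "x \<in> used P" "x' \<in> used P"
    and pp: "load (P j) \<ge> 1" "load (P (nx j)) \<ge> 1"
    and good: "\<not> (h = 2 \<and> load (P j) = 1 \<and> load (P (nx j)) = 1)"
  shows "solvable2 P j v x j v' x'"
proof -
  have PB: "\<forall>i\<in>J. partial_col I K (P i)" using P by blast
  note nd = layers_distinct[OF j] and lb = loads_bound[OF PB tot]
  have nj: "nx j \<in> J" using j by simp
  have xx: "x \<in> K" "x' \<in> K" using obs used_sub_K[of P] P by blast+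
  obtain a where a: "a \<in> K" "a \<notin> used P" by (rule pick_unused[of P "{}", OF P tot]) auto
  obtain b where b: "b \<in> K" "b \<notin> used P" "b \<notin> {a}" by (rule pick_unused[of P "{a}", OF P tot]) auto
  \<comment> \<open>The two singletons are added one after the other, to be removed in the opposite order.\<close>
  define Q where "Q = put P j {v'} x'"
  define R where "R = put Q j {v} x"
  have Qp: "partial_col I K (Q i)" if "i \<in> J" for i
    unfolding Q_def by (rule put_partial_col[OF j P singleton_item[OF vv(2)] xx(2) _ that]) (use v' in auto)
  have dis: "z \<inter> {v} = {}" if "Q j z = Some x \<or> Q (nx j) z = Some x" for z
    using that v[of z] vv(3) put_at[OF j, of P "{v'}" x'] by (auto simp: Q_def split: if_splits)
  have Rp: "partial_col I K (R i)" if "i \<in> J" for i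
    unfolding R_def by (rule put_partial_col[OF j Qp singleton_item[OF vv(1)] xx(1) dis that])
  have Rle: "load (R i) \<le> load (P i) + 2" if "i \<in> J" for i
    using put_load[of j Q i "{v}" x, OF j Qp that] put_load[of j P i "{v'}" x', OF j P that] by (simp add: R_def Q_def)
  have Ro: "R i = P i" if "i \<noteq> j" "i \<noteq> nx j" for i
    using put_other[OF that] by (simp add: R_def Q_def)
  have Rr: "ran (R i) \<subseteq> used P" if "i \<in> J" for i
    using put_ran[of Q j "{v}" x i] put_ran[of P j "{v'}" x' i] obs usedI[of _ P i, OF _ that]
    unfolding R_def Q_def by blast
  have two: "load (P j) + load (P (nx j)) \<le> h" by (rule lb(2)[OF j nj nd(2)])
  obtain g m where gm: "layered g m" "\<And>i. i \<in> J \<Longrightarrow> agrees (R i) (g i)" "\<And>v. m j v = a"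
  proof (rule constant_matching[of j R a b])
    show "a \<notin> ran (R j)" "a \<notin> ran (R (nx j))" using Rr[OF j] Rr[OF nj] a by auto
    show "b \<notin> ran (R i)" if "i \<in> {pv j, j, nx j, nx (nx j)}" for i
      using Rr[of i] b that j by auto
    show "load (R j) \<le> h + 1" "load (R (nx j)) \<le> h + 1"
      using Rle[OF j] Rle[OF nj] two pp by linarith+
    show "load (R j) \<le> h \<or> load (R (nx j)) \<le> h"
    proof (rule ccontr)
      assume "\<not> ?thesis"
      then have 1: "load (P j) + 1 \<ge> h" "load (P (nx j)) + 1 \<ge> h" using Rle[OF j] Rle[OF nj] by linarith+
      then have "h = 2" using two pp by linarith
      then show False using good 1 two pp by linarith
    qed
    show "R i = Map.empty" if i: "i \<in> J" "i \<noteq> j" "i \<noteq> nx j" "load (R j) > h \<or> load (R (nx j)) > h" for i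
    proof -
      have "load (P j) + 1 \<ge> h \<or> load (P (nx j)) + 1 \<ge> h" using Rle[OF j] Rle[OF nj] i(4) by linarith
      then have "load (P i) = 0" using lb(3)[OF j nj i(1)] nd i pp by fastforce
      then show ?thesis using Ro i load_0[OF P] by simp
    qed
    show "load (R i) \<le> h" if "i \<in> J" "i \<noteq> j" "i \<noteq> nx j" for i using Ro that lb(1) by simp
    show "load (R i) + load (R (nx i)) \<le> h" if i: "i \<in> J - {pv j, j, nx j}" for i
      using outside_pair[OF j i] Ro lb(2)[of i "nx i"] by simp
  qed (use j Rp a b in auto)
  have n1: "Q j {v} = None" "Q (nx j) {v} = None"
    using noloop j nj vv(3) put_at[OF j, of P "{v'}" x'] by (auto simp: Q_def)
  obtain g1 m1 where 1: "layered g1 m1" "\<And>i. i \<in> J \<Longrightarrow> agrees (Q i) (g1 i)" "\<And>u. u \<in> {v} \<Longrightarrow> m1 j u = x"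
      "\<And>u. u \<notin> {v} \<Longrightarrow> m1 j u = m j u"
    using unput[OF gm(1) j gm(2)[unfolded R_def] singleton_item[OF vv(1)] n1 gm(3)] by metis
  obtain g2 m2 where 2: "layered g2 m2" "\<And>i. i \<in> J \<Longrightarrow> agrees (P i) (g2 i)" "\<And>u. u \<in> {v'} \<Longrightarrow> m2 j u = x'"
      "\<And>u. u \<notin> {v'} \<Longrightarrow> m2 j u = m1 j u"
    using unput[OF 1(1) j 1(2)[unfolded Q_def] singleton_item[OF vv(2)] noloop[OF j] noloop[OF nj], of "m1 j v'"]
    by (metis singletonD)
  show ?thesis unfolding solvable2_def using 1(3) 2 vv(3) by (metis singletonD singletonI)
qed


text \<open>The flags \<open>o1\<close> and \<open>o2\<close> say that the respective edge is moved to a singleton; otherwise its whole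
matching takes its colour.\<close>

lemma different_matchings:
  assumes j: "j \<in> J" "j' \<in> J" "j \<noteq> j'"
    and P: "\<And>i. i \<in> J \<Longrightarrow> partial_col I K (P i)" and tot: "(\<Sum>i\<in>J. load (P i)) \<le> h"
    and vv: "v \<in> X" "v' \<in> X" and xx: "x \<in> K" "x' \<in> K"
    and noloop: "\<And>i u. i \<in> J \<Longrightarrow> P i {u} = None"
    and v: "\<And>z. P j z = Some x \<or> P (nx j) z = Some x \<Longrightarrow> v \<notin> z"
    and v': "\<And>z. P j' z = Some x' \<or> P (nx j') z = Some x' \<Longrightarrow> v' \<notin> z"
    and o: "if o1 then x \<in> used P else x \<notin> ran (P j) \<and> x \<notin> ran (P (nx j))"
    and o': "if o2 then x' \<in> used P else x' \<notin> ran (P j') \<and> x' \<notin> ran (P (nx j'))"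
    and sep: "o1 \<Longrightarrow> o2 \<Longrightarrow> nx j = j' \<or> nx j' = j \<Longrightarrow> v \<noteq> v'"
    and adj: "nx j = j' \<or> nx j' = j \<Longrightarrow> o1 \<and> o2 \<or> x \<noteq> x'"
    and l: "\<And>i. i \<in> J \<Longrightarrow> load (P i) + (if o1 \<and> (i = j \<or> i = nx j) then 1 else 0)
       + (if o2 \<and> (i = j' \<or> i = nx j') then 1 else 0) \<le> h"
  shows "solvable2 P j v x j' v' x'"
proof -
  have nj: "nx j \<in> J" "nx j' \<in> J" using j by simp_all
  note nd = layers_distinct[OF j(1)] layers_distinct[OF j(2)]
  note ub = used_bounds[of P, OF P tot]
  obtain a where a: "a \<in> K" "a \<notin> used P" "a \<notin> {x, x'}"
    by (rule pick_unused[of P "{x, x'}", OF P tot]) (auto simp: card_insert_if)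
  obtain b where b: "b \<in> K" "b \<notin> used P" "b \<notin> {a, x'}"
    by (rule pick_unused[of P "{a, x'}", OF P tot]) (auto simp: card_insert_if)
  define Q where "Q = (if o1 then put P j {v} x else P)"
  define R where "R = (if o2 then put Q j' {v'} x' else Q)"
  define c1 where "c1 = (if o1 then b else x)"
  define c2 where "c2 = (if o2 then a else x')"
  have Qp: "partial_col I K (Q i)" if "i \<in> J" for i
    using put_partial_col[of j P "{v}" x i, OF j(1) P singleton_item[OF vv(1)] xx(1) _ that] v P[OF that]
    by (auto simp: Q_def)
  have Qcases: "Q i z = P i z \<or> (o1 \<and> (i = j \<or> i = nx j) \<and> z = {v} \<and> Q i z = Some x)" for i z
    using put_at[OF j(1), of P "{v}" x] put_other[of i j P "{v}" x]
    by (cases "i = j"; cases "i = nx j") (auto simp: Q_def)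
  have shared: "nx j = j' \<or> nx j' = j" if "i = j \<or> i = nx j" "i = j' \<or> i = nx j'" for i
    using that j nx_inject[of j j'] by auto
  have Qv: "Q i z = P i z \<or> z \<noteq> {v'} \<and> z = {v}" if "o2" "i = j' \<or> i = nx j'" for i z
    using Qcases[of i z] sep[OF _ that(1)] shared[OF _ that(2)] by auto
  have Qnone: "Q i {v'} = None" if "o2" "i = j' \<or> i = nx j'" for i
    using Qv[OF that, of "{v'}"] noloop[of i v'] that nj j by auto
  have Rp: "partial_col I K (R i)" if i: "i \<in> J" for i
  proof (cases o2)
    case True
    have dis: "z \<inter> {v'} = {}" if z: "Q j' z = Some x' \<or> Q (nx j') z = Some x'" for z
    proof -
      obtain k where k: "k = j' \<or> k = nx j'" "Q k z = Some x'" using z by blast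
      from Qv[OF True k(1), of z] show ?thesis
      proof
        assume "Q k z = P k z"
        then have "v' \<notin> z" using v'[of z] k by auto
        then show ?thesis by simp
      next
        assume "z \<noteq> {v'} \<and> z = {v}" then show ?thesis by auto
      qed
    qed
    show ?thesis unfolding R_def using True put_partial_col[of j' Q "{v'}" x' i, OF j(2) Qp singleton_item[OF vv(2)] xx(2) dis i] by simp
  next
    case False then show ?thesis using Qp[OF i] by (simp add: R_def)
  qed
  have Rle: "load (R i) \<le> h" if i: "i \<in> J" for i
  proof -
    have 1: "load (Q i) \<le> load (P i) + (if o1 \<and> (i = j \<or> i = nx j) then 1 else 0)"
      using put_load[of j P i "{v}" x, OF j(1) P i] put_other[of i j P "{v}" x] by (auto simp: Q_def)
    have 2: "load (R i) \<le> load (Q i) + (if o2 \<and> (i = j' \<or> i = nx j') then 1 else 0)"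
      using put_load[of j' Q i "{v'}" x', OF j(2) Qp i] put_other[of i j' Q "{v'}" x'] by (auto simp: R_def)
    show ?thesis using 1 2 l[OF i] by linarith
  qed
  have Rr: "ran (R i) \<subseteq> used P" if i: "i \<in> J" for i
  proof -
    have "ran (P i) \<subseteq> used P" using usedI[of _ P i, OF _ i] by blast
    moreover have "ran (Q i) \<subseteq> (if o1 then insert x (ran (P i)) else ran (P i))"
      using put_ran[of P j "{v}" x i] by (auto simp: Q_def)
    moreover have "ran (R i) \<subseteq> (if o2 then insert x' (ran (Q i)) else ran (Q i))"
      using put_ran[of Q j' "{v'}" x' i] by (auto simp: R_def)
    ultimately show ?thesis using o o' by (cases o1; cases o2) auto
  qed
  have Rx: "y \<in> ran (P i) \<or> o1 \<and> (i = j \<or> i = nx j) \<and> y = x \<or> o2 \<and> (i = j' \<or> i = nx j') \<and> y = x'"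
    if "y \<in> ran (R i)" for i y
  proof -
    from that obtain z where z: "R i z = Some y" unfolding ran_def by blast
    have "R i z = Q i z \<or> o2 \<and> (i = j' \<or> i = nx j') \<and> R i z = Some x'"
      using put_at[OF j(2), of Q "{v'}" x'] put_other[of i j' Q "{v'}" x']
      by (cases "i = j'"; cases "i = nx j'") (auto simp: R_def)
    then show ?thesis using Qcases[of i z] z by (auto simp: ran_def)
  qed
  have c1: "c1 \<in> K" "c1 \<notin> ran (R j)" "c1 \<notin> ran (R (nx j))"
  proof -
    show "c1 \<in> K" using b xx by (simp add: c1_def)
    have "c1 \<notin> ran (R i)" if i: "i = j \<or> i = nx j" for i
    proof (cases o1)
      case True
      have "i \<in> J" using i j nj by auto
      then show ?thesis using True b Rr by (auto simp: c1_def)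
    next
      case False
      then have "x \<notin> ran (P i)" using o i by auto
      then show ?thesis using False Rx[of x i] shared[OF i] adj by (auto simp: c1_def)
    qed
    then show "c1 \<notin> ran (R j)" "c1 \<notin> ran (R (nx j))" by blast+
  qed
  have c2: "c2 \<in> K" "c2 \<notin> ran (R j')" "c2 \<notin> ran (R (nx j'))"
  proof -
    show "c2 \<in> K" using a xx by (simp add: c2_def)
    have "c2 \<notin> ran (R i)" if i: "i = j' \<or> i = nx j'" for i
    proof (cases o2)
      case True
      have "i \<in> J" using i j nj by auto
      then show ?thesis using True a Rr by (auto simp: c2_def)
    next
      case False
      then have "x' \<notin> ran (P i)" using o' i by auto
      then show ?thesis using False Rx[of x' i] shared[OF _ i] adj by (auto simp: c2_def)
    qed
    then show "c2 \<notin> ran (R j')" "c2 \<notin> ran (R (nx j'))" by blast+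
  qed
  have c12: "nx j = j' \<or> nx j' = j \<Longrightarrow> c1 \<noteq> c2"
    using a b adj by (auto simp: c1_def c2_def)
  define c where "c = (\<lambda>_. c2)(j := c1)"
  have c: "c j = c1" "c j' = c2" using j by (auto simp: c_def)
  obtain g m where gm: "layered g m" "\<And>i. i \<in> J \<Longrightarrow> agrees (R i) (g i)" "\<And>i u. i \<in> {j, j'} \<Longrightarrow> m i u = c i"
  proof (rule color_along_walk[of "{j, j'}" c R])
    fix i
    show "c i \<in> K \<and> c i \<notin> ran (R i) \<and> c i \<notin> ran (R (nx i))" if "i \<in> {j, j'}"
      using that c c1 c2 by auto
    show "c i \<noteq> c (nx i)" if i: "i \<in> {j, j'}" "nx i \<in> {j, j'}"
    proof -
      have "i = j \<and> nx i = j' \<or> i = j' \<and> nx i = j" using i nd(1) nd(29) by auto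
      then show ?thesis using c c12 by auto
    qed
    show "card (ran (R i) \<union> ran (R (nx i))) \<le> h" if i: "i \<in> J - {j, j'}"
      using few_from_set[OF Rr Rr ub(2,1)] i by auto
  qed (use j Rp Rle in auto)
  have mj: "m j u = c1" "m j' u = c2" for u using gm(3) c by auto
  obtain g1 m1 where 1: "layered g1 m1" "\<And>i. i \<in> J \<Longrightarrow> agrees (Q i) (g1 i)" "m1 j' v' = x'" "m1 j = m j"
  proof (cases o2)
    case True
    have ag: "agrees (put Q j' {v'} x' i) (g i)" if "i \<in> J" for i using gm(2)[OF that] True by (simp add: R_def)
    have n: "Q j' {v'} = None" "Q (nx j') {v'} = None" using Qnone[OF True] by auto
    show ?thesis using unput[OF gm(1) j(2) ag singleton_item[OF vv(2)] n mj(2)] j(3) that by (metis singletonI)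
  next
    case False
    then show ?thesis using that[of g m] gm mj by (auto simp: R_def c2_def)
  qed
  obtain g2 m2 where 2: "layered g2 m2" "\<And>i. i \<in> J \<Longrightarrow> agrees (P i) (g2 i)" "m2 j v = x" "m2 j' = m1 j'"
  proof (cases o1)
    case True
    have ag: "agrees (put P j {v} x i) (g1 i)" if "i \<in> J" for i using 1(2)[OF that] True by (simp add: Q_def)
    show ?thesis using unput[OF 1(1) j(1) ag singleton_item[OF vv(1)] noloop[OF j(1)] noloop[OF nj(1)], of c1] 1(4) mj(1) j(3) that
      by (metis singletonI)
  next
    case False
    then show ?thesis using that[of g1 m1] 1 mj by (auto simp: Q_def c1_def)
  qed
  show ?thesis unfolding solvable2_def using 2 1(3) by metis
qed

text \<open>Three consecutive layers \<open>j\<close>, \<open>k\<close>, \<open>l\<close>, with one prescribed edge in each of the two matchings between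
them. Layer \<open>l\<close> is empty: layer \<open>k\<close> is coupled with it through the colour \<open>x'\<close> of the second edge, and
the first edge is moved to the singleton \<open>{v}\<close>, whose colour may itself be \<open>x'\<close>.\<close>

lemma adjacent_coupled:
  fixes j defines "k \<equiv> nx j"
  defines "l \<equiv> nx k"
  assumes j: "j \<in> J"
    and P: "\<And>i. i \<in> J \<Longrightarrow> partial_col I K (P i)" and tot: "(\<Sum>i\<in>J. load (P i)) \<le> h"
    and vv: "v \<in> X" and xx: "x \<in> K" "x' \<in> K"
    and noloop: "\<And>i u. i \<in> J \<Longrightarrow> P i {u} = None"
    and v: "\<And>z. P j z = Some x \<or> P k z = Some x \<Longrightarrow> v \<notin> z"
    and v': "\<And>z. P k z = Some x' \<Longrightarrow> v' \<notin> z"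
    and obs: "x' \<in> ran (P k) \<or> x' = x" and ne: "x = x' \<Longrightarrow> v \<noteq> v'"
    and emp: "P l = Map.empty" and pj: "load (P j) + 1 \<le> h"
  shows "solvable2 P j v x k v' x'"
proof -
  have PB: "\<forall>i\<in>J. partial_col I K (P i)" using P by blast
  note nd = layers_distinct[OF j] and lb = loads_bound[OF PB tot]
  have kl: "k \<in> J" "l \<in> J" "nx j = k" "nx k = l" "pv k = j" "pv j \<in> J" using j by (simp_all add: k_def l_def)
  have d: "j \<noteq> k" "j \<noteq> l" "k \<noteq> l" "pv j \<noteq> j" "pv j \<noteq> k" "pv j \<noteq> l" "nx l \<noteq> j" "nx l \<noteq> k" "nx l \<noteq> l" "nx l \<noteq> pv j"
    using nd by (auto simp: k_def l_def)
  have vI: "{v} \<in> I" by (rule singleton_item[OF vv])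
  obtain t where t: "t \<in> K" "t \<notin> used P" "t \<notin> {x}" by (rule pick_unused[of P "{x}", OF P tot]) auto
  obtain t' where t': "t' \<in> K" "t' \<notin> used P" "t' \<notin> {x, t}"
    by (rule pick_unused[of P "{x, t}", OF P tot]) (auto simp: card_insert_if)
  define R where "R = put P j {v} x"
  have Rj: "R j = (P j)({v} \<mapsto> x)" "R k = (P k)({v} \<mapsto> x)" using put_at[OF j] by (simp_all add: R_def k_def)
  have Ro: "R i = P i" if "i \<noteq> j" "i \<noteq> k" for i using put_other that by (simp add: R_def k_def)
  have Rp: "partial_col I K (R i)" if "i \<in> J" for i
    unfolding R_def by (rule put_partial_col[OF j P vI xx(1) _ that]) (use v in \<open>auto simp: k_def\<close>)
  have Rle: "load (R i) \<le> load (P i) + 1" if "i \<in> J" for i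
    unfolding R_def by (rule put_load[OF j P that])
  have Pu: "ran (P i) \<subseteq> used P" if "i \<in> J" for i using usedI[of _ P i, OF _ that] by blast
  have Rr: "ran (R i) \<subseteq> insert x (used P)" if "i \<in> J" for i
    using put_ran[of P j "{v}" x i] Pu[OF that] unfolding R_def by blast
  have x'R: "x' \<in> ran (R k)"
  proof (cases "x' = x")
    case True then show ?thesis by (auto simp: Rj ran_def)
  next
    case False
    then obtain z where z: "P k z = Some x'" using obs by (auto simp: ran_def)
    then have "z \<noteq> {v}" using noloop[OF kl(1), of v] by auto
    then show ?thesis using z by (auto simp: Rj ran_def)
  qed
  have w: "load (without (R k) x') \<le> h"
    using card_without_less[OF Rp[OF kl(1)] x'R] Rle[OF kl(1)] lb(1)[OF kl(1)] by linarith
  have tx': "t \<noteq> x'" using obs t Pu[OF kl(1)] by auto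
  \<comment> \<open>The colour of the matching below \<open>j\<close> has to be fixed too, as \<open>x\<close> need not be among the used colours.\<close>
  define c where "c = (\<lambda>_. t)(k := x', pv j := t')"
  have c: "c (pv j) = t'" "c j = t" "c k = x'" "c l = t" using d by (auto simp: c_def)
  obtain g m where gm: "layered g m" "\<And>i. i \<in> J \<Longrightarrow> agrees (R i) (g i)"
    "\<And>i u. i \<in> {pv j, j, k, l} \<Longrightarrow> i \<noteq> k \<Longrightarrow> m i u = c i"
    "\<And>u. (\<And>e. R k e = Some (c k) \<Longrightarrow> u \<notin> e) \<Longrightarrow> m k u = c k"
  proof (rule couple[of k "{pv j, j, k, l}" R c])
    fix i
    show "c i \<noteq> c (nx i)" if i: "i \<in> {pv j, j, k, l}" "nx i \<in> {pv j, j, k, l}"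
    proof -
      have "i = pv j \<or> i = j \<or> i = k" using i d by auto
      then show ?thesis using c kl j t' tx' by auto
    qed
    show "c i \<notin> ran (R i) \<and> c i \<notin> ran (R (nx i))" if i: "i \<in> {pv j, j, k, l}" "i \<noteq> k"
    proof -
      have "i \<in> J" "c i \<in> {t, t'}" using i c kl j by auto
      then show ?thesis using t t' Rr[of i] Rr[of "nx i"] by auto
    qed
    show "load (R i) \<le> h" if "i \<in> J" "i \<noteq> k"
    proof (cases "i = j")
      case True then show ?thesis using Rle[OF j] pj by simp
    next
      case False then show ?thesis using Ro[of i] lb(1)[of i] that by simp
    qed
    show "card (ran (R i) \<union> ran (R (nx i))) \<le> h" if i: "i \<in> J - {pv j, j, k, l}"
    proof -
      have "nx i \<noteq> j" "nx i \<noteq> k" using nx_eq_iff[of i j] nx_eq_iff[of i k] i j kl by auto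
      then have "R i = P i" "R (nx i) = P (nx i)" using Ro i by auto
      then show ?thesis
        using few_from_set[OF Pu[of i] Pu[of "nx i"] used_bounds(2,1)[of P, OF P tot]] i by auto
    qed
    show "c i \<in> K" if "i \<in> {pv j, j, k, l}" using that c t t' xx by auto
  qed (use j kl Rp emp w c d Ro[of l] in auto)
  have "m k v' = x'"
  proof -
    have "v' \<notin> e" if "R k e = Some x'" for e
      using that v'[of e] ne by (auto simp: Rj split: if_splits)
    then show ?thesis using gm(4)[of v'] c by simp
  qed
  moreover obtain g' m' where "layered g' m'" "\<And>i. i \<in> J \<Longrightarrow> agrees (P i) (g' i)" "\<And>u. u \<in> {v} \<Longrightarrow> m' j u = x"
      "\<And>i. i \<noteq> j \<Longrightarrow> m' i = m i"
    using unput[OF gm(1) j gm(2)[unfolded R_def] vI noloop[OF j] noloop[of "nx j"], of t] gm(3)[of j] c d j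
    by (metis insertCI nx_J)
  ultimately show ?thesis unfolding solvable2_def using d(1) by (metis singletonI)
qed

text \<open>All items of the layers lie in \<open>l\<close>, which becomes overloaded when the second edge is moved to a
singleton, and is coupled with the layer above it. The flag \<open>o1\<close> says that the first edge is moved
to a singleton as well.\<close>

lemma adjacent_outer:
  fixes j defines "k \<equiv> nx j"
  defines "l \<equiv> nx k"
  assumes j: "j \<in> J"
    and P: "\<And>i. i \<in> J \<Longrightarrow> partial_col I K (P i)" and tot: "(\<Sum>i\<in>J. load (P i)) \<le> h"
    and vv: "v \<in> X" "v' \<in> X" and xx: "x \<in> K" "x' \<in> K"
    and noloop: "\<And>i u. i \<in> J \<Longrightarrow> P i {u} = None"
    and v': "\<And>z. P l z = Some x' \<Longrightarrow> v' \<notin> z"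
    and o: "if o1 then x = x' \<and> v \<noteq> v' else x \<noteq> x'"
    and full: "load (P l) = h" and h2: "h \<ge> 2"
  shows "solvable2 P j v x k v' x'"
proof -
  have PB: "\<forall>i\<in>J. partial_col I K (P i)" using P by blast
  note nd = layers_distinct[OF j] and lb = loads_bound[OF PB tot]
  have kl: "k \<in> J" "l \<in> J" "nx j = k" "nx k = l" "pv k = j" "pv l = k" "nx l \<in> J" using j by (simp_all add: k_def l_def)
  have d: "j \<noteq> k" "j \<noteq> l" "k \<noteq> l" "nx l \<noteq> j" "nx l \<noteq> k" "nx l \<noteq> l" "nx (nx l) \<noteq> j" "nx (nx l) \<noteq> k" "nx (nx l) \<noteq> l"
    "nx (nx l) \<noteq> nx l"
    using nd layers_distinct[OF kl(1)] layers_distinct[OF kl(2)] nx4[OF j] by (auto simp: k_def l_def)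
  have emp: "P i = Map.empty" if "i \<in> J" "i \<noteq> l" for i using lb(4)[OF kl(2) that(1)] that full by simp
  have Pj: "P j = Map.empty" "P k = Map.empty" using emp j kl d by auto
  have I1: "{v} \<in> I" "{v'} \<in> I" using singleton_item vv by blast+
  obtain t where t: "t \<in> K" "t \<notin> used P" "t \<notin> {x, x'}"
    by (rule pick_unused[of P "{x, x'}", OF P tot]) (auto simp: card_insert_if)
  obtain t' where t': "t' \<in> K" "t' \<notin> used P" "t' \<notin> {x, t}"
    by (rule pick_unused[of P "{x, t}", OF P tot]) (auto simp: card_insert_if)
  define Q where "Q = (if o1 then put P j {v} x else P)"
  define R where "R = put Q k {v'} x'"
  define cj where "cj = (if o1 then t' else x)"
  have Qp: "partial_col I K (Q i)" if "i \<in> J" for i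
    using put_partial_col[of j P "{v}" x i, OF j P I1(1) xx(1) _ that] P[OF that] Pj
    by (auto simp: Q_def k_def)
  have Qk: "Q k = (if o1 then Map.empty({v} \<mapsto> x) else Map.empty)"
    using put_at(2)[OF j, of P "{v}" x] Pj by (auto simp: Q_def k_def)
  have Qj: "Q j = (if o1 then Map.empty({v} \<mapsto> x) else Map.empty)"
    using put_at(1)[OF j, of P "{v}" x] Pj by (auto simp: Q_def)
  have Qo: "Q i = P i" if "i \<noteq> j" "i \<noteq> k" for i using put_other[of i j P "{v}" x] that by (auto simp: Q_def k_def)
  have Rk: "R k = (Q k)({v'} \<mapsto> x')" "R l = (P l)({v'} \<mapsto> x')"
    using put_at[OF kl(1), of Q "{v'}" x'] Qo[of l] d kl by (auto simp: R_def)
  have Ro: "R i = Q i" if "i \<noteq> k" "i \<noteq> l" for i using put_other[of i k] that kl by (auto simp: R_def)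
  have Re: "R i = Map.empty" if "i \<in> J" "i \<noteq> j" "i \<noteq> k" "i \<noteq> l" for i using Ro Qo emp that by simp
  have Rj: "R j = Q j" using Ro d by simp
  have Rp: "partial_col I K (R i)" if i: "i \<in> J" for i
    unfolding R_def
  proof (rule put_partial_col[OF kl(1) Qp I1(2) xx(2) _ i])
    fix z assume "Q k z = Some x' \<or> Q (nx k) z = Some x'"
    then have "P l z = Some x' \<or> o1 \<and> z = {v}" using Qk Qo[of l] d kl by (auto split: if_splits)
    then show "z \<inter> {v'} = {}" using v'[of z] o by auto
  qed
  have Rlj: "load (R j) \<le> 1" using Rj Qj by (cases o1) auto
  have Rlk: "load (R k) \<le> 2" using Rk Qk by (cases o1) (auto simp: card_insert_if)
  have Rll: "load (R l) \<le> h + 1" using card_dom_upd_le[OF fin_dom[OF P[OF kl(2)]], of "{v'}" x'] Rk full by simp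
  have ranR: "ran (R i) \<subseteq> insert x' (insert x (used P))" if "i \<in> J" for i
  proof -
    have "ran (P i) \<subseteq> used P" using usedI[of _ P i, OF _ that] by blast
    then show ?thesis using put_ran[of P j "{v}" x i] put_ran[of Q k "{v'}" x' i] unfolding R_def Q_def
      by (auto split: if_splits)
  qed
  have s: "x' \<in> ran (R l)" unfolding Rk by (auto simp: ran_def)
  have st: "x' \<noteq> t" using t by auto
  have w: "load (without (R l) x') \<le> h" using card_without_less[OF Rp[OF kl(2)] s] Rll by linarith
  define c where "c = (\<lambda>_. t)(j := cj, l := x')"
  have c: "c j = cj" "c k = t" "c l = x'" "c (nx l) = t" using d by (auto simp: c_def)
  have cj: "cj \<in> K" "cj \<noteq> t" using t t' xx by (auto simp: cj_def)
  have cjR: "cj \<notin> ran (R j)" "cj \<notin> ran (R k)"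
    using Rj Qj Qk Rk t' o by (auto simp: cj_def ran_def split: if_splits)
  obtain g m where gm: "layered g m" "\<And>i. i \<in> J \<Longrightarrow> agrees (R i) (g i)"
    "\<And>i u. i \<in> {j, k, l, nx l} \<Longrightarrow> i \<noteq> l \<Longrightarrow> m i u = c i"
  proof (rule couple[of l "{j, k, l, nx l}" R c])
    fix i
    show "c i \<noteq> c (nx i)" if i: "i \<in> {j, k, l, nx l}" "nx i \<in> {j, k, l, nx l}"
    proof -
      have "i = j \<or> i = k \<or> i = l" using i d by auto
      then show ?thesis using c kl cj st by auto
    qed
    show "c i \<notin> ran (R i) \<and> c i \<notin> ran (R (nx i))" if i: "i \<in> {j, k, l, nx l}" "i \<noteq> l"
    proof (cases "i = j")
      case True then show ?thesis using cjR c kl by simp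
    next
      case False
      then have "i \<in> J" "c i = t" using i c kl j by auto
      then show ?thesis using t ranR[of i] ranR[of "nx i"] by auto
    qed
    show "load (R i) \<le> h" if "i \<in> J" "i \<noteq> l"
      using Rlj Rlk h2 Re[OF that(1)] that by (cases "i = j"; cases "i = k") auto
    show "card (ran (R i) \<union> ran (R (nx i))) \<le> h" if i: "i \<in> J - {j, k, l, nx l}"
    proof -
      have n: "nx i \<noteq> k" "nx i \<noteq> l" using nx_eq_iff[of i k] nx_eq_iff[of i l] i j kl by auto
      have "R i = Map.empty" using Re i by auto
      moreover have "load (R (nx i)) \<le> h" using Rlj h2 Re[of "nx i"] n i by (cases "nx i = j") auto
      ultimately show ?thesis using few_from_loads[of R i, OF Rp] i by simp
    qed
    show "c i \<in> K" if "i \<in> {j, k, l, nx l}" using that c t xx cj by auto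
  qed (use j kl Rp w c d Re[of "nx l"] in auto)
  have mm: "m j u = cj" "m k u = t" for u using gm(3) c d by auto
  have n: "Q k {v'} = None" "Q (nx k) {v'} = None"
    using Qk o Qo[of l] noloop[OF kl(2)] d kl by auto
  obtain g1 m1 where 1: "layered g1 m1" "\<And>i. i \<in> J \<Longrightarrow> agrees (Q i) (g1 i)" "m1 k v' = x'" "m1 j = m j"
    using unput[OF gm(1) kl(1) gm(2)[unfolded R_def] I1(2) n mm(2)] d(1) by (metis singletonI)
  obtain g2 m2 where 2: "layered g2 m2" "\<And>i. i \<in> J \<Longrightarrow> agrees (P i) (g2 i)" "m2 j v = x" "m2 k = m1 k"
  proof (cases o1)
    case True
    have ag: "agrees (put P j {v} x i) (g1 i)" if "i \<in> J" for i using 1(2)[OF that] True by (simp add: Q_def)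
    have s: "m1 j u = cj" for u using 1(4) mm by simp
    show ?thesis using unput[OF 1(1) j ag I1(1) noloop[OF j] noloop s] j d(1) that by (metis singletonI nx_J)
  next
    case False
    then show ?thesis using that[of g1 m1] 1 mm by (auto simp: Q_def cj_def)
  qed
  show ?thesis unfolding solvable2_def using 2 1(3) by metis
qed


text \<open>Each of the three layers has room for the items that it gains. The second edge is moved to an item
\<open>e\<close> instead of the singleton \<open>{v'}\<close>, because that one is already occupied in layer \<open>k\<close> if \<open>v = v'\<close>.\<close>

lemma adjacent_items:
  fixes j defines "k \<equiv> nx j"
  defines "l \<equiv> nx k"
  assumes j: "j \<in> J"
    and P: "\<And>i. i \<in> J \<Longrightarrow> partial_col I K (P i)" and tot: "(\<Sum>i\<in>J. load (P i)) \<le> h"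
    and vv: "v \<in> X" and xx: "x \<in> K" "x' \<in> K"
    and noloop: "\<And>i u. i \<in> J \<Longrightarrow> P i {u} = None"
    and v: "\<And>z. P j z = Some x \<or> P k z = Some x \<Longrightarrow> v \<notin> z"
    and e: "e \<in> I" "e \<noteq> {v}" "v' \<in> e" "P k e = None" "P l e = None"
    and dis: "\<And>z. P k z = Some x' \<or> P l z = Some x' \<Longrightarrow> z \<inter> e = {}"
    and ne: "v \<in> e \<Longrightarrow> x \<noteq> x'" and xu: "x = x' \<or> x \<in> used P"
    and l: "load (P j) + 1 \<le> h" "load (P k) + 2 \<le> h" "load (P l) + 1 \<le> h"
  shows "solvable2 P j v x k v' x'"
proof -
  have PB: "\<forall>i\<in>J. partial_col I K (P i)" using P by blast
  note nd = layers_distinct[OF j] and lb = loads_bound[OF PB tot]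
  have kl: "k \<in> J" "l \<in> J" "nx j = k" "nx k = l" "pv k = j" "pv j \<in> J" using j by (simp_all add: k_def l_def)
  have d: "j \<noteq> k" "j \<noteq> l" "k \<noteq> l" "pv j \<noteq> j" "pv j \<noteq> k" "pv j \<noteq> l" "nx l \<noteq> j" "nx l \<noteq> k" "nx l \<noteq> l" "nx l \<noteq> pv j"
    using nd by (auto simp: k_def l_def)
  have vI: "{v} \<in> I" by (rule singleton_item[OF vv])
  obtain t where t: "t \<in> K" "t \<notin> used P" "t \<notin> {x, x'}"
    by (rule pick_unused[of P "{x, x'}", OF P tot]) (auto simp: card_insert_if)
  obtain t' where t': "t' \<in> K" "t' \<notin> used P" "t' \<notin> {x', t}"
    by (rule pick_unused[of P "{x', t}", OF P tot]) (auto simp: card_insert_if)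
  \<comment> \<open>The four matchings from \<open>pv j\<close> to \<open>l\<close> will be coloured \<open>t\<close> and \<open>t'\<close> alternately.\<close>
  have t'x: "t' \<noteq> x" using t' xu by auto
  define Q where "Q = put P k e x'"
  define R where "R = put Q j {v} x"
  have Qk: "Q k = (P k)(e \<mapsto> x')" "Q l = (P l)(e \<mapsto> x')" using put_at[OF kl(1)] kl by (simp_all add: Q_def)
  have Qo: "Q i = P i" if "i \<noteq> k" "i \<noteq> l" for i using put_other that kl by (simp add: Q_def)
  have Qp: "partial_col I K (Q i)" if "i \<in> J" for i
    unfolding Q_def by (rule put_partial_col[OF kl(1) P e(1) xx(2) _ that]) (use dis kl in auto)
  have Rp: "partial_col I K (R i)" if i: "i \<in> J" for i
    unfolding R_def
  proof (rule put_partial_col[OF j Qp vI xx(1) _ i])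
    fix z assume "Q j z = Some x \<or> Q (nx j) z = Some x"
    then have "P j z = Some x \<or> P k z = Some x \<or> z = e \<and> x = x'"
      using Qo[of j] d kl Qk by (auto split: if_splits)
    then show "z \<inter> {v} = {}" using v[of z] ne by auto
  qed
  have Ro: "R i = P i" if "i \<noteq> j" "i \<noteq> k" "i \<noteq> l" for i
    using put_other[of i j Q] Qo that kl by (simp add: R_def)
  have "R j = (P j)({v} \<mapsto> x)" "R k = (P k)(e \<mapsto> x', {v} \<mapsto> x)" "R l = (P l)(e \<mapsto> x')"
    using put_at[OF j, of Q "{v}" x] put_other[of l j Q "{v}" x] Qk Qo[of j] d kl by (simp_all add: R_def)
  then have Rle: "load (R j) \<le> load (P j) + 1" "load (R k) \<le> load (P k) + 2" "load (R l) \<le> load (P l) + 1"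
    using card_dom_upd_le[OF fin_dom[OF P[OF j]], of "{v}" x] card_dom_upd_le[OF fin_dom[OF P[OF kl(2)]], of e x']
      card_dom_upd_le[OF fin_dom[OF P[OF kl(1)]], of e x'] card_dom_upd_le[OF fin_dom[OF Qp[OF kl(1)]], of "{v}" x]
    unfolding Qk by auto
  have Pu: "ran (P i) \<subseteq> used P" if "i \<in> J" for i using usedI[of _ P i, OF _ that] by blast
  have Rr: "ran (R i) \<subseteq> insert x (insert x' (used P))" if "i \<in> J" for i
    using put_ran[of P k e x' i] put_ran[of Q j "{v}" x i] Pu[OF that] unfolding R_def Q_def by blast
  define c where "c = (\<lambda>_. t)(j := t', l := t')"
  have c: "c (pv j) = t" "c j = t'" "c k = t" "c l = t'" using d by (auto simp: c_def)
  obtain g m where gm: "layered g m" "\<And>i. i \<in> J \<Longrightarrow> agrees (R i) (g i)"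
    "\<And>i u. i \<in> {pv j, j, k, l} \<Longrightarrow> m i u = c i"
  proof (rule color_along_walk[of "{pv j, j, k, l}" c R])
    fix i
    show "c i \<noteq> c (nx i)" if i: "i \<in> {pv j, j, k, l}" "nx i \<in> {pv j, j, k, l}"
    proof -
      have "i = pv j \<or> i = j \<or> i = k" using i d by auto
      then show ?thesis using c kl j t' by auto
    qed
    show "c i \<in> K \<and> c i \<notin> ran (R i) \<and> c i \<notin> ran (R (nx i))" if i: "i \<in> {pv j, j, k, l}"
    proof -
      have "i \<in> J" "c i \<in> {t, t'}" using i c kl j by auto
      then show ?thesis using t t' t'x Rr[of i] Rr[of "nx i"] by auto
    qed
    show "load (R i) \<le> h" if "i \<in> J"
      using Rle l Ro[of i] lb(1)[OF that] by (cases "i = j"; cases "i = k"; cases "i = l") auto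
    show "card (ran (R i) \<union> ran (R (nx i))) \<le> h" if i: "i \<in> J - {pv j, j, k, l}"
    proof -
      have "nx i \<noteq> j" "nx i \<noteq> k" "nx i \<noteq> l"
        using nx_eq_iff[of i j] nx_eq_iff[of i k] nx_inject[of i k] i j kl by auto
      then have "R i = P i" "R (nx i) = P (nx i)" using Ro i by auto
      then show ?thesis
        using few_from_set[OF Pu[of i] Pu[of "nx i"] used_bounds(2,1)[of P, OF P tot]] i by auto
    qed
  qed (use j kl Rp in auto)
  have mm: "m j u = t'" "m k u = t" for u using gm(3) c by auto
  have n: "Q j {v} = None" "Q (nx j) {v} = None"
    using Qo[of j] Qk d kl noloop[OF j] noloop[OF kl(1)] e(2) by auto
  obtain g1 m1 where 1: "layered g1 m1" "\<And>i. i \<in> J \<Longrightarrow> agrees (Q i) (g1 i)" "m1 j v = x" "m1 k = m k"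
    using unput[OF gm(1) j gm(2)[unfolded R_def] vI n mm(1)] d(1) by (metis singletonI)
  have n': "P (nx k) e = None" using e kl by simp
  have mm': "m1 k u = t" for u using 1 mm by simp
  obtain g2 m2 where 2: "layered g2 m2" "\<And>i. i \<in> J \<Longrightarrow> agrees (P i) (g2 i)" "\<And>u. u \<in> e \<Longrightarrow> m2 k u = x'" "m2 j = m1 j"
    using unput[OF 1(1) kl(1) 1(2)[unfolded Q_def] e(1,4) n' mm'] d(1) by metis
  show ?thesis unfolding solvable2_def using 2 1(3) e(3) by metis
qed

text \<open>Layer \<open>j\<close> contains all items of the layers, so the other edge is free to determine the colour of
its matching.\<close>

lemma far_coupled:
  assumes j: "j \<in> J" "j' \<in> J" and far: "j \<noteq> j'" "nx j \<noteq> j'" "nx j' \<noteq> j"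
    and P: "\<And>i. i \<in> J \<Longrightarrow> partial_col I K (P i)" and tot: "(\<Sum>i\<in>J. load (P i)) \<le> h"
    and xx: "x' \<in> K"
    and v: "\<And>z. P j z = Some x \<Longrightarrow> v \<notin> z"
    and obs: "x \<in> ran (P j)" and full: "load (P j) = h"
  shows "solvable2 P j v x j' v' x'"
proof -
  have PB: "\<forall>i\<in>J. partial_col I K (P i)" using P by blast
  note nd = layers_distinct[OF j(1)] and lb = loads_bound[OF PB tot]
  have xK: "x \<in> K" using obs P[OF j(1)] by (auto simp: partial_col_def)
  have emp: "P i = Map.empty" if "i \<in> J" "i \<noteq> j" for i using lb(4)[OF j(1) that(1)] that full by simp
  have e2: "P (nx j) = Map.empty" "P j' = Map.empty" "P (nx j') = Map.empty" "P (pv j) = Map.empty" "P (nx (nx j)) = Map.empty"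
    using emp j far nd by auto
  obtain t where t: "t \<in> K" "t \<notin> used P" "t \<notin> {x'}" by (rule pick_unused[of P "{x'}", OF P tot]) auto
  have tx: "t \<noteq> x" "t \<notin> ran (P j)" using t obs not_used[of t P j] j by auto
  have d: "pv j \<noteq> j'" using far j by auto
  have w: "load (without (P j) x) \<le> h" using card_without_less[OF P[OF j(1)] obs] full by linarith
  define c where "c = (\<lambda>_. t)(j := x, j' := x')"
  have c: "c (pv j) = t" "c j = x" "c (nx j) = t" "c j' = x'" using nd d far by (auto simp: c_def)
  obtain g m where gm: "layered g m" "\<And>i. i \<in> J \<Longrightarrow> agrees (P i) (g i)"
    "\<And>i u. i \<in> {pv j, j, nx j, j'} \<Longrightarrow> i \<noteq> j \<Longrightarrow> m i u = c i"
    "\<And>u. (\<And>e. P j e = Some (c j) \<Longrightarrow> u \<notin> e) \<Longrightarrow> m j u = c j"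
  proof (rule couple[of j "{pv j, j, nx j, j'}" P c])
    fix i
    show "c i \<noteq> c (nx i)" if i: "i \<in> {pv j, j, nx j, j'}" "nx i \<in> {pv j, j, nx j, j'}"
    proof -
      have "i = pv j \<or> i = j \<or> i = nx j \<and> nx i = j' \<or> i = j' \<and> nx i = pv j"
        using i nd far nx1[OF j(2)] nx_inject[OF j] by auto
      then show ?thesis using c j tx t by auto
    qed
    show "c i \<notin> ran (P i) \<and> c i \<notin> ran (P (nx i))" if i: "i \<in> {pv j, j, nx j, j'}" "i \<noteq> j"
      using i c e2 tx j by auto
    show "load (P i) \<le> h" if "i \<in> J" "i \<noteq> j" using lb(1) that by simp
    show "card (ran (P i) \<union> ran (P (nx i))) \<le> h" if i: "i \<in> J - {pv j, j, nx j, j'}"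
      using emp[of i] emp[of "nx i"] nx_eq_iff[of i j] i j by auto
    show "c i \<in> K" if "i \<in> {pv j, j, nx j, j'}" using that c t xK xx by auto
  qed (use j P e2 w c in auto)
  have "m j v = x" using gm(4)[of v] c v by metis
  moreover have "m j' v' = x'" using gm(3)[of j'] c far by auto
  ultimately show ?thesis unfolding solvable2_def using gm by blast
qed

lemma two_verticals_same_matching:
  assumes j: "j \<in> J"
    and P: "\<And>i. i \<in> J \<Longrightarrow> partial_col I K (P i)" and tot: "(\<Sum>i\<in>J. load (P i)) \<le> h"
    and vv: "v \<in> X" "v' \<in> X" "v \<noteq> v'" and xx: "x \<in> K" "x' \<in> K"
    and noloop: "\<And>i u. i \<in> J \<Longrightarrow> P i {u} = None"
    and v: "\<And>z. P j z = Some x \<or> P (nx j) z = Some x \<Longrightarrow> v \<notin> z"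
    and v': "\<And>z. P j z = Some x' \<or> P (nx j) z = Some x' \<Longrightarrow> v' \<notin> z"
    and good: "\<not> (h = 2 \<and> load (P j) = 1 \<and> load (P (nx j)) = 1 \<and>
        x \<in> ran (P j) \<union> ran (P (nx j)) \<and> x' \<in> ran (P j) \<union> ran (P (nx j)))"
  shows "solvable2 P j v x j v' x'"
proof -
  interpret r: layers J pv nx X I K h by (rule reflect)
  have nj: "nx j \<in> J" using j by simp
  show ?thesis
  proof (cases "x \<in> ran (P j) \<union> ran (P (nx j)) \<and> x' \<in> ran (P j) \<union> ran (P (nx j))")
    case False
    then consider "x \<notin> ran (P j)" "x \<notin> ran (P (nx j))" | "x' \<notin> ran (P j)" "x' \<notin> ran (P (nx j))" by blast
    then show ?thesis
    proof cases
      case 1 show ?thesis by (rule same_matching_free[OF j P tot vv xx noloop v' 1])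
    next
      case 2 show ?thesis by (rule solvable2_swap, rule same_matching_free[OF j P tot vv(2,1) vv(3)[symmetric] xx(2,1) noloop v 2])
    qed
  next
    case True
    consider "P (nx j) = Map.empty" | "P j = Map.empty" | "load (P j) \<ge> 1" "load (P (nx j)) \<ge> 1"
      using load_0[OF P[OF j]] load_0[OF P[OF nj]] by fastforce
    then show ?thesis
    proof cases
      case 1
      then have o: "x \<in> ran (P j)" "x' \<in> ran (P j)" using True by auto
      show ?thesis by (rule same_matching_coupled[of j P v v' x x']) (use j P tot vv noloop v v' o 1 in blast)+
    next
      case 2
      then have o: "x \<in> ran (P (nx j))" "x' \<in> ran (P (nx j))" using True by auto
      have "P (pv (nx j)) = Map.empty" using 2 j by simp
      then have "r.solvable2 P (nx j) v x (nx j) v' x'"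
        by (intro r.same_matching_coupled[of "nx j" P v v' x x']) (use nj P tot vv noloop v v' o in blast)+
      then show ?thesis by (rule solvable2_reflect)
    next
      case 3
      have "x \<in> used P" "x' \<in> used P" using True usedI[of _ P j] usedI[of _ P "nx j"] j by auto
      then show ?thesis
        using same_matching_singletons[of j P v v' x x'] j P tot vv noloop v v' 3 good True by blast
    qed
  qed
qed

text \<open>An edge whose colour occurs in an adjacent layer is moved to a singleton. This fails only if one
of its two layers is full, and then the other layers are empty.\<close>

lemma two_verticals_far:
  assumes j: "j \<in> J" "j' \<in> J" and far: "j \<noteq> j'" "nx j \<noteq> j'" "nx j' \<noteq> j"
    and P: "\<And>i. i \<in> J \<Longrightarrow> partial_col I K (P i)" and tot: "(\<Sum>i\<in>J. load (P i)) \<le> h"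
    and vv: "v \<in> X" "v' \<in> X" and xx: "x \<in> K" "x' \<in> K"
    and noloop: "\<And>i u. i \<in> J \<Longrightarrow> P i {u} = None"
    and v: "\<And>z. P j z = Some x \<or> P (nx j) z = Some x \<Longrightarrow> v \<notin> z"
    and v': "\<And>z. P j' z = Some x' \<or> P (nx j') z = Some x' \<Longrightarrow> v' \<notin> z"
  shows "solvable2 P j v x j' v' x'"
proof -
  interpret r: layers J pv nx X I K h by (rule reflect)
  have PB: "\<forall>i\<in>J. partial_col I K (P i)" using P by blast
  note lb = loads_bound[OF PB tot]
  have nj: "nx j \<in> J" "nx j' \<in> J" using j by simp_all
  let ?o = "x \<in> ran (P j) \<or> x \<in> ran (P (nx j))"
  let ?o' = "x' \<in> ran (P j') \<or> x' \<in> ran (P (nx j'))"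
  have far': "nx j \<noteq> nx j'" "pv (nx j) \<noteq> nx j'" "pv (nx j') \<noteq> nx j" "nx j' \<noteq> nx j" using far j nx_inject by auto
  consider "x \<in> ran (P j)" "load (P j) = h" | "x \<in> ran (P (nx j))" "load (P (nx j)) = h"
    | "x' \<in> ran (P j')" "load (P j') = h" | "x' \<in> ran (P (nx j'))" "load (P (nx j')) = h"
    | "\<And>i. ?o \<Longrightarrow> i = j \<or> i = nx j \<Longrightarrow> load (P i) < h" "\<And>i. ?o' \<Longrightarrow> i = j' \<or> i = nx j' \<Longrightarrow> load (P i) < h"
  proof -
    have A: "y \<in> ran (P i) \<and> load (P i) = h \<or> y \<in> ran (P (nx i)) \<and> load (P (nx i)) = h \<or>
       load (P i) < h \<and> load (P (nx i)) < h" if "y \<in> ran (P i) \<or> y \<in> ran (P (nx i))" "i \<in> J" for y i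
      using that(1) lb(1)[OF that(2)] lb(1)[OF nx_J[OF that(2)]] lb(4)[of i "nx i"] lb(4)[of "nx i" i] that(2) layers_distinct(1)[OF that(2)]
      by fastforce
    show ?thesis using A[of x j] A[of x' j'] j that by metis
  qed
  then show ?thesis
  proof cases
    case 1
    show ?thesis by (rule far_coupled[of j j' P x' x v v']) (use j far P tot xx v 1 in blast)+
  next
    case 2
    have "r.solvable2 P (nx j) v x (nx j') v' x'"
      by (rule r.far_coupled[of "nx j" "nx j'" P x' x v v']) (use nj far' P tot xx v 2 in blast)+
    then show ?thesis by (rule solvable2_reflect)
  next
    case 3
    show ?thesis
      by (rule solvable2_swap, rule far_coupled[of j' j P x x' v' v]) (use j far P tot xx v' 3 in blast)+
  next
    case 4
    have "r.solvable2 P (nx j') v' x' (nx j) v x"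
      by (rule r.far_coupled[of "nx j'" "nx j" P x x' v' v]) (use nj far' P tot xx v' 4 in blast)+
    then show ?thesis using solvable2_reflect solvable2_swap by blast
  next
    case 5
    show ?thesis
    proof (rule different_matchings[of j j' P v v' x x' "?o" "?o'"])
      show "if ?o then x \<in> used P else x \<notin> ran (P j) \<and> x \<notin> ran (P (nx j))"
        using usedI[of x P j] usedI[of x P "nx j"] j by auto
      show "if ?o' then x' \<in> used P else x' \<notin> ran (P j') \<and> x' \<notin> ran (P (nx j'))"
        using usedI[of x' P j'] usedI[of x' P "nx j'"] j by auto
      show "load (P i) + (if ?o \<and> (i = j \<or> i = nx j) then 1 else 0)
         + (if ?o' \<and> (i = j' \<or> i = nx j') then 1 else 0) \<le> h" if "i \<in> J" for i
      proof -
        have "\<not> ((i = j \<or> i = nx j) \<and> (i = j' \<or> i = nx j'))" using far far' by auto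
        moreover have "?o \<and> (i = j \<or> i = nx j) \<Longrightarrow> load (P i) < h" using 5(1)[of i] by blast
        moreover have "?o' \<and> (i = j' \<or> i = nx j') \<Longrightarrow> load (P i) < h" using 5(2)[of i] by blast
        ultimately show ?thesis using lb(1)[OF that] by (simp only: split: if_split) linarith
      qed
    qed (use assms in blast)+
  qed
qed

text \<open>The configurations in which it helps to couple upwards, or in which only the first edge determines
the colour of its matching. Up to reversal they leave only the case of two different colours that
are both free, and the cases where both outer layers contain an item.\<close>

lemma adjacent_some:
  fixes j defines "k \<equiv> nx j"
  defines "l \<equiv> nx k"
  assumes j: "j \<in> J"
    and P: "\<And>i. i \<in> J \<Longrightarrow> partial_col I K (P i)" and tot: "(\<Sum>i\<in>J. load (P i)) \<le> h"
    and vv: "v \<in> X" "v' \<in> X" and xx: "x \<in> K" "x' \<in> K"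
    and noloop: "\<And>i u. i \<in> J \<Longrightarrow> P i {u} = None"
    and v: "\<And>z. P j z = Some x \<or> P k z = Some x \<Longrightarrow> v \<notin> z"
    and v': "\<And>z. P k z = Some x' \<or> P l z = Some x' \<Longrightarrow> v' \<notin> z"
    and ne: "x = x' \<Longrightarrow> v \<noteq> v'"
    and cases: "x = x' \<and> load (P l) = h \<or> x = x' \<and> P l = Map.empty \<and> load (P j) < h \<or>
      x \<noteq> x' \<and> \<not> (x \<in> ran (P j) \<or> x \<in> ran (P k)) \<and> (x' \<in> ran (P k) \<or> x' \<in> ran (P l)) \<or>
      x \<noteq> x' \<and> x' \<in> ran (P k) \<and> P l = Map.empty"
  shows "solvable2 P j v x k v' x'"
proof -
  have PB: "\<forall>i\<in>J. partial_col I K (P i)" using P by blast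
  note nd = layers_distinct[OF j] and lb = loads_bound[OF PB tot]
  have kl: "k \<in> J" "l \<in> J" "nx j = k" "nx k = l" using j by (simp_all add: k_def l_def)
  have d: "j \<noteq> k" "j \<noteq> l" "k \<noteq> l" "nx l \<noteq> j" using nd by (auto simp: k_def l_def)
  have own: "solvable2 P j v x k v' x'"
    if "x' \<in> ran (P k) \<or> x' = x" "P l = Map.empty" "load (P j) + 1 \<le> h"
    using adjacent_coupled[of j P v x x' v'] j P tot vv xx noloop v v' ne that unfolding k_def l_def by blast
  have outer: "solvable2 P j v x k v' x'" if "load (P l) = h" "h \<ge> 1"
  proof -
    have "h \<ge> 2" using that(2) h_even by (cases "h = 1") auto
    moreover have "if x = x' then x = x' \<and> v \<noteq> v' else x \<noteq> x'" using ne by simp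
    ultimately show ?thesis
      using adjacent_outer[of j P v v' x x' "x = x'"] j P tot vv xx noloop v' that(1) unfolding k_def l_def by blast
  qed
  have h1: "h \<ge> 1" if "v \<noteq> v'" using single_vertex vv that by (cases h) auto
  consider (a) "x = x'" "load (P l) = h" | (b) "x = x'" "P l = Map.empty" "load (P j) < h"
    | (c) "x' \<in> ran (P k)" "P l = Map.empty"
    | (A) "x \<noteq> x'" "\<not> (x \<in> ran (P j) \<or> x \<in> ran (P k))" "x' \<in> ran (P k) \<or> x' \<in> ran (P l)"
    using cases by blast
  then show ?thesis
  proof cases
    case a
    then show ?thesis using outer h1 ne by blast
  next
    case b
    then show ?thesis using own by auto
  next
    case c
    moreover have "load (P j) + 1 \<le> h"
      using lb(2)[OF j kl(1) d(1)] load_pos[OF c(1) P[OF kl(1)]] by linarith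
    ultimately show ?thesis using own by blast
  next
    case A
    have h1': "h \<ge> 1"
      using A(3) load_pos[OF _ P[OF kl(1)]] load_pos[OF _ P[OF kl(2)]] lb(1)[OF kl(1)] lb(1)[OF kl(2)] by force
    consider "load (P l) = h" | "load (P k) = h" | "load (P k) < h" "load (P l) < h"
      using lb(1)[OF kl(1)] lb(1)[OF kl(2)] by linarith
    then show ?thesis
    proof cases
      case 1 then show ?thesis using outer h1' by blast
    next
      case 2
      then have "P l = Map.empty" "P j = Map.empty" using lb(4)[OF kl(1)] kl(2) j d by auto
      then show ?thesis using own A(3) h1' by auto
    next
      case 3
      show ?thesis
        by (rule different_matchings[of j k P v v' x x' False True])
          (use 3 j kl d P tot vv xx noloop v v' A lb(1) usedI[of x' P k] usedI[of x' P l] in auto)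
    qed
  qed
qed

text \<open>If both outer layers contain an item, none of the three layers is close to full. Only for \<open>v = v'\<close>
is an item at \<open>v'\<close> other than the singleton needed; there are \<open>h\<close> of them, more than the items that
can block one.\<close>

lemma two_verticals_adjacent:
  fixes j defines "k \<equiv> nx j"
  defines "l \<equiv> nx k"
  assumes j: "j \<in> J"
    and P: "\<And>i. i \<in> J \<Longrightarrow> partial_col I K (P i)" and tot: "(\<Sum>i\<in>J. load (P i)) \<le> h"
    and vv: "v \<in> X" "v' \<in> X" and xx: "x \<in> K" "x' \<in> K"
    and noloop: "\<And>i u. i \<in> J \<Longrightarrow> P i {u} = None"
    and v: "\<And>z. P j z = Some x \<or> P k z = Some x \<Longrightarrow> v \<notin> z"
    and v': "\<And>z. P k z = Some x' \<or> P l z = Some x' \<Longrightarrow> v' \<notin> z"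
    and ne: "x = x' \<Longrightarrow> v \<noteq> v'"
  shows "solvable2 P j v x k v' x'"
proof -
  interpret r: layers J pv nx X I K h by (rule reflect)
  have PB: "\<forall>i\<in>J. partial_col I K (P i)" using P by blast
  note nd = layers_distinct[OF j] and lb = loads_bound[OF PB tot]
  have kl: "k \<in> J" "l \<in> J" "nx j = k" "nx k = l" "pv k = j" "pv l = k" using j by (simp_all add: k_def l_def)
  have d: "j \<noteq> k" "j \<noteq> l" "k \<noteq> l" using nd by (auto simp: k_def l_def)
  define A where "A \<longleftrightarrow> x = x' \<and> load (P l) = h \<or> x = x' \<and> P l = Map.empty \<and> load (P j) < h \<or>
      x \<noteq> x' \<and> \<not> (x \<in> ran (P j) \<or> x \<in> ran (P k)) \<and> (x' \<in> ran (P k) \<or> x' \<in> ran (P l)) \<or>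
      x \<noteq> x' \<and> x' \<in> ran (P k) \<and> P l = Map.empty"
  define B where "B \<longleftrightarrow> x' = x \<and> load (P j) = h \<or> x' = x \<and> P j = Map.empty \<and> load (P l) < h \<or>
      x' \<noteq> x \<and> \<not> (x' \<in> ran (P l) \<or> x' \<in> ran (P k)) \<and> (x \<in> ran (P k) \<or> x \<in> ran (P j)) \<or>
      x' \<noteq> x \<and> x \<in> ran (P k) \<and> P j = Map.empty"
  consider "A" | "B" | "\<not> A" "\<not> B" by blast
  then show ?thesis
  proof cases
    case 1
    show ?thesis
      using adjacent_some[of j P v v' x x'] j P tot vv xx noloop v v' ne 1[unfolded A_def]
      unfolding k_def l_def by blast
  next
    case 2
    have ne': "x' = x \<Longrightarrow> v' \<noteq> v" using ne by blast
    have "r.solvable2 P l v' x' (pv l) v x"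
      by (rule r.adjacent_some[of l P v' v x' x]) (use kl P tot vv xx noloop v v' ne' 2[unfolded B_def] in auto)
    then have "r.solvable2 P l v' x' k v x" using kl by simp
    then have "solvable2 P k v' x' j v x" using solvable2_reflect[of P k v' x' j v x] kl by simp
    then show ?thesis by (rule solvable2_swap)
  next
    case 3
    let ?o = "x \<in> ran (P j) \<or> x \<in> ran (P k)"
    let ?o' = "x' \<in> ran (P k) \<or> x' \<in> ran (P l)"
    show ?thesis
    proof (cases "x \<noteq> x' \<and> \<not> ?o \<and> \<not> ?o'")
      case True
      show ?thesis
        by (rule different_matchings[of j k P v v' x x' False False])
          (use True j kl d P tot vv xx noloop v v' lb(1) in auto)
    next
      case False
      have obs: "?o" "?o'" if "x \<noteq> x'" using that 3 False unfolding A_def B_def by blast+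
      have "load (P l) \<noteq> 0 \<and> load (P j) \<noteq> 0"
      proof (cases "x = x'")
        case True
        have "load (P l) < h" "load (P j) < h"
          using 3 True lb(1)[OF j] lb(1)[OF kl(2)] unfolding A_def B_def by linarith+
        then have "P l \<noteq> Map.empty" "P j \<noteq> Map.empty" using 3 True unfolding A_def B_def by blast+
        then show ?thesis using load_0[OF P[OF j]] load_0[OF P[OF kl(2)]] by blast
      next
        case F: False
        then have "P l \<noteq> Map.empty" "P j \<noteq> Map.empty" using 3 obs unfolding A_def B_def by auto
        then show ?thesis using load_0[OF P[OF j]] load_0[OF P[OF kl(2)]] by blast
      qed
      then have pp: "load (P l) \<ge> 1" "load (P j) \<ge> 1" by auto
      have three: "load (P j) + load (P k) + load (P l) \<le> h" using lb(3)[OF j kl(1,2) d(1,3,2)] .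
      have ll: "load (P j) + 1 \<le> h" "load (P k) + 2 \<le> h" "load (P l) + 1 \<le> h" using three pp by linarith+
      have xu: "x = x' \<or> x \<in> used P" using obs(1) usedI[of x P j] usedI[of x P k] j kl by blast
      have main: "solvable2 P j v x k v' x'"
        if "e \<in> I" "e \<noteq> {v}" "v' \<in> e" "P k e = None" "P l e = None"
          "\<And>z. P k z = Some x' \<or> P l z = Some x' \<Longrightarrow> z \<inter> e = {}" "v \<in> e \<Longrightarrow> x \<noteq> x'" for e
        using adjacent_items[of j P v x x' e v'] j P tot vv(1) xx noloop v that xu ll
        unfolding k_def l_def by blast
      show ?thesis
      proof (cases "v = v'")
        case False
        show ?thesis
          by (rule main[of "{v'}"]) (use False singleton_item[OF vv(2)] noloop kl v' in auto)
      next
        case True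
        \<comment> \<open>Layer \<open>k\<close> needs the singleton of the common end vertex for the first edge.\<close>
        let ?C = "{e \<in> I. v' \<in> e} - {{v'}}"
        have cC: "card ?C = h" using card_star[OF vv(2)] singleton_item[OF vv(2)] by simp
        have "\<exists>e\<in>?C. \<not> blocked (P k) (P l) x' e"
        proof (rule ccontr)
          assume "\<not> ?thesis"
          then have all: "blocked (P k) (P l) x' e" if "e \<in> ?C" for e using that by blast
          have "load (P k) + load (P l) \<le> card ?C" using cC three by linarith
          then have "load (P k) + load (P l) = card ?C"
            by (intro tight_blocking(1)[OF P[OF kl(1)] P[OF kl(2)], of x' v']) (use v' all in auto)
          then show False using cC three pp by linarith
        qed
        then obtain e where e: "e \<in> I" "v' \<in> e" "e \<noteq> {v'}" "\<not> blocked (P k) (P l) x' e" by blast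
        show ?thesis
          by (rule main[of e]) (use e True ne in \<open>auto simp: blocked_def\<close>)
      qed
    qed
  qed
qed

lemma two_verticals:
  assumes j: "j \<in> J" "j' \<in> J"
    and P: "\<And>i. i \<in> J \<Longrightarrow> partial_col I K (P i)" and tot: "(\<Sum>i\<in>J. load (P i)) \<le> h"
    and vv: "v \<in> X" "v' \<in> X" and xx: "x \<in> K" "x' \<in> K"
    and noloop: "\<And>i u. i \<in> J \<Longrightarrow> P i {u} = None"
    and v: "\<And>z. P j z = Some x \<or> P (nx j) z = Some x \<Longrightarrow> v \<notin> z"
    and v': "\<And>z. P j' z = Some x' \<or> P (nx j') z = Some x' \<Longrightarrow> v' \<notin> z"
    and distinct: "j = j' \<Longrightarrow> v \<noteq> v'"
    and adj: "nx j = j' \<or> nx j' = j \<Longrightarrow> x = x' \<Longrightarrow> v \<noteq> v'"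
    and good: "j = j' \<Longrightarrow> \<not> (h = 2 \<and> load (P j) = 1 \<and> load (P (nx j)) = 1 \<and>
        x \<in> ran (P j) \<union> ran (P (nx j)) \<and> x' \<in> ran (P j) \<union> ran (P (nx j)))"
  shows "solvable2 P j v x j' v' x'"
proof -
  consider "j = j'" | "nx j = j'" | "nx j' = j" | "j \<noteq> j'" "nx j \<noteq> j'" "nx j' \<noteq> j" by blast
  then show ?thesis
  proof cases
    case 1
    then show ?thesis using two_verticals_same_matching[of j P v v' x x'] assms by blast
  next
    case 2
    then show ?thesis using two_verticals_adjacent[of j P v v' x x'] assms by blast
  next
    case 3
    have ne: "x' = x \<Longrightarrow> v' \<noteq> v" using adj 3 by blast
    have "solvable2 P j' v' x' j v x"
      using two_verticals_adjacent[of j' P v' v x' x] ne 3 j P tot vv xx noloop v v' by blast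
    then show ?thesis by (rule solvable2_swap)
  next
    case 4
    then show ?thesis using two_verticals_far[of j j' P v v' x x'] assms by blast
  qed
qed

end

section \<open>Powers of cycles as layers\<close>

definition cyc_suc :: "nat \<Rightarrow> nat \<Rightarrow> nat" where
  "cyc_suc n j = Suc j mod n"

definition cyc_pred :: "nat \<Rightarrow> nat \<Rightarrow> nat" where
  "cyc_pred n j = (j + n - 1) mod n"

lemma cyc_suc_eq: "j < n \<Longrightarrow> cyc_suc n j = (if Suc j = n then 0 else Suc j)"
  by (auto simp: cyc_suc_def)

lemma cyc_pred_eq: "j < n \<Longrightarrow> cyc_pred n j = (if j = 0 then n - 1 else j - 1)"
  by (cases j) (auto simp: cyc_pred_def)

lemma cyc_suc_less: "j < n \<Longrightarrow> cyc_suc n j < n"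
  by (simp add: cyc_suc_def)

lemma cyc_pred_less: "j < n \<Longrightarrow> cyc_pred n j < n"
  by (simp add: cyc_pred_def)

lemma cyc_suc_pred: "j < n \<Longrightarrow> cyc_suc n (cyc_pred n j) = j"
  by (auto simp: cyc_pred_eq cyc_suc_eq)

lemma cyc_pred_suc: "j < n \<Longrightarrow> cyc_pred n (cyc_suc n j) = j"
  by (auto simp: cyc_pred_eq cyc_suc_eq)

definition vertices :: "nat \<Rightarrow> nat \<Rightarrow> nat list set" where
  "vertices n d = {xs. length xs = d \<and> set xs \<subseteq> {..<n}}"

definition items :: "nat \<Rightarrow> nat \<Rightarrow> nat list set set" where
  "items n d = edges (cart_power (cycle_graph n) d) \<union> (\<lambda>v. {v}) ` vertices n d"

definition col_edge :: "nat \<Rightarrow> nat \<Rightarrow> nat list \<Rightarrow> nat list set" where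
  "col_edge n j v = {j # v, cyc_suc n j # v}"

lemma vertices_Suc: "vertices n (Suc d) = {j # v | j v. j < n \<and> v \<in> vertices n d}"
  by (auto simp: vertices_def length_Suc_conv)

lemma vertices_Cons [simp]: "j # v \<in> vertices n (Suc d) \<longleftrightarrow> j < n \<and> v \<in> vertices n d"
  by (auto simp: vertices_def)

lemma finite_vertices: "finite (vertices n d)"
  using finite_lists_length_eq[of "{..<n}" d] by (simp add: vertices_def conj_commute)

lemma verts_cycle_power: "verts (cart_power (cycle_graph n) d) = vertices n d"
  by (simp add: verts_cart_power vertices_def cycle_graph_def)

lemma items_sub_vertices: "n \<ge> 3 \<Longrightarrow> e \<in> items n d \<Longrightarrow> e \<subseteq> vertices n d"
  using simple_cart_power[OF simple_cycle_graph] verts_cycle_power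
  by (fastforce simp: items_def simple_graph_def)

lemma finite_items: "n \<ge> 3 \<Longrightarrow> finite (items n d)"
  using items_sub_vertices finite_vertices by (metis PowI finite_Pow_iff finite_subset subsetI)

lemma edges_power_Suc:
  assumes n: "n \<ge> 3"
  shows "edges (cart_power (cycle_graph n) (Suc d)) =
     {(#) j ` e | j e. j < n \<and> e \<in> edges (cart_power (cycle_graph n) d)} \<union>
     {col_edge n j v | j v. j < n \<and> v \<in> vertices n d}" (is "?L = ?R1 \<union> ?R2")
proof -
  let ?H = "cart_power (cycle_graph n) d"
  have sH: "simple_graph ?H" by (rule simple_cart_power[OF simple_cycle_graph[OF n]])
  have eq: "?L = {{u # v, u' # v'} | u v u' v'. u < n \<and> v \<in> vertices n d \<and> u' < n \<and> v' \<in> vertices n d \<and>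
        (u = u' \<and> {v, v'} \<in> edges ?H \<or> {u, u'} \<in> edges (cycle_graph n) \<and> v = v')}" (is "_ = ?M")
  proof -
    let ?h = "\<lambda>(x, xs). x # (xs :: nat list)"
    let ?C = "\<lambda>u v u' v'. u < n \<and> v \<in> vertices n d \<and> u' < n \<and> v' \<in> vertices n d \<and>
        (u = u' \<and> {v, v'} \<in> edges ?H \<or> {u, u'} \<in> edges (cycle_graph n) \<and> v = v')"
    have "verts (cycle_graph n) = {..<n}" by (simp add: cycle_graph_def)
    then have "?L = (`) ?h ` {{(u, v), (u', v')} | u v u' v'. ?C u v u' v'}"
      by (simp add: map_graph_verts_def cart_prod_def verts_cycle_power)
    also have "\<dots> = {?h ` {(u, v), (u', v')} | u v u' v'. ?C u v u' v'}" by blast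
    finally show ?thesis by simp
  qed
  have sub1: "?M \<subseteq> ?R1 \<union> ?R2"
  proof
    fix e assume "e \<in> ?M"
    then obtain u v u' v' where e: "e = {u # v, u' # v'}" "u < n" "v \<in> vertices n d" "u' < n" "v' \<in> vertices n d"
      "u = u' \<and> {v, v'} \<in> edges ?H \<or> {u, u'} \<in> edges (cycle_graph n) \<and> v = v'" by blast
    from e(6) show "e \<in> ?R1 \<union> ?R2"
    proof
      assume A: "u = u' \<and> {v, v'} \<in> edges ?H"
      then have "e = (#) u ` {v, v'}" using e by auto
      then show ?thesis using A e(2) by blast
    next
      assume A: "{u, u'} \<in> edges (cycle_graph n) \<and> v = v'"
      then obtain i where i: "i < n" "{u, u'} = {i, cyc_suc n i}" by (auto simp: cycle_graph_def cyc_suc_def)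
      then have "e = col_edge n i v" using e(1) A by (auto simp: col_edge_def doubleton_eq_iff)
      then show ?thesis using i e(3) by blast
    qed
  qed
  have sub2: "?R1 \<subseteq> ?M"
  proof
    fix e assume "e \<in> ?R1"
    then obtain j f where f: "e = (#) j ` f" "j < n" "f \<in> edges ?H" by blast
    then have "card f = 2" "f \<subseteq> vertices n d" using sH verts_cycle_power by (auto simp: simple_graph_def)
    then obtain v v' where "f = {v, v'}" "v \<in> vertices n d" "v' \<in> vertices n d" by (auto simp: card_2_iff)
    then show "e \<in> ?M" using f by auto
  qed
  have sub3: "?R2 \<subseteq> ?M"
  proof
    fix e assume "e \<in> ?R2"
    then obtain j v where "e = col_edge n j v" "j < n" "v \<in> vertices n d" by blast
    then have "e = {j # v, cyc_suc n j # v} \<and> j < n \<and> v \<in> vertices n d \<and> cyc_suc n j < n \<and> v \<in> vertices n d \<and>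
      {j, cyc_suc n j} \<in> edges (cycle_graph n)"
      by (auto simp: col_edge_def cyc_suc_less cycle_graph_def cyc_suc_def)
    then show "e \<in> ?M" by blast
  qed
  show ?thesis unfolding eq by (intro equalityI Un_least sub1 sub2 sub3)
qed

lemma items_0: "items n 0 = {{[]}}"
  by (auto simp: items_def vertices_def)

lemma items_Suc:
  assumes n: "n \<ge> 3"
  shows "items n (Suc d) = {(#) j ` e | j e. j < n \<and> e \<in> items n d} \<union>
     {col_edge n j v | j v. j < n \<and> v \<in> vertices n d}"
proof -
  have "(\<lambda>v. {v}) ` vertices n (Suc d) = {(#) j ` e | j e. j < n \<and> e \<in> (\<lambda>v. {v}) ` vertices n d}"
    unfolding vertices_Suc by (auto simp: image_iff)
  moreover have "{(#) j ` e | j e. j < n \<and> e \<in> E \<union> S} =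
      {(#) j ` e | j e. j < n \<and> e \<in> E} \<union> {(#) j ` e | j e. j < n \<and> e \<in> S}" for E S :: "nat list set set"
    by blast
  ultimately show ?thesis unfolding items_def edges_power_Suc[OF n] by (simp only: Un_ac)
qed

lemma Cons_image_eq: "e \<noteq> {} \<Longrightarrow> (#) j ` e = (#) i ` f \<longleftrightarrow> j = i \<and> e = f"
proof -
  assume ne: "e \<noteq> {}"
  have "inj ((#) j)" by (auto intro: injI)
  moreover have "j = i" if "(#) j ` e = (#) i ` f" using that ne by auto
  ultimately show ?thesis by (metis inj_image_eq_iff)
qed

lemma col_edge_not_layer: "n \<ge> 3 \<Longrightarrow> j < n \<Longrightarrow> col_edge n j v \<noteq> (#) i ` f"
proof
  assume n: "n \<ge> 3" "j < n" and "col_edge n j v = (#) i ` f"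
  then have "j = i" "cyc_suc n j = i" by (auto simp: col_edge_def)
  then show False using n by (auto simp: cyc_suc_eq split: if_splits)
qed

lemma col_edge_eq_iff: "n \<ge> 3 \<Longrightarrow> j < n \<Longrightarrow> i < n \<Longrightarrow> col_edge n j v = col_edge n i w \<longleftrightarrow> j = i \<and> v = w"
  by (auto simp: col_edge_def doubleton_eq_iff cyc_suc_eq split: if_splits)

lemma items_nonempty: "n \<ge> 3 \<Longrightarrow> e \<in> items n d \<Longrightarrow> e \<noteq> {}"
proof (induction d arbitrary: e)
  case 0 then show ?case by (auto simp: items_0)
next
  case (Suc d) then show ?case by (auto simp: items_Suc col_edge_def)
qed

lemma layer_in_items:
  assumes n: "n \<ge> 3" and e: "e \<noteq> {}"
  shows "(#) j ` e \<in> items n (Suc d) \<longleftrightarrow> j < n \<and> e \<in> items n d"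
proof -
  have "(#) j ` e \<noteq> col_edge n i v" if "i < n" for i v using col_edge_not_layer[OF n that] by metis
  then have "(#) j ` e \<in> items n (Suc d) \<longleftrightarrow> (\<exists>k f. (#) j ` e = (#) k ` f \<and> k < n \<and> f \<in> items n d)"
    unfolding items_Suc[OF n] by blast
  then show ?thesis unfolding Cons_image_eq[OF e] by blast
qed

lemma col_edge_in_items:
  assumes n: "n \<ge> 3" and "j < n" "v \<in> vertices n d"
  shows "col_edge n j v \<in> items n (Suc d)"
  using assms unfolding items_Suc[OF n] by blast

lemma pair_in_items_Suc:
  assumes n: "n \<ge> 3"
  shows "{i # u, j # w} \<in> items n (Suc d) \<longleftrightarrow> i < n \<and> j < n \<and>
     (i = j \<and> {u, w} \<in> items n d \<or> u = w \<and> u \<in> vertices n d \<and> (j = cyc_suc n i \<or> i = cyc_suc n j))"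
    (is "?L \<longleftrightarrow> ?R")
proof
  assume ?L
  then consider k e where "{i # u, j # w} = (#) k ` e" "k < n" "e \<in> items n d"
    | k v where "{i # u, j # w} = col_edge n k v" "k < n" "v \<in> vertices n d"
    unfolding items_Suc[OF n] by blast
  then show ?R
  proof cases
    case 1
    then have "i = k" "j = k" by auto
    then have "(#) k ` {u, w} = (#) k ` e" using 1 by simp
    then have "{u, w} = e" using Cons_image_eq[of "{u, w}" k k e] by simp
    then show ?thesis using 1 \<open>i = k\<close> \<open>j = k\<close> by simp
  next
    case 2
    then show ?thesis using cyc_suc_less[OF 2(2)] by (auto simp: col_edge_def doubleton_eq_iff)
  qed
next
  assume R: ?R
  show ?L
  proof (cases "i = j \<and> {u, w} \<in> items n d")
    case True
    then have "{i # u, j # w} = (#) i ` {u, w}" by simp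
    then show ?thesis using layer_in_items[OF n, of "{u, w}" i] True R by simp
  next
    case False
    then consider "u = w" "u \<in> vertices n d" "j = cyc_suc n i" | "u = w" "u \<in> vertices n d" "i = cyc_suc n j" using R by blast
    then show ?thesis
    proof cases
      case 1 then show ?thesis using col_edge_in_items[OF n, of i u] R by (simp add: col_edge_def)
    next
      case 2 then show ?thesis using col_edge_in_items[OF n, of j u] R by (simp add: col_edge_def insert_commute)
    qed
  qed
qed

lemma items_pair: "n \<ge> 3 \<Longrightarrow> e \<in> items n d \<Longrightarrow> v \<in> e \<Longrightarrow> \<exists>w. e = {v, w}"
proof (induction d arbitrary: e v)
  case 0 then show ?case by (auto simp: items_0)
next
  case (Suc d)
  then consider k f where "e = (#) k ` f" "f \<in> items n d" | k u where "e = col_edge n k u"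
    unfolding items_Suc[OF Suc.prems(1)] by blast
  then show ?case
  proof cases
    case 1
    then obtain u where u: "v = k # u" "u \<in> f" using Suc.prems by auto
    then obtain w where "f = {u, w}" using Suc.IH[OF Suc.prems(1) 1(2)] by blast
    then have "e = {v, k # w}" using 1 u by simp
    then show ?thesis by blast
  next
    case 2 then show ?thesis using Suc.prems by (auto simp: col_edge_def)
  qed
qed

text \<open>Three vertices in three different layers cannot be pairwise adjacent in a cycle of length at least
five; if two of them share a layer, the third edge lies in this layer as well.\<close>

lemma items_no_triangle:
  assumes n: "n \<ge> 5"
  shows "{u, v} \<in> items n d \<Longrightarrow> {v, w} \<in> items n d \<Longrightarrow> {u, w} \<in> items n d \<Longrightarrow> u = v \<or> v = w \<or> u = w"
proof (induction d arbitrary: u v w)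
  case 0 then show ?case by (auto simp: items_0)
next
  case (Suc d)
  have n3: "n \<ge> 3" using n by simp
  have "u \<in> vertices n (Suc d)" "v \<in> vertices n (Suc d)" "w \<in> vertices n (Suc d)"
    using Suc.prems items_sub_vertices[OF n3] by blast+
  then obtain i j k a b c where e: "u = i # a" "v = j # b" "w = k # c" "i < n" "j < n" "k < n"
    unfolding vertices_Suc by blast
  note p = Suc.prems[unfolded e pair_in_items_Suc[OF n3]]
  show ?case
  proof (cases "i = j \<and> j = k")
    case True
    have "x = cyc_suc n x \<longleftrightarrow> False" if "x < n" for x using that n by (auto simp: cyc_suc_eq)
    then show ?thesis using p True Suc.IH[of a b c] e by auto
  next
    case False
    then show ?thesis using p e n by (auto simp: cyc_suc_eq split: if_splits)
  qed
qed

lemma card_star_items: "n \<ge> 3 \<Longrightarrow> v \<in> vertices n d \<Longrightarrow> card {e \<in> items n d. v \<in> e} = 2 * d + 1"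
proof (induction d arbitrary: v)
  case 0
  then have "{e \<in> items n 0. v \<in> e} = {{[]}}" by (auto simp: items_0 vertices_def)
  then show ?case by simp
next
  case (Suc d)
  note n = Suc.prems(1)
  obtain i u where v: "v = i # u" "i < n" "u \<in> vertices n d" using Suc.prems(2) unfolding vertices_Suc by blast
  let ?S = "{e \<in> items n d. u \<in> e}"
  have "{e \<in> items n (Suc d). v \<in> e} = (\<lambda>e. (#) i ` e) ` ?S \<union> {col_edge n i u, col_edge n (cyc_pred n i) u}"
  proof -
    have "col_edge n k w = col_edge n i u \<or> col_edge n k w = col_edge n (cyc_pred n i) u"
      if "v \<in> col_edge n k w" "k < n" for k w
      using that v cyc_pred_suc[of k n] by (auto simp: col_edge_def)
    moreover have "v \<in> col_edge n i u" "v \<in> col_edge n (cyc_pred n i) u"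
      using v by (auto simp: col_edge_def cyc_suc_pred)
    moreover have "col_edge n i u \<in> items n (Suc d)" "col_edge n (cyc_pred n i) u \<in> items n (Suc d)"
      using col_edge_in_items[OF n] v cyc_pred_less by auto
    ultimately show ?thesis unfolding items_Suc[OF n] using v by (auto simp: image_iff)
  qed
  moreover have "inj_on (\<lambda>e. (#) i ` e) ?S"
  proof (rule inj_onI)
    fix e f assume "e \<in> ?S" "f \<in> ?S" and eq: "(#) i ` e = (#) i ` f"
    then have "e \<noteq> {}" by blast
    then show "e = f" using eq Cons_image_eq[OF \<open>e \<noteq> {}\<close>] by simp
  qed
  then have "card ((\<lambda>e. (#) i ` e) ` ?S) = 2 * d + 1" using Suc.IH[OF n v(3)] by (simp add: card_image)
  moreover have "(\<lambda>e. (#) i ` e) ` ?S \<inter> {col_edge n i u, col_edge n (cyc_pred n i) u} = {}"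
  proof -
    have "(#) i ` e \<noteq> col_edge n i u \<and> (#) i ` e \<noteq> col_edge n (cyc_pred n i) u" for e
      using col_edge_not_layer[OF n v(2)] col_edge_not_layer[OF n cyc_pred_less[OF v(2)]] by metis
    then show ?thesis by auto
  qed
  moreover have "col_edge n i u \<noteq> col_edge n (cyc_pred n i) u"
    using col_edge_eq_iff[OF n v(2) cyc_pred_less[OF v(2)]] v n by (auto simp: cyc_pred_eq split: if_splits)
  moreover have "finite ?S" using finite_items[OF n] by simp
  ultimately show ?case by (simp add: card_Un_disjoint)
qed

text \<open>A vertex lies on \<open>2 d + 1\<close> items of its layer, as required for \<open>h = 2 d\<close>.\<close>

lemma layers_cycle_power:
  assumes n: "n \<ge> 5" and ext: "extendable (items n d) (2 * d)" and K: "card K = 2 * d + 3"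
  shows "layers {..<n} (cyc_suc n) (cyc_pred n) (vertices n d) (items n d) K (2 * d)"
proof
  have n3: "n \<ge> 3" using n by simp
  show "cyc_suc n j \<noteq> j" "cyc_suc n (cyc_suc n j) \<noteq> j" "cyc_suc n (cyc_suc n (cyc_suc n j)) \<noteq> j"
    "cyc_suc n (cyc_suc n (cyc_suc n (cyc_suc n j))) \<noteq> j" if "j \<in> {..<n}" for j
  proof -
    have "j < n" using that by simp
    then show "cyc_suc n j \<noteq> j" "cyc_suc n (cyc_suc n j) \<noteq> j" "cyc_suc n (cyc_suc n (cyc_suc n j)) \<noteq> j"
       "cyc_suc n (cyc_suc n (cyc_suc n (cyc_suc n j))) \<noteq> j"
      using n by (simp_all add: cyc_suc_eq cyc_suc_less)
  qed
  show "{v} \<in> items n d" if "v \<in> vertices n d" for v using that by (auto simp: items_def)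
  show "u = v" if "2 * d = 0" "u \<in> vertices n d" "v \<in> vertices n d" for u v using that by (simp add: vertices_def)
  show "\<exists>w. e = {v, w}" if "e \<in> items n d" "v \<in> e" for e v using items_pair[OF n3 that] .
  show "u = v \<or> v = w \<or> u = w" if "{u, v} \<in> items n d" "{v, w} \<in> items n d" "{u, w} \<in> items n d" for u v w
    using items_no_triangle[OF n that] .
  show "e \<noteq> {}" if "e \<in> items n d" for e using items_nonempty[OF n3 that] .
  show "e \<subseteq> vertices n d" if "e \<in> items n d" for e using items_sub_vertices[OF n3 that] .
qed (use n K ext finite_items card_star_items in \<open>auto simp: cyc_suc_less cyc_pred_less cyc_suc_pred cyc_pred_suc\<close>)

section \<open>Directions and their exchange\<close>

definition layer_part :: "(nat list set \<Rightarrow> nat option) \<Rightarrow> nat \<Rightarrow> nat list set \<Rightarrow> nat option" where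
  "layer_part \<phi> j e = \<phi> ((#) j ` e)"

lemma partial_col_layer_part:
  assumes n: "n \<ge> 3" and \<phi>: "partial_col (items n (Suc d)) K \<phi>"
  shows "partial_col (items n d) K (layer_part \<phi> j)"
  unfolding partial_col_def
proof (intro conjI allI impI)
  have ne: "e \<noteq> {}" if "\<phi> ((#) j ` e) = Some x" for e x
    using that \<phi> items_nonempty[OF n, of "(#) j ` e" "Suc d"] unfolding partial_col_def by auto
  show "dom (layer_part \<phi> j) \<subseteq> items n d"
  proof
    fix e assume "e \<in> dom (layer_part \<phi> j)"
    then obtain x where x: "\<phi> ((#) j ` e) = Some x" by (auto simp: layer_part_def)
    then have "(#) j ` e \<in> items n (Suc d)" using \<phi> unfolding partial_col_def by blast
    then show "e \<in> items n d" using layer_in_items[OF n ne[OF x]] by blast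
  qed
  show "ran (layer_part \<phi> j) \<subseteq> K" using \<phi> unfolding partial_col_def by (auto simp: ran_def layer_part_def)
  fix e e' x assume A: "layer_part \<phi> j e = Some x" "layer_part \<phi> j e' = Some x" "e \<inter> e' \<noteq> {}"
  then have "\<phi> ((#) j ` e) = Some x" "\<phi> ((#) j ` e') = Some x" "(#) j ` e \<inter> (#) j ` e' \<noteq> {}"
    by (auto simp: layer_part_def)
  then have "(#) j ` e = (#) j ` e'" using \<phi> unfolding partial_col_def by blast
  then show "e = e'" using Cons_image_eq ne A by (metis layer_part_def)
qed

definition direction :: "nat \<Rightarrow> nat \<Rightarrow> nat \<Rightarrow> nat list set set" where
  "direction n d k = {{xs, xs[k := cyc_suc n (xs ! k)]} | xs. xs \<in> vertices n d}"

lemma direction_0: "direction n (Suc d) 0 = {col_edge n j v | j v. j < n \<and> v \<in> vertices n d}"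
proof
  show "direction n (Suc d) 0 \<subseteq> {col_edge n j v | j v. j < n \<and> v \<in> vertices n d}"
    unfolding direction_def vertices_Suc col_edge_def by fastforce
  show "{col_edge n j v | j v. j < n \<and> v \<in> vertices n d} \<subseteq> direction n (Suc d) 0"
  proof
    fix e assume "e \<in> {col_edge n j v | j v. j < n \<and> v \<in> vertices n d}"
    then obtain j v where "e = col_edge n j v" "j < n" "v \<in> vertices n d" by blast
    then have "e = {j # v, (j # v)[0 := cyc_suc n ((j # v) ! 0)]}" "j # v \<in> vertices n (Suc d)"
      by (simp_all add: col_edge_def)
    then show "e \<in> direction n (Suc d) 0" unfolding direction_def by blast
  qed
qed

lemma direction_Suc: "j < n \<Longrightarrow> e \<in> direction n d k \<Longrightarrow> (#) j ` e \<in> direction n (Suc d) (Suc k)"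
proof -
  assume j: "j < n" and "e \<in> direction n d k"
  then obtain xs where xs: "e = {xs, xs[k := cyc_suc n (xs ! k)]}" "xs \<in> vertices n d" unfolding direction_def by blast
  then have "(#) j ` e = {j # xs, (j # xs)[Suc k := cyc_suc n ((j # xs) ! Suc k)]}" by simp
  moreover have "j # xs \<in> vertices n (Suc d)" using j xs by simp
  ultimately show ?thesis unfolding direction_def by blast
qed

lemma items_direction:
  assumes n: "n \<ge> 3"
  shows "e \<in> items n d \<Longrightarrow> (\<exists>v. e = {v}) \<or> (\<exists>k<d. e \<in> direction n d k)"
proof (induction d arbitrary: e)
  case 0 then show ?case by (auto simp: items_0)
next
  case (Suc d)
  then consider j f where "e = (#) j ` f" "j < n" "f \<in> items n d" | "e \<in> direction n (Suc d) 0"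
    unfolding items_Suc[OF n] direction_0 by blast
  then show ?case
  proof cases
    case 1
    from Suc.IH[OF 1(3)] show ?thesis
    proof
      assume "\<exists>v. f = {v}" then show ?thesis using 1 by auto
    next
      assume "\<exists>k<d. f \<in> direction n d k"
      then obtain k where "k < d" "f \<in> direction n d k" by blast
      then have "Suc k < Suc d" "e \<in> direction n (Suc d) (Suc k)" using 1 direction_Suc by auto
      then show ?thesis by blast
    qed
  next
    case 2 then show ?thesis by blast
  qed
qed

lemma direction_items:
  assumes n: "n \<ge> 3"
  shows "k < d \<Longrightarrow> direction n d k \<subseteq> items n d"
proof (induction d arbitrary: k)
  case (Suc d)
  show ?case
  proof (cases k)
    case 0 then show ?thesis unfolding items_Suc[OF n] using direction_0 by blast
  next
    case (Suc k')
    show ?thesis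
    proof
      fix e assume "e \<in> direction n (Suc d) k"
      then obtain j v where e: "e = {j # v, j # v[k' := cyc_suc n (v ! k')]}" "j < n" "v \<in> vertices n d"
        unfolding direction_def vertices_Suc Suc by auto
      then have "{v, v[k' := cyc_suc n (v ! k')]} \<in> items n d"
        using Suc.IH[of k'] Suc.prems Suc unfolding direction_def by blast
      then have "(#) j ` {v, v[k' := cyc_suc n (v ! k')]} \<in> items n (Suc d)"
        using layer_in_items[OF n, of "{v, v[k' := cyc_suc n (v ! k')]}" j d] e(2) by blast
      then show "e \<in> items n (Suc d)" using e by simp
    qed
  qed
qed simp

lemma direction_differ:
  assumes n: "n \<ge> 3" and k: "k < d" and e: "e \<in> direction n d k" and ab: "a \<in> e" "b \<in> e" "a \<noteq> b"
  shows "{i. i < d \<and> a ! i \<noteq> b ! i} = {k}"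
proof -
  obtain xs where xs: "e = {xs, xs[k := cyc_suc n (xs ! k)]}" "xs \<in> vertices n d" using e unfolding direction_def by blast
  have len: "length xs = d" "xs ! k < n" using xs(2) k by (auto simp: vertices_def dest: nth_mem)
  have "cyc_suc n (xs ! k) \<noteq> xs ! k" using len(2) n by (simp add: cyc_suc_eq)
  then have "{i. i < d \<and> xs ! i \<noteq> xs[k := cyc_suc n (xs ! k)] ! i} = {k}"
    using len k by (auto simp: nth_list_update split: if_splits)
  moreover have "{i. i < d \<and> xs[k := cyc_suc n (xs ! k)] ! i \<noteq> xs ! i} =
      {i. i < d \<and> xs ! i \<noteq> xs[k := cyc_suc n (xs ! k)] ! i}" by (intro Collect_cong) metis
  moreover have "a = xs \<and> b = xs[k := cyc_suc n (xs ! k)] \<or> a = xs[k := cyc_suc n (xs ! k)] \<and> b = xs"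
    using ab xs(1) by blast
  ultimately show ?thesis by (elim disjE conjE) simp_all
qed

lemma direction_two:
  assumes n: "n \<ge> 3" and k: "k < d" and e: "e \<in> direction n d k"
  shows "\<exists>a b. a \<in> e \<and> b \<in> e \<and> a \<noteq> b"
proof -
  obtain xs where xs: "e = {xs, xs[k := cyc_suc n (xs ! k)]}" "xs \<in> vertices n d" using e unfolding direction_def by blast
  have len: "length xs = d" "xs ! k < n" using xs(2) k by (auto simp: vertices_def dest: nth_mem)
  have "cyc_suc n (xs ! k) \<noteq> xs ! k" using len(2) n by (simp add: cyc_suc_eq)
  then have "xs \<noteq> xs[k := cyc_suc n (xs ! k)]" using len k by (metis nth_list_update_eq)
  then show ?thesis using xs by blast
qed

lemma direction_disjoint:
  assumes n: "n \<ge> 3" and k: "k < d" "k' < d" and e: "e \<in> direction n d k" "e \<in> direction n d k'"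
  shows "k = k'"
proof -
  obtain a b where ab: "a \<in> e" "b \<in> e" "a \<noteq> b" using direction_two[OF n k(1) e(1)] by blast
  show ?thesis using direction_differ[OF n k(1) e(1) ab] direction_differ[OF n k(2) e(2) ab] by simp
qed

text \<open>Total, so that it is an involution on all lists: a list that is too short is left unchanged.\<close>

definition swap_coord :: "nat \<Rightarrow> nat list \<Rightarrow> nat list" where
  "swap_coord i xs = (if i < length xs then xs[0 := xs ! i, i := xs ! 0] else xs)"

lemma length_swap_coord [simp]: "length (swap_coord i xs) = length xs"
  by (simp add: swap_coord_def)

lemma nth_swap_coord:
  "i < length xs \<Longrightarrow> k < length xs \<Longrightarrow> swap_coord i xs ! k = xs ! (if k = 0 then i else if k = i then 0 else k)"
  by (auto simp: swap_coord_def nth_list_update)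

lemma swap_coord_involution [simp]: "swap_coord i (swap_coord i xs) = xs"
proof (cases "i < length xs")
  case True
  then have "0 < length xs" by linarith
  then show ?thesis by (intro nth_equalityI) (use True in \<open>auto simp: nth_swap_coord\<close>)
next
  case False then show ?thesis by (simp add: swap_coord_def)
qed

lemma swap_coord_image [simp]: "swap_coord i ` swap_coord i ` e = e"
  by (simp add: image_image)

lemma swap_coord_vertices: "xs \<in> vertices n d \<Longrightarrow> swap_coord i xs \<in> vertices n d"
proof -
  assume xs: "xs \<in> vertices n d"
  have "set (swap_coord i xs) \<subseteq> set xs"
  proof
    fix y assume "y \<in> set (swap_coord i xs)"
    then obtain k where k: "k < length xs" "y = swap_coord i xs ! k" by (auto simp: in_set_conv_nth)
    show "y \<in> set xs"
    proof (cases "i < length xs")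
      case True
      then have "0 < length xs" by linarith
      then show ?thesis using True k nth_swap_coord[OF True k(1)] by (auto split: if_splits)
    next
      case False then show ?thesis using k by (simp add: swap_coord_def)
    qed
  qed
  then show ?thesis using xs by (auto simp: vertices_def)
qed

lemma swap_coord_update:
  assumes "i < length xs" "k < length xs"
  shows "swap_coord i (xs[k := y]) = (swap_coord i xs)[(if k = 0 then i else if k = i then 0 else k) := y]"
proof -
  have "0 < length xs" using assms(1) by linarith
  then show ?thesis by (intro nth_equalityI) (use assms in \<open>auto simp: nth_swap_coord nth_list_update\<close>)
qed

lemma swap_coord_direction:
  assumes i: "i < d" and k: "k < d" and e: "e \<in> direction n d k"
  shows "swap_coord i ` e \<in> direction n d (if k = 0 then i else if k = i then 0 else k)" (is "_ \<in> direction n d ?k")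
proof -
  obtain xs where xs: "e = {xs, xs[k := cyc_suc n (xs ! k)]}" "xs \<in> vertices n d" using e unfolding direction_def by blast
  have len: "i < length xs" "k < length xs" using xs i k by (auto simp: vertices_def)
  then have "?k < length xs" by auto
  then have "swap_coord i xs ! ?k = xs ! k" using nth_swap_coord[OF len(1), of ?k] by auto
  then have "swap_coord i ` e = {swap_coord i xs, (swap_coord i xs)[?k := cyc_suc n (swap_coord i xs ! ?k)]}"
    using xs swap_coord_update[OF len] by simp
  then show ?thesis using swap_coord_vertices[OF xs(2)] unfolding direction_def by blast
qed

lemma swap_coord_items:
  assumes n: "n \<ge> 3" and i: "i < d" and e: "e \<in> items n d"
  shows "swap_coord i ` e \<in> items n d"
proof -
  from items_direction[OF n e] show ?thesis
  proof
    assume "\<exists>v. e = {v}"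
    then obtain v where v: "e = {v}" by blast
    then have "swap_coord i v \<in> vertices n d" using items_sub_vertices[OF n e] swap_coord_vertices by blast
    then show ?thesis using v by (simp add: items_def)
  next
    assume "\<exists>k<d. e \<in> direction n d k"
    then obtain k where k: "k < d" "e \<in> direction n d k" by blast
    then have "swap_coord i ` e \<in> direction n d (if k = 0 then i else if k = i then 0 else k)"
      using swap_coord_direction[OF i] by blast
    moreover have "(if k = 0 then i else if k = i then 0 else k) < d" using i k by auto
    ultimately show ?thesis using direction_items[OF n] by blast
  qed
qed

text \<open>Exchanges direction \<open>i\<close> with direction \<open>0\<close>, the vertical one.\<close>

definition turn :: "nat \<Rightarrow> (nat list set \<Rightarrow> nat option) \<Rightarrow> nat list set \<Rightarrow> nat option" where
  "turn i \<phi> e = \<phi> (swap_coord i ` e)"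

lemma dom_turn: "dom (turn i \<phi>) = (`) (swap_coord i) ` dom \<phi>"
proof
  show "dom (turn i \<phi>) \<subseteq> (`) (swap_coord i) ` dom \<phi>"
  proof
    fix e assume "e \<in> dom (turn i \<phi>)"
    then have "swap_coord i ` e \<in> dom \<phi>" by (auto simp: turn_def)
    then show "e \<in> (`) (swap_coord i) ` dom \<phi>" by (intro image_eqI[of _ _ "swap_coord i ` e"]) simp_all
  qed
  show "(`) (swap_coord i) ` dom \<phi> \<subseteq> dom (turn i \<phi>)" by (auto simp: turn_def)
qed

lemma inj_swap_coord_image: "inj_on ((`) (swap_coord i)) A"
  by (rule inj_on_inverseI[of _ "(`) (swap_coord i)"]) simp

lemma partial_col_turn:
  assumes n: "n \<ge> 3" and i: "i < d" and \<phi>: "partial_col (items n d) K \<phi>"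
  shows "partial_col (items n d) K (turn i \<phi>)"
  unfolding partial_col_def
proof (intro conjI allI impI)
  show "dom (turn i \<phi>) \<subseteq> items n d"
    using \<phi> swap_coord_items[OF n i] unfolding dom_turn partial_col_def by blast
  show "ran (turn i \<phi>) \<subseteq> K" using \<phi> unfolding partial_col_def by (auto simp: ran_def turn_def)
  fix e e' x assume A: "turn i \<phi> e = Some x" "turn i \<phi> e' = Some x" "e \<inter> e' \<noteq> {}"
  then have "swap_coord i ` e \<inter> swap_coord i ` e' \<noteq> {}" by blast
  then have "swap_coord i ` e = swap_coord i ` e'" using A \<phi> unfolding partial_col_def turn_def by blast
  then show "e = e'" by (metis swap_coord_image)
qed

lemma extension_turn:
  assumes n: "n \<ge> 3" and i: "i < d" and G: "total_col (items n d) K G" "agrees (turn i \<phi>) G"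
  shows "\<exists>G. total_col (items n d) K G \<and> agrees \<phi> G"
proof (intro exI conjI)
  let ?G = "\<lambda>e. G (swap_coord i ` e)"
  show "total_col (items n d) K ?G"
    unfolding total_col_def proper_on_def
  proof (intro conjI ballI impI)
    show "?G ` items n d \<subseteq> K" using G swap_coord_items[OF n i] by (auto simp: total_col_def)
    fix e e' assume A: "e \<in> items n d" "e' \<in> items n d" "e \<noteq> e' \<and> e \<inter> e' \<noteq> {}"
    have "swap_coord i ` e \<noteq> swap_coord i ` e'" using A(3) by (metis swap_coord_image)
    moreover have "swap_coord i ` e \<inter> swap_coord i ` e' \<noteq> {}" using A(3) by blast
    moreover have "G a \<noteq> G b" if "a \<in> items n d" "b \<in> items n d" "a \<noteq> b" "a \<inter> b \<noteq> {}" for a b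
      using G(1) that unfolding total_col_def proper_on_def by blast
    ultimately show "?G e \<noteq> ?G e'" using swap_coord_items[OF n i] A(1,2) by simp
  qed
  show "agrees \<phi> ?G" using G(2) unfolding agrees_def turn_def by simp
qed

section \<open>The induction over the dimension\<close>

definition glue :: "nat \<Rightarrow> nat \<Rightarrow> (nat \<Rightarrow> nat list set \<Rightarrow> nat) \<Rightarrow> (nat \<Rightarrow> nat list \<Rightarrow> nat) \<Rightarrow> nat list set \<Rightarrow> nat" where
  "glue n d g m e = (THE y. (\<exists>j f. j < n \<and> f \<in> items n d \<and> e = (#) j ` f \<and> y = g j f) \<or>
     (\<exists>j v. j < n \<and> v \<in> vertices n d \<and> e = col_edge n j v \<and> y = m j v))"

lemma glue_layer:
  assumes n: "n \<ge> 3" and f: "j < n" "f \<in> items n d"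
  shows "glue n d g m ((#) j ` f) = g j f"
  unfolding glue_def
proof (rule the_equality)
  show "(\<exists>k f'. k < n \<and> f' \<in> items n d \<and> (#) j ` f = (#) k ` f' \<and> g j f = g k f') \<or>
    (\<exists>k v. k < n \<and> v \<in> vertices n d \<and> (#) j ` f = col_edge n k v \<and> g j f = m k v)" using f by blast
  fix y assume "(\<exists>k f'. k < n \<and> f' \<in> items n d \<and> (#) j ` f = (#) k ` f' \<and> y = g k f') \<or>
    (\<exists>k v. k < n \<and> v \<in> vertices n d \<and> (#) j ` f = col_edge n k v \<and> y = m k v)"
  then show "y = g j f"
    using Cons_image_eq[OF items_nonempty[OF n f(2)]] col_edge_not_layer[OF n] by metis
qed

lemma glue_col:
  assumes n: "n \<ge> 3" and v: "j < n" "v \<in> vertices n d"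
  shows "glue n d g m (col_edge n j v) = m j v"
  unfolding glue_def
proof (rule the_equality)
  show "(\<exists>k f'. k < n \<and> f' \<in> items n d \<and> col_edge n j v = (#) k ` f' \<and> m j v = g k f') \<or>
    (\<exists>k w. k < n \<and> w \<in> vertices n d \<and> col_edge n j v = col_edge n k w \<and> m j v = m k w)" using v by blast
  fix y assume "(\<exists>k f'. k < n \<and> f' \<in> items n d \<and> col_edge n j v = (#) k ` f' \<and> y = g k f') \<or>
    (\<exists>k w. k < n \<and> w \<in> vertices n d \<and> col_edge n j v = col_edge n k w \<and> y = m k w)"
  then show "y = m j v"
    using col_edge_eq_iff[OF n v(1)] col_edge_not_layer[OF n v(1)] by metis
qed

lemma items_at_vertex:
  assumes n: "n \<ge> 3" and e: "e \<in> items n (Suc d)" "x \<in> e"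
  obtains i u f where "x = i # u" "i < n" "u \<in> vertices n d" "u \<in> f" "f \<in> items n d" "e = (#) i ` f"
  | i u where "x = i # u" "i < n" "u \<in> vertices n d" "e = col_edge n i u"
  | i u where "x = i # u" "i < n" "u \<in> vertices n d" "e = col_edge n (cyc_pred n i) u"
proof -
  from e(1) consider i f where "e = (#) i ` f" "i < n" "f \<in> items n d"
    | k u where "e = col_edge n k u" "k < n" "u \<in> vertices n d" unfolding items_Suc[OF n] by blast
  then show ?thesis
  proof cases
    case 1
    then obtain u where "x = i # u" "u \<in> f" using e(2) by blast
    then show ?thesis using that(1) 1 items_sub_vertices[OF n 1(3)] by blast
  next
    case 2
    then have "x = k # u \<or> x = cyc_suc n k # u" using e(2) by (auto simp: col_edge_def)
    then show ?thesis
    proof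
      assume "x = k # u" then show ?thesis using that(2) 2 by blast
    next
      assume "x = cyc_suc n k # u"
      then show ?thesis using that(3)[of "cyc_suc n k" u] 2 by (simp add: cyc_suc_less cyc_pred_suc)
    qed
  qed
qed

lemma extension_from_layers:
  assumes n: "n \<ge> 5" and ext: "extendable (items n d) (2 * d)" and K: "card K = 2 * d + 3"
    and \<phi>: "partial_col (items n (Suc d)) K \<phi>"
    and layered: "layers.layered {..<n} (cyc_suc n) (vertices n d) (items n d) K g m"
    and ag: "\<And>j. j < n \<Longrightarrow> agrees (layer_part \<phi> j) (g j)"
    and vert: "\<And>j v x. j < n \<Longrightarrow> v \<in> vertices n d \<Longrightarrow> \<phi> (col_edge n j v) = Some x \<Longrightarrow> m j v = x"
  shows "\<exists>G. total_col (items n (Suc d)) K G \<and> agrees \<phi> G"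
proof (intro exI conjI)
  interpret L: layers "{..<n}" "cyc_suc n" "cyc_pred n" "vertices n d" "items n d" K "2 * d"
    by (rule layers_cycle_power[OF n ext K])
  have n3: "n \<ge> 3" using n by simp
  note D = L.layeredD[OF layered]
  let ?G = "glue n d g m"
  note gl = glue_layer[OF n3, of _ _ d g m] and gc = glue_col[OF n3, of _ _ d g m]
  show "total_col (items n (Suc d)) K ?G"
    unfolding total_col_def proper_on_def
  proof (intro conjI ballI impI)
    show "?G ` items n (Suc d) \<subseteq> K"
    proof
      fix y assume "y \<in> ?G ` items n (Suc d)"
      then obtain e where e: "e \<in> items n (Suc d)" "y = ?G e" by blast
      from e(1) consider i f where "e = (#) i ` f" "i < n" "f \<in> items n d"
        | k u where "e = col_edge n k u" "k < n" "u \<in> vertices n d" unfolding items_Suc[OF n3] by blast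
      then show "y \<in> K"
      proof cases
        case 1 then show ?thesis using D(2)[of i f] e gl by simp
      next
        case 2 then show ?thesis using D(3)[of k u] e gc by simp
      qed
    qed
    fix e e' assume e: "e \<in> items n (Suc d)" "e' \<in> items n (Suc d)" "e \<noteq> e' \<and> e \<inter> e' \<noteq> {}"
    then obtain x where x: "x \<in> e" "x \<in> e'" by blast
    have vv: "m i u \<noteq> m (cyc_pred n i) u" if "i < n" "u \<in> vertices n d" for i u
      using D(4)[of "cyc_pred n i" u] that by (simp add: cyc_pred_less cyc_suc_pred)
    have lv: "g i f \<noteq> m i u" "g i f \<noteq> m (cyc_pred n i) u" if "i < n" "f \<in> items n d" "u \<in> f" for i f u
      using D(6)[of i f u] D(7)[of "cyc_pred n i" f u] that by (simp_all add: cyc_pred_less cyc_suc_pred)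
    have c: "?G (col_edge n i u) = m i u" "?G (col_edge n (cyc_pred n i) u) = m (cyc_pred n i) u"
      if "i < n" "u \<in> vertices n d" for i u using gc that cyc_pred_less by auto
    show "?G e \<noteq> ?G e'"
    proof (rule items_at_vertex[OF n3 e(1) x(1)])
      fix i u f assume A: "x = i # u" "i < n" "u \<in> vertices n d" "u \<in> f" "f \<in> items n d" "e = (#) i ` f"
      show ?thesis
      proof (rule items_at_vertex[OF n3 e(2) x(2)])
        fix i' u' f' assume B: "x = i' # u'" "i' < n" "u' \<in> f'" "f' \<in> items n d" "e' = (#) i' ` f'"
        then have "g i f = g i f' \<Longrightarrow> f = f'" using D(10)[of i f f' u] A by auto
        then show ?thesis using A B e(3) gl by auto
      qed (use A lv[of i f u] gl c in auto)
    next
      fix i u assume A: "x = i # u" "i < n" "u \<in> vertices n d" "e = col_edge n i u"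
      show ?thesis
      proof (rule items_at_vertex[OF n3 e(2) x(2)])
        fix i' u' f' assume B: "x = i' # u'" "i' < n" "u' \<in> f'" "f' \<in> items n d" "e' = (#) i' ` f'"
        show ?thesis using A B lv(1)[of i f' u] gl c by auto
      qed (use A e(3) vv[of i u] c in auto)
    next
      fix i u assume A: "x = i # u" "i < n" "u \<in> vertices n d" "e = col_edge n (cyc_pred n i) u"
      show ?thesis
      proof (rule items_at_vertex[OF n3 e(2) x(2)])
        fix i' u' f' assume B: "x = i' # u'" "i' < n" "u' \<in> f'" "f' \<in> items n d" "e' = (#) i' ` f'"
        show ?thesis using A B lv(2)[of i f' u] gl c by auto
      qed (use A e(3) vv[of i u] c in auto)
    qed
  qed
  show "agrees \<phi> ?G"
    unfolding agrees_def
  proof (intro allI impI)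
    fix e x assume ex: "\<phi> e = Some x"
    then have "e \<in> items n (Suc d)" using \<phi> unfolding partial_col_def by blast
    then consider i f where "e = (#) i ` f" "i < n" "f \<in> items n d"
        | k u where "e = col_edge n k u" "k < n" "u \<in> vertices n d" unfolding items_Suc[OF n3] by blast
    then show "?G e = x"
    proof cases
      case 1
      then show ?thesis using agreesD[OF ag[OF 1(2)], of f x] ex gl by (simp add: layer_part_def)
    next
      case 2 then show ?thesis using vert ex gc by simp
    qed
  qed
qed

lemma finite_dom_items: "n \<ge> 3 \<Longrightarrow> partial_col (items n d) K R \<Longrightarrow> finite (dom R)"
  unfolding partial_col_def using finite_subset[OF _ finite_items, of "dom R" n d] by blast

lemma sum_layer_loads:
  assumes n: "n \<ge> 3" and \<phi>: "partial_col (items n (Suc d)) K \<phi>"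
  shows "(\<Sum>j<n. card (dom (layer_part \<phi> j))) + card (dom \<phi> \<inter> direction n (Suc d) 0) \<le> card (dom \<phi>)"
proof -
  let ?S = "Sigma {..<n} (\<lambda>j. dom (layer_part \<phi> j))"
  let ?f = "\<lambda>(j, e). (#) j ` e"
  have fin: "finite (dom \<phi>)" by (rule finite_dom_items[OF n \<phi>])
  have finl: "finite (dom (layer_part \<phi> j))" for j
    by (rule finite_dom_items[OF n partial_col_layer_part[OF n \<phi>]])
  have ne: "e \<noteq> {}" if "e \<in> dom (layer_part \<phi> j)" for e j
    using partial_col_layer_part[OF n \<phi>, of j] that items_nonempty[OF n, of e d] unfolding partial_col_def by blast
  have "inj_on ?f ?S"
  proof (rule inj_onI)
    fix p q assume "p \<in> ?S" "q \<in> ?S" "?f p = ?f q"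
    then obtain i e j f where pq: "p = (i, e)" "q = (j, f)" "e \<in> dom (layer_part \<phi> i)" "(#) i ` e = (#) j ` f"
      by (cases p; cases q) auto
    then show "p = q" using Cons_image_eq[OF ne[OF pq(3)], of i j f] by simp
  qed
  moreover have "?f ` ?S \<subseteq> dom \<phi> - direction n (Suc d) 0"
  proof
    fix x assume "x \<in> ?f ` ?S"
    then obtain j e where je: "x = (#) j ` e" "e \<in> dom (layer_part \<phi> j)" by auto
    have "x \<noteq> col_edge n i v" if "i < n" for i v using col_edge_not_layer[OF n that] je(1) by metis
    then have "x \<notin> direction n (Suc d) 0" unfolding direction_0 by blast
    moreover have "x \<in> dom \<phi>" using je by (auto simp: layer_part_def)
    ultimately show "x \<in> dom \<phi> - direction n (Suc d) 0" by blast
  qed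
  ultimately have "card ?S \<le> card (dom \<phi> - direction n (Suc d) 0)" using fin by (intro card_inj_on_le) auto
  moreover have "card ?S = (\<Sum>j<n. card (dom (layer_part \<phi> j)))" using finl by simp
  moreover have "card (dom \<phi> - direction n (Suc d) 0) + card (dom \<phi> \<inter> direction n (Suc d) 0) = card (dom \<phi>)"
    using fin by (metis add.commute card_Int_Diff)
  ultimately show ?thesis by linarith
qed

text \<open>The configuration in two dimensions that \<open>two_verticals\<close> leaves out, with one precoloured item in
each of two consecutive layers and all vertical edges between these layers.\<close>

definition tangled :: "nat \<Rightarrow> (nat list set \<Rightarrow> nat option) \<Rightarrow> bool" where
  "tangled n \<phi> \<longleftrightarrow> (\<exists>j<n. \<exists>x\<in>dom \<phi>. \<exists>y\<in>dom \<phi>. hd ` x = {j} \<and> hd ` y = {cyc_suc n j} \<and>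
     (\<forall>f \<in> dom \<phi> \<inter> direction n 2 0. (\<exists>v\<in>vertices n 1. f = col_edge n j v) \<and> (\<phi> f = \<phi> x \<or> \<phi> f = \<phi> y)))"

lemma extend_along_first:
  assumes n: "n \<ge> 5" and ext: "extendable (items n d) (2 * d)" and K: "card K = 2 * d + 3"
    and \<phi>: "partial_col (items n (Suc d)) K \<phi>" and le: "card (dom \<phi>) \<le> 2 * d + 2"
    and few: "card (dom \<phi> \<inter> direction n (Suc d) 0) \<le> 1 \<or>
      card (dom \<phi> \<inter> direction n (Suc d) 0) = 2 \<and> (\<forall>v. \<phi> {v} = None) \<and> (d = 1 \<longrightarrow> \<not> tangled n \<phi>)"
  shows "\<exists>G. total_col (items n (Suc d)) K G \<and> agrees \<phi> G"
proof -
  interpret L: layers "{..<n}" "cyc_suc n" "cyc_pred n" "vertices n d" "items n d" K "2 * d"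
    by (rule layers_cycle_power[OF n ext K])
  have n3: "n \<ge> 3" using n by simp
  let ?P = "layer_part \<phi>"
  let ?V = "dom \<phi> \<inter> direction n (Suc d) 0"
  have P: "partial_col (items n d) K (?P j)" for j by (rule partial_col_layer_part[OF n3 \<phi>])
  note tot = sum_layer_loads[OF n3 \<phi>]
  have finV: "finite ?V" using finite_dom_items[OF n3 \<phi>] by simp
  have V: "col_edge n j v \<in> ?V" if "j < n" "v \<in> vertices n d" "\<phi> (col_edge n j v) = Some x" for j v x
    using that unfolding direction_0 by blast
  have V_ex: "\<exists>j v x. f = col_edge n j v \<and> j < n \<and> v \<in> vertices n d \<and> \<phi> f = Some x" if "f \<in> ?V" for f
    using that unfolding direction_0 by blast
  have colK: "x \<in> K" if "\<phi> f = Some x" for f x using \<phi> that unfolding partial_col_def ran_def by blast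
  have same: "e = f" if "\<phi> e = Some x" "\<phi> f = Some x" "u \<in> e" "u \<in> f" for e f x u
    using \<phi> that unfolding partial_col_def by blast
  have away: "v \<notin> z" if "\<phi> (col_edge n j v) = Some x" "j < n" "?P j z = Some x \<or> ?P (cyc_suc n j) z = Some x" for j v x z
  proof
    assume vz: "v \<in> z"
    from that(3) obtain i where i: "i = j \<or> i = cyc_suc n j" "\<phi> ((#) i ` z) = Some x" by (auto simp: layer_part_def)
    have "col_edge n j v = (#) i ` z"
      by (rule same[OF that(1) i(2), of "i # v"]) (use i vz in \<open>auto simp: col_edge_def\<close>)
    then show False using col_edge_not_layer[OF n3 that(2)] by blast
  qed
  have Sum: "(\<Sum>j\<in>{..<n}. L.load (?P j)) = (\<Sum>j<n. card (dom (?P j)))" by simp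
  consider "card ?V = 0" | "card ?V = 1" | "card ?V = 2" "\<forall>v. \<phi> {v} = None" "d = 1 \<longrightarrow> \<not> tangled n \<phi>"
    using few by (metis le_0_eq le_SucE One_nat_def)
  then show ?thesis
  proof cases
    case 1
    then have none: "?V = {}" using finV by simp
    have "L.solvable0 ?P" by (rule L.no_vertical) (use P tot le 1 in auto)
    then obtain g m where "L.layered g m" "\<forall>j\<in>{..<n}. agrees (?P j) (g j)" unfolding L.solvable0_def by blast
    then show ?thesis using extension_from_layers[OF n ext K \<phi>, of g m] V none by blast
  next
    case 2
    then obtain f where f: "?V = {f}" by (auto simp: card_1_singleton_iff)
    then have "f \<in> ?V" by simp
    from V_ex[OF this] obtain j v x where j: "f = col_edge n j v" "j < n" "v \<in> vertices n d" "\<phi> f = Some x" by blast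
    have "L.solvable1 ?P j v x"
      by (rule L.one_vertical) (use P tot le 2 j colK away[of j v x] in auto)
    then obtain g m where gm: "L.layered g m" "\<forall>j\<in>{..<n}. agrees (?P j) (g j)" "m j v = x" unfolding L.solvable1_def by blast
    have "m i u = y" if "i < n" "u \<in> vertices n d" "\<phi> (col_edge n i u) = Some y" for i u y
    proof -
      have "col_edge n i u = col_edge n j v" using V[OF that] f j(1) by blast
      then show ?thesis using col_edge_eq_iff[OF n3 that(1) j(2)] gm(3) that(3) j by auto
    qed
    then show ?thesis using extension_from_layers[OF n ext K \<phi> gm(1)] gm(2) by blast
  next
    case 3
    then obtain f f' where f: "?V = {f, f'}" "f \<noteq> f'" by (auto simp: card_2_iff)
    then have fV: "f \<in> ?V" "f' \<in> ?V" by simp_all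
    from V_ex[OF fV(1)] obtain j v x where j: "f = col_edge n j v" "j < n" "v \<in> vertices n d" "\<phi> f = Some x" by blast
    from V_ex[OF fV(2)] obtain j' v' x' where j': "f' = col_edge n j' v'" "j' < n" "v' \<in> vertices n d" "\<phi> f' = Some x'" by blast
    have "L.solvable2 ?P j v x j' v' x'"
    proof (rule L.two_verticals)
      show "(\<Sum>i\<in>{..<n}. L.load (?P i)) \<le> 2 * d" using tot le 3 by simp
      show "?P i {u} = None" for i u using 3(2) by (simp add: layer_part_def)
      show "j = j' \<Longrightarrow> v \<noteq> v'" using f j j' by auto
      show "v \<noteq> v'" if "cyc_suc n j = j' \<or> cyc_suc n j' = j" "x = x'"
      proof
        assume vv: "v = v'"
        have "\<exists>u. u \<in> f \<and> u \<in> f'" using that(1) vv j(1) j'(1) by (auto simp: col_edge_def)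
        then show False using same[of f x f'] f(2) j(4) j'(4) that(2) by blast
      qed
      show "\<not> (2 * d = 2 \<and> L.load (?P j) = 1 \<and> L.load (?P (cyc_suc n j)) = 1 \<and>
        x \<in> ran (?P j) \<union> ran (?P (cyc_suc n j)) \<and> x' \<in> ran (?P j) \<union> ran (?P (cyc_suc n j)))" if "j = j'"
      proof
        assume A: "2 * d = 2 \<and> L.load (?P j) = 1 \<and> L.load (?P (cyc_suc n j)) = 1 \<and>
          x \<in> ran (?P j) \<union> ran (?P (cyc_suc n j)) \<and> x' \<in> ran (?P j) \<union> ran (?P (cyc_suc n j))"
        then have d1: "d = 1" by simp
        obtain e where e: "dom (?P j) = {e}" using A by (auto simp: card_1_singleton_iff)
        obtain e' where e': "dom (?P (cyc_suc n j)) = {e'}" using A by (auto simp: card_1_singleton_iff)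
        have "e \<in> items n d" "e' \<in> items n d"
          using P[of j] P[of "cyc_suc n j"] e e' unfolding partial_col_def by simp_all
        then have ne: "e \<noteq> {}" "e' \<noteq> {}" using items_nonempty[OF n3] by simp_all
        have r: "\<phi> ((#) i ` q) = Some y" if "y \<in> ran (?P i)" "dom (?P i) = {q}" for y i q
        proof -
          from that(1) obtain z where z: "?P i z = Some y" unfolding ran_def by blast
          then have "z \<in> dom (?P i)" by blast
          then have "z = q" unfolding that(2) by simp
          then show ?thesis using z by (simp add: layer_part_def)
        qed
        have hds: "hd ` (#) j ` e = {j}" "hd ` (#) (cyc_suc n j) ` e' = {cyc_suc n j}"
          using ne by (auto simp: image_image)
        have doms: "(#) j ` e \<in> dom \<phi>" "(#) (cyc_suc n j) ` e' \<in> dom \<phi>"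
          using e e' by (auto simp: layer_part_def dom_def)
        have "(\<exists>v\<in>vertices n 1. q = col_edge n j v) \<and> (\<phi> q = \<phi> ((#) j ` e) \<or> \<phi> q = \<phi> ((#) (cyc_suc n j) ` e'))"
          if "q \<in> dom \<phi> \<inter> direction n 2 0" for q
        proof -
          have "q \<in> ?V" using that d1 by (simp add: numeral_2_eq_2)
          then have q: "q = f \<or> q = f'" using f by blast
          then have 1: "\<exists>v\<in>vertices n 1. q = col_edge n j v" using j j' \<open>j = j'\<close> d1 by auto
          have "Some y = \<phi> ((#) j ` e) \<or> Some y = \<phi> ((#) (cyc_suc n j) ` e')"
            if "y \<in> ran (?P j) \<union> ran (?P (cyc_suc n j))" for y
            using that r[OF _ e, of y] r[OF _ e', of y] by (elim UnE) simp_all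
          then have "\<phi> q = \<phi> ((#) j ` e) \<or> \<phi> q = \<phi> ((#) (cyc_suc n j) ` e')"
            using q A j(4) j'(4) by metis
          then show ?thesis using 1 by blast
        qed
        then have "tangled n \<phi>" unfolding tangled_def using j(2) hds doms by blast
        then show False using 3 d1 by blast
      qed
    qed (use P j j' colK away[of j v x] away[of j' v' x'] in auto)
    then obtain g m where gm: "L.layered g m" "\<forall>j\<in>{..<n}. agrees (?P j) (g j)" "m j v = x" "m j' v' = x'"
      unfolding L.solvable2_def by blast
    have "m i u = y" if "i < n" "u \<in> vertices n d" "\<phi> (col_edge n i u) = Some y" for i u y
    proof -
      have "col_edge n i u = col_edge n j v \<or> col_edge n i u = col_edge n j' v'" using V[OF that] f j(1) j'(1) by blast
      then show ?thesis
        using col_edge_eq_iff[OF n3 that(1) j(2)] col_edge_eq_iff[OF n3 that(1) j'(2)] gm(3,4) that(3) j j' by auto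
    qed
    then show ?thesis using extension_from_layers[OF n ext K \<phi> gm(1)] gm(2) by blast
  qed
qed

text \<open>If the colouring is tangled in both directions, its edges form a 4-cycle. But then each of them is
adjacent to both edges of the other direction and cannot share a colour with either.\<close>

lemma tangled_turn:
  assumes n: "n \<ge> 3" and \<phi>: "partial_col (items n 2) K \<phi>" and noloop: "\<And>v. \<phi> {v} = None"
    and two: "card (dom \<phi> \<inter> direction n 2 1) = 2"
    and t: "tangled n \<phi>" "tangled n (turn 1 \<phi>)"
  shows False
proof -
  let ?s = "swap_coord 1"
  have dom: "e \<in> direction n 2 0 \<or> e \<in> direction n 2 1" if "e \<in> dom \<phi>" for e
  proof -
    have "e \<in> items n 2" using that \<phi> unfolding partial_col_def by blast
    moreover have "\<not> (\<exists>v. e = {v})" using that noloop by auto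
    ultimately obtain k where "k < 2" "e \<in> direction n 2 k" using items_direction[OF n] by blast
    then show ?thesis by (cases k) (auto simp: less_Suc_eq numeral_2_eq_2)
  qed
  have vtx2: "\<exists>a b. xs = [a, b] \<and> a < n \<and> b < n" if "xs \<in> vertices n 2" for xs
    using that by (auto simp: vertices_def length_Suc_conv numeral_2_eq_2)
  have d0: "\<exists>a b. e = {[a, b], [cyc_suc n a, b]} \<and> a < n \<and> b < n" if "e \<in> direction n 2 0" for e
  proof -
    from that obtain xs where "e = {xs, xs[0 := cyc_suc n (xs ! 0)]}" "xs \<in> vertices n 2" unfolding direction_def by blast
    then show ?thesis using vtx2 by fastforce
  qed
  have d1: "\<exists>a b. e = {[a, b], [a, cyc_suc n b]} \<and> a < n \<and> b < n" if "e \<in> direction n 2 1" for e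
  proof -
    from that obtain xs where "e = {xs, xs[1 := cyc_suc n (xs ! 1)]}" "xs \<in> vertices n 2" unfolding direction_def by blast
    then show ?thesis using vtx2 by fastforce
  qed
  have sne: "cyc_suc n a \<noteq> a" if "a < n" for a using that n by (simp add: cyc_suc_eq)
  have sw: "?s [a, b] = [b, a]" for a b by (simp add: swap_coord_def)
  from t(1) obtain j x y where jxy: "j < n" "x \<in> dom \<phi>" "y \<in> dom \<phi>" "hd ` x = {j}" "hd ` y = {cyc_suc n j}"
    and A: "\<forall>f \<in> dom \<phi> \<inter> direction n 2 0. (\<exists>v\<in>vertices n 1. f = col_edge n j v) \<and> (\<phi> f = \<phi> x \<or> \<phi> f = \<phi> y)"
    unfolding tangled_def by (elim exE conjE bexE) (rule that)
  from t(2) obtain k x' y' where k: "k < n" "x' \<in> dom (turn 1 \<phi>)" "y' \<in> dom (turn 1 \<phi>)"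
      "hd ` x' = {k}" "hd ` y' = {cyc_suc n k}"
    and B': "\<forall>f \<in> dom (turn 1 \<phi>) \<inter> direction n 2 0. (\<exists>v\<in>vertices n 1. f = col_edge n k v) \<and>
      (turn 1 \<phi> f = turn 1 \<phi> x' \<or> turn 1 \<phi> f = turn 1 \<phi> y')"
    unfolding tangled_def by (elim exE conjE bexE) (rule that)
  have B: "\<exists>v\<in>vertices n 1. f = col_edge n k v" if "f \<in> dom (turn 1 \<phi>)" "f \<in> direction n 2 0" for f
    using B' that by simp
  have horizontal: "\<exists>b. e = {[a, b], [a, cyc_suc n b]} \<and> b < n" if "e \<in> dom \<phi>" "hd ` e = {a}" for e a
  proof -
    have "e \<notin> direction n 2 0"
    proof
      assume "e \<in> direction n 2 0"
      then obtain c b where "e = {[c, b], [cyc_suc n c, b]}" "c < n" using d0 by blast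
      then show False using that(2) sne by auto
    qed
    then have "e \<in> direction n 2 1" using dom[OF that(1)] by blast
    then obtain c b where e: "e = {[c, b], [c, cyc_suc n b]}" "b < n" using d1 by blast
    then have "c = a" using that(2) by auto
    then show ?thesis using e by blast
  qed
  have at_k: "e = {[a, k], [a, cyc_suc n k]}" if "e \<in> dom \<phi>" "hd ` e = {a}" for e a
  proof -
    from horizontal[OF that] obtain b where b: "e = {[a, b], [a, cyc_suc n b]}" "b < n" by blast
    have "e \<in> direction n 2 1"
    proof -
      have "e \<notin> direction n 2 0"
      proof
        assume "e \<in> direction n 2 0"
        then obtain c b where "e = {[c, b], [cyc_suc n c, b]}" "c < n" using d0 by blast
        then show False using that(2) sne by auto
      qed
      then show ?thesis using dom[OF that(1)] by blast
    qed
    then have "?s ` e \<in> direction n 2 0" using swap_coord_direction[of 1 2 1 e n] by simp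
    moreover have "?s ` e \<in> dom (turn 1 \<phi>)" using that(1) unfolding dom_turn by blast
    ultimately obtain v where "?s ` e = col_edge n k v" using B by blast
    then have "{[b, a], [cyc_suc n b, a]} = {k # v, cyc_suc n k # v}" using b sw by (simp add: col_edge_def)
    then have "{b, cyc_suc n b} = {k, cyc_suc n k}" by (auto simp: doubleton_eq_iff)
    then have "b = k" using b(2) k(1) n by (auto simp: doubleton_eq_iff cyc_suc_eq split: if_splits)
    then show ?thesis using b by simp
  qed
  have x: "x = {[j, k], [j, cyc_suc n k]}" by (rule at_k[OF jxy(2,4)])
  have y: "y = {[cyc_suc n j, k], [cyc_suc n j, cyc_suc n k]}" by (rule at_k[OF jxy(3,5)])
  let ?X = "?s ` x'"
  have X: "?X \<in> dom \<phi>" using k(2) unfolding dom_turn by auto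
  have x': "x' = ?s ` ?X" by simp
  have "?X \<notin> direction n 2 1"
  proof
    assume "?X \<in> direction n 2 1"
    then obtain a b where ab: "?X = {[a, b], [a, cyc_suc n b]}" "b < n" using d1 by blast
    then have "x' = {[b, a], [cyc_suc n b, a]}" using x' sw by simp
    then show False using k(4) sne[OF ab(2)] by auto
  qed
  then have X0: "?X \<in> direction n 2 0" using dom[OF X] by blast
  obtain v where v: "v \<in> vertices n 1" "?X = col_edge n j v" and c: "\<phi> ?X = \<phi> x \<or> \<phi> ?X = \<phi> y"
    using bspec[OF A, of ?X] X X0 by auto
  obtain w where w: "v = [w]" using v(1) by (auto simp: vertices_def length_Suc_conv)
  have Xw: "?X = {[j, w], [cyc_suc n j, w]}" using v(2) w by (simp add: col_edge_def)
  have "x' = ?s ` {[j, w], [cyc_suc n j, w]}" using x' by (simp only: Xw)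
  then have "x' = {[w, j], [w, cyc_suc n j]}" using sw by simp
  then have "w = k" using k(4) by auto
  then have X_eq: "?X = {[j, k], [cyc_suc n j, k]}" using v w by (simp add: col_edge_def)
  obtain a where a: "\<phi> ?X = Some a" using X by blast
  have P: "e = f" if "\<phi> e = Some a" "\<phi> f = Some a" "u \<in> e" "u \<in> f" for e f u
    using \<phi> that unfolding partial_col_def by blast
  from c show False
  proof
    assume "\<phi> ?X = \<phi> x"
    then have "?X = x" using P[of ?X x "[j, k]"] a X_eq x by simp
    then show False using X_eq x sne[OF jxy(1)] sne[OF k(1)] by (auto simp: doubleton_eq_iff)
  next
    assume "\<phi> ?X = \<phi> y"
    then have "?X = y" using P[of ?X y "[cyc_suc n j, k]"] a X_eq y by simp
    then show False using X_eq y sne[OF jxy(1)] sne[OF k(1)] by (auto simp: doubleton_eq_iff)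
  qed
qed

text \<open>If every direction contains at least two precoloured edges, then counting shows that each
contains exactly two and that no singleton is precoloured.\<close>

theorem extendable_cycle_power:
  assumes n: "n \<ge> 5"
  shows "extendable (items n d) (2 * d)"
proof (induction d)
  case 0
  show ?case
    unfolding extendable_def
  proof (intro allI impI)
    fix K :: "nat set" and R :: "nat list set \<Rightarrow> nat option"
    assume K: "card K = 2 * 0 + 1" and R: "partial_col (items n 0) K R" "card (dom R) \<le> 2 * 0"
    obtain y where "K = {y}" using K by (auto simp: card_1_singleton_iff)
    moreover have "R = Map.empty" using R finite_dom_items[OF _ R(1)] n by simp
    ultimately show "\<exists>g. total_col (items n 0) K g \<and> agrees R g"
      by (intro exI[of _ "\<lambda>_. y"]) (auto simp: total_col_def proper_on_def items_0)
  qed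
next
  case (Suc d)
  have n3: "n \<ge> 3" using n by simp
  show ?case
    unfolding extendable_def
  proof (intro allI impI)
    fix K :: "nat set" and \<phi> :: "nat list set \<Rightarrow> nat option"
    assume "card K = 2 * Suc d + 1" and \<phi>: "partial_col (items n (Suc d)) K \<phi>" and "card (dom \<phi>) \<le> 2 * Suc d"
    then have K: "card K = 2 * d + 3" and le: "card (dom \<phi>) \<le> 2 * d + 2" by simp_all
    let ?c = "\<lambda>\<psi> k. card (dom \<psi> \<inter> direction n (Suc d) k)"
    have fin: "finite (dom \<phi>)" by (rule finite_dom_items[OF n3 \<phi>])
    have turned: "\<exists>G. total_col (items n (Suc d)) K G \<and> agrees \<phi> G"
      if i: "i < Suc d" and few: "?c \<phi> i \<le> 1 \<or>
        ?c \<phi> i = 2 \<and> (\<forall>v. \<phi> {v} = None) \<and> (d = 1 \<longrightarrow> \<not> tangled n (turn i \<phi>))" for i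
    proof -
      have "(`) (swap_coord i) ` (dom \<phi> \<inter> direction n (Suc d) i) = dom (turn i \<phi>) \<inter> direction n (Suc d) 0"
      proof
        have "swap_coord i ` e \<in> direction n (Suc d) 0" if "e \<in> direction n (Suc d) i" for e
          using swap_coord_direction[OF i i that] by (cases "i = 0") simp_all
        then show "(`) (swap_coord i) ` (dom \<phi> \<inter> direction n (Suc d) i) \<subseteq> dom (turn i \<phi>) \<inter> direction n (Suc d) 0"
          unfolding dom_turn by blast
        show "dom (turn i \<phi>) \<inter> direction n (Suc d) 0 \<subseteq> (`) (swap_coord i) ` (dom \<phi> \<inter> direction n (Suc d) i)"
        proof
          fix e assume e: "e \<in> dom (turn i \<phi>) \<inter> direction n (Suc d) 0"
          then have "swap_coord i ` e \<in> dom \<phi>" by (auto simp: turn_def)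
          moreover have "swap_coord i ` e \<in> direction n (Suc d) i" using swap_coord_direction[OF i, of 0 e n] e by simp
          ultimately show "e \<in> (`) (swap_coord i) ` (dom \<phi> \<inter> direction n (Suc d) i)"
            by (intro image_eqI[of _ _ "swap_coord i ` e"]) simp_all
        qed
      qed
      then have c: "?c (turn i \<phi>) 0 = ?c \<phi> i" using card_image[OF inj_swap_coord_image] by metis
      have cd: "card (dom (turn i \<phi>)) = card (dom \<phi>)" unfolding dom_turn by (rule card_image[OF inj_swap_coord_image])
      have "(\<forall>v. \<phi> {v} = None) \<Longrightarrow> (\<forall>v. turn i \<phi> {v} = None)" by (simp add: turn_def)
      then obtain G where "total_col (items n (Suc d)) K G" "agrees (turn i \<phi>) G"
        using extend_along_first[OF n Suc.IH K partial_col_turn[OF n3 i \<phi>]] le few c cd by auto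
      then show ?thesis by (rule extension_turn[OF n3 i])
    qed
    show "\<exists>G. total_col (items n (Suc d)) K G \<and> agrees \<phi> G"
    proof (cases "\<exists>i<Suc d. ?c \<phi> i \<le> 1")
      case True then show ?thesis using turned by blast
    next
      case False
      then have two: "?c \<phi> i \<ge> 2" if "i < Suc d" for i using that by (metis Suc_1 not_less_eq_eq)
      let ?U = "\<Union>i\<in>{..<Suc d}. dom \<phi> \<inter> direction n (Suc d) i"
      have "card ?U = (\<Sum>i<Suc d. ?c \<phi> i)"
        by (rule card_UN_disjoint) (use fin direction_disjoint[OF n3] in auto)
      then have U: "(\<Sum>i<Suc d. ?c \<phi> i) = card ?U" by simp
      have low: "(\<Sum>i\<in>A. ?c \<phi> i) \<ge> 2 * card A" if "A \<subseteq> {..<Suc d}" for A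
        using sum_bounded_below[of A 2 "?c \<phi>"] two that by (auto simp: mult.commute)
      have UU: "card ?U \<le> card (dom \<phi>)" using fin by (intro card_mono) auto
      have big: "(\<Sum>i<Suc d. ?c \<phi> i) \<ge> 2 * d + 2" using low[of "{..<Suc d}"] by simp
      have noloop: "\<phi> {v} = None" for v
      proof (rule ccontr)
        assume "\<phi> {v} \<noteq> None"
        then have v: "{v} \<in> dom \<phi>" by blast
        have "{v} \<notin> direction n (Suc d) i" if "i < Suc d" for i
          using direction_two[OF n3 that, of "{v}"] by auto
        then have "?U \<subset> dom \<phi>" using v by auto
        then have "card ?U < card (dom \<phi>)" using fin by (rule psubset_card_mono[rotated])
        then show False using U big le by linarith
      qed
      have eq2: "?c \<phi> i = 2" if i: "i < Suc d" for i
      proof -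
        have "(\<Sum>k<Suc d. ?c \<phi> k) = ?c \<phi> i + (\<Sum>k\<in>{..<Suc d} - {i}. ?c \<phi> k)"
          using i by (intro sum.remove) auto
        moreover have "(\<Sum>k\<in>{..<Suc d} - {i}. ?c \<phi> k) \<ge> 2 * d" using low[of "{..<Suc d} - {i}"] i by simp
        ultimately show ?thesis using two[OF i] U UU le by linarith
      qed
      show ?thesis
      proof (cases "d = 1")
        case False then show ?thesis using turned[of 0] eq2[of 0] noloop by simp
      next
        case True
        have turn0: "turn 0 \<phi> = \<phi>"
        proof
          fix e
          have "swap_coord 0 xs = xs" for xs by (cases xs) (simp_all add: swap_coord_def)
          then show "turn 0 \<phi> e = \<phi> e" by (simp add: turn_def)
        qed
        have "\<not> (tangled n \<phi> \<and> tangled n (turn 1 \<phi>))"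
          using tangled_turn[OF n3, of K \<phi>] \<phi> noloop eq2[of 1] True by (auto simp: numeral_2_eq_2)
        then show ?thesis using turned[of 0] turned[of 1] eq2[of 0] eq2[of 1] noloop turn0 True by auto
      qed
    qed
  qed
qed

theorem theorem4p1:
  fixes d k :: nat and \<phi> :: "nat list set \<Rightarrow> nat option"
  assumes "d \<ge> 1" and "k \<ge> 2"
    and "proper_partial_edge_coloring (cart_power (cycle_graph (2 * k + 1)) d) (2 * d + 1) \<phi>"
    and "card (dom \<phi>) \<le> 2 * d"
  shows "\<exists>f. proper_edge_coloring (cart_power (cycle_graph (2 * k + 1)) d) (2 * d + 1) f
           \<and> (\<forall>e\<in>dom \<phi>. \<phi> e = Some (f e))"
proof -
  let ?n = "2 * k + 1" and ?K = "{1..2 * d + 1}"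
  have sub: "edges (cart_power (cycle_graph ?n) d) \<subseteq> items ?n d" by (auto simp: items_def)
  have \<phi>: "dom \<phi> \<subseteq> edges (cart_power (cycle_graph ?n) d)" "ran \<phi> \<subseteq> ?K"
    and proper: "proper_on (dom \<phi>) (\<lambda>e. the (\<phi> e))"
    using assms(3) by (auto simp: proper_partial_edge_coloring_def)
  have "e = e'" if "\<phi> e = Some x" "\<phi> e' = Some x" "e \<inter> e' \<noteq> {}" for e e' x
  proof (rule ccontr)
    assume "e \<noteq> e'"
    moreover have "e \<in> dom \<phi>" "e' \<in> dom \<phi>" using that by auto
    ultimately have "the (\<phi> e) \<noteq> the (\<phi> e')" using proper that(3) unfolding proper_on_def by blast
    then show False using that by simp
  qed
  then have "partial_col (items ?n d) ?K \<phi>" using \<phi> sub unfolding partial_col_def by blast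
  moreover have "card ?K = 2 * d + 1" by simp
  moreover have "?n \<ge> 5" using assms(2) by simp
  ultimately obtain f where f: "total_col (items ?n d) ?K f" "agrees \<phi> f"
    using extendable_cycle_power[of ?n d] assms(4) unfolding extendable_def by blast
  have "proper_edge_coloring (cart_power (cycle_graph ?n) d) (2 * d + 1) f"
    using f(1) sub unfolding proper_edge_coloring_def total_col_def proper_on_def by blast
  moreover have "\<phi> e = Some (f e)" if "e \<in> dom \<phi>" for e using that f(2) by (auto simp: agrees_def)
  ultimately show ?thesis by blast
qed

end
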